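(* The $\mathcal I^{\mathrm{cb}}$-interpretation (canonical upon the bounding interpretation) is a sound type-informative base interpretation of $\mathrm{HA}^\omega$.
   Context: $\mathrm{HA}^\omega$: intuitionistic theory with finite types generated by $\sigma\to\tau$ from ground types $\mathbb N$, $\mathbb B$; constants: combinators $\Pi,\Sigma$, zero $0^{\mathbb N}$, successor $\mathsf S^{\mathbb N\to\mathbb N}$, recursors $\mathsf R_\sigma:\mathbb N\to\sigma\to(\mathbb N\to\sigma\to\sigma)\to\sigma$ (simultaneous recursion allowed), Booleans $0^{\mathbb B},1^{\mathbb B}$, conditionals $\mathrm{Cond}_\sigma:\mathbb B\to\sigma\to\sigma\to\sigma$; relation symbols: only logical equality $\equiv_\sigma$ at every type. Formulas use $\bot,\wedge,\to,\forall x^\sigma,\exists x^\sigma$; $A\vee B$ abbreviates $\exists i^{\mathbb B}((i\equiv0\to A)\wedge(i\equiv1\to B))$. Axioms: equality and combinator axioms ($\Pi xy\equiv x$, $\Sigma xyz\equiv xz(yz)$); $\mathsf S$ injective, $0\notin\mathrm{range}(\mathsf S)$; $\mathsf R0wf\equiv w$, $\mathsf R(\mathsf Sn)wf\equiv fn(\mathsf Rnwf)$; $\neg(0\equiv_{\mathbb B}1)$; $D(0)\wedge D(1)\to\forall i^{\mathbb B}D(i)$ for all formulas $D$; $\mathrm{Cond}(0,x,y)\equiv x$, $\mathrm{Cond}(1,x,y)\equiv y$; induction for all formulas. Target language: the language of $\mathrm{HA}^\omega$ with the extra type constructor $\sigma\mapsto\sigma^*$ (non-empty finite subsets) and constants for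 singleton, union, indexed union $\bigcup_{w\in t}qw$, membership, combinators and recursors for all these types, and $\mathrm m:\mathbb N^*\to\mathbb N$ (maximum). $\mathcal S^\omega_*$ is the structure with $\mathcal S_{\mathbb N}=\mathbb N$, $\mathcal S_{\mathbb B}=\{0,1\}$, $\mathcal S_{\rho\to\sigma}$ all functions from $\mathcal S_\rho$ to $\mathcal S_\sigma$, $\mathcal S_{\sigma^*}$ all non-empty finite subsets of $\mathcal S_\sigma$. The target theory $T$ is the set of sentences true in $\mathcal S^\omega_*$. Witnessing types are the types generated from $\mathbb N$ by $\to$ and $*$; witnessing terms are terms of such types. $\mathcal L^{\mathcal I}$ adds to the language of $\mathrm{HA}^\omega$ a unary predicate $\mathcal I_\sigma(x^\sigma)$ for each type. Boldface letters are (possibly empty) tuples; $\forall\boldsymbol b\in\boldsymbol B$ is componentwise. $\mathcal I^{\mathrm{cb}}$: $\langle\mathcal I_{\mathbb N}(x)\rangle^n$ is $x\le n$ ($n:\mathbb N$, no negative witnesses); $\mathcal I_{\mathbb B}(i)$ has no witnesses at all and $\langle\mathcal I_{\mathbb B}(i)\rangle$ is true; and at function types $$\langle\mathcal I_{\rho\to\sigma}(h)\rangle^{\boldsymbol f,\boldsymbol g}_{\boldsymbol a,\boldsymbol d}:\equiv\forall x^\rho(\forall\boldsymbol b\in\boldsymbol g\boldsymbol a\boldsymbol d\,\langle\mathcal I_\rho(x)\rangle^{\boldsymbol a}_{\boldsymbol b}\to\langle\mathcal I_\sigma(hx)\rangle^{\boldsymbol f\boldsymbol a}_{\boldsymbol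 d}).$$ $\mathcal U$-interpretation: $\langle x\equiv_\sigma y\rangle$ is $x=y$; $\langle\bot\rangle:\equiv\bot$; $\langle A\wedge B\rangle^{\boldsymbol a,\boldsymbol c}_{\boldsymbol b,\boldsymbol d}:\equiv\langle A\rangle^{\boldsymbol a}_{\boldsymbol b}\wedge\langle B\rangle^{\boldsymbol c}_{\boldsymbol d}$; $\langle A\to B\rangle^{\boldsymbol f,\boldsymbol g}_{\boldsymbol a,\boldsymbol d}:\equiv\forall\boldsymbol b\in\boldsymbol g\boldsymbol a\boldsymbol d\,\langle A\rangle^{\boldsymbol a}_{\boldsymbol b}\to\langle B\rangle^{\boldsymbol f\boldsymbol a}_{\boldsymbol d}$; $\langle\forall xA\rangle^{\boldsymbol a}_{\boldsymbol b}:\equiv\forall x\langle A\rangle^{\boldsymbol a}_{\boldsymbol b}$; $\langle\exists xA\rangle^{\boldsymbol a}_{\boldsymbol B}:\equiv\exists x\forall\boldsymbol b\in\boldsymbol B\langle A\rangle^{\boldsymbol a}_{\boldsymbol b}$. $A(\boldsymbol x)$ is $\mathcal U$-interpretable if there are closed witnessing terms $\boldsymbol t$ with $T\vdash\forall\boldsymbol b\langle A(\boldsymbol x)\rangle^{\boldsymbol t}_{\boldsymbol b}$. $A^{\mathcal I}$ replaces $\forall x^\sigma(\dots)$ by $\forall x^\sigma(\mathcal I_\sigma(x)\to\dots)$ and $\exists x^\sigma(\dots)$ by $\exists x^\sigma(\mathcal I_\sigma(x)\wedge\dots)$. $A(\boldsymbol x)$ is $\mathcal I$-interpretable if $\forall\boldsymbol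 x(\mathcal I(\boldsymbol x)\to A^{\mathcal I}(\boldsymbol x))$ is $\mathcal U$-interpretable. A base interpretation is a sound type-informative base interpretation of $\mathrm{HA}^\omega$ if all $\mathcal I_\sigma(c)$ ($c^\sigma$ a constant of $\mathrm{HA}^\omega$) and all $\forall x^\sigma\forall f^{\sigma\to\tau}(\mathcal I_\sigma(x)\wedge\mathcal I_{\sigma\to\tau}(f)\to\mathcal I_\tau(fx))$ are $\mathcal U$-interpretable, and all non-logical axioms of $\mathrm{HA}^\omega$ are $\mathcal I$-interpretable. *)

theory Defs
  imports Main "HOL-Library.FuncSet"
begin

section \<open>Types and terms\<close>

text \<open>
  Types and terms of the target language. The types and terms of \<open>HA\<^sup>\<omega>\<close> are those
  in which the star constructor and its constants do not occur (\<open>ha_ty\<close>, \<open>ha_tm\<close> below).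
\<close>

datatype ty = TN | TB | Fn ty ty (infixr "\<Rrightarrow>" 65) | Star ty

abbreviation Fns :: "ty list \<Rightarrow> ty \<Rightarrow> ty" where
  "Fns \<rho>s \<sigma> \<equiv> foldr Fn \<rho>s \<sigma>"

text \<open>
  \<open>cRec \<sigma>s i\<close> is the \<open>i\<close>-th component (\<open>i < length \<sigma>s\<close>) of the recursor for simultaneous
  recursion at the tuple \<open>\<sigma>s\<close>; \<open>cRec [\<sigma>] 0\<close> is the ordinary recursor at \<open>\<sigma>\<close>.
  \<open>cB0\<close>, \<open>cB1\<close> are the Booleans 0, 1.
\<close>

datatype cst =
    cZero | cSuc | cPi ty ty | cSigma ty ty ty | cRec "ty list" nat
  | cB0 | cB1 | cCond ty
  | cSing ty | cUnion ty | cBigUnion ty ty | cMax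

definition step_tys :: "ty list \<Rightarrow> ty list" where
  "step_tys \<sigma>s = map (\<lambda>\<tau>. TN \<Rrightarrow> Fns \<sigma>s \<tau>) \<sigma>s"

primrec cst_ty :: "cst \<Rightarrow> ty" where
  "cst_ty cZero = TN"
| "cst_ty cSuc = TN \<Rrightarrow> TN"
| "cst_ty (cPi \<rho> \<sigma>) = \<rho> \<Rrightarrow> \<sigma> \<Rrightarrow> \<rho>"
| "cst_ty (cSigma \<rho> \<sigma> \<tau>) = (\<rho> \<Rrightarrow> \<sigma> \<Rrightarrow> \<tau>) \<Rrightarrow> (\<rho> \<Rrightarrow> \<sigma>) \<Rrightarrow> \<rho> \<Rrightarrow> \<tau>"
| "cst_ty (cRec \<sigma>s i) = Fns (TN # \<sigma>s @ step_tys \<sigma>s) (\<sigma>s ! i)"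
| "cst_ty cB0 = TB"
| "cst_ty cB1 = TB"
| "cst_ty (cCond \<sigma>) = TB \<Rrightarrow> \<sigma> \<Rrightarrow> \<sigma> \<Rrightarrow> \<sigma>"
| "cst_ty (cSing \<sigma>) = \<sigma> \<Rrightarrow> Star \<sigma>"
| "cst_ty (cUnion \<sigma>) = Star \<sigma> \<Rrightarrow> Star \<sigma> \<Rrightarrow> Star \<sigma>"
| "cst_ty (cBigUnion \<rho> \<sigma>) = Star \<rho> \<Rrightarrow> (\<rho> \<Rrightarrow> Star \<sigma>) \<Rrightarrow> Star \<sigma>"
| "cst_ty cMax = Star TN \<Rrightarrow> TN"

fun cst_ok :: "cst \<Rightarrow> bool" where
  "cst_ok (cRec \<sigma>s i) \<longleftrightarrow> i < length \<sigma>s"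
| "cst_ok _ \<longleftrightarrow> True"

text \<open>Variables carry their type; the same index at two types gives two variables.\<close>

type_synonym var = "nat \<times> ty"

datatype tm = Var var | Con cst | App tm tm

abbreviation Apps :: "tm \<Rightarrow> tm list \<Rightarrow> tm" where
  "Apps t ss \<equiv> foldl App t ss"

inductive has_type :: "tm \<Rightarrow> ty \<Rightarrow> bool" where
  "has_type (Var (x, \<sigma>)) \<sigma>"
| "cst_ok c \<Longrightarrow> has_type (Con c) (cst_ty c)"
| "has_type s (\<rho> \<Rrightarrow> \<sigma>) \<Longrightarrow> has_type t \<rho> \<Longrightarrow> has_type (App s t) \<sigma>"

primrec fv_tm :: "tm \<Rightarrow> var list" where
  "fv_tm (Var v) = [v]"
| "fv_tm (Con c) = []"
| "fv_tm (App s t) = fv_tm s @ fv_tm t"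

primrec wit_ty :: "ty \<Rightarrow> bool" where
  "wit_ty TN \<longleftrightarrow> True"
| "wit_ty TB \<longleftrightarrow> False"
| "wit_ty (\<rho> \<Rrightarrow> \<sigma>) \<longleftrightarrow> wit_ty \<rho> \<and> wit_ty \<sigma>"
| "wit_ty (Star \<sigma>) \<longleftrightarrow> wit_ty \<sigma>"

definition witnessing_tm :: "tm \<Rightarrow> bool" where
  "witnessing_tm t \<longleftrightarrow> (\<exists>\<sigma>. wit_ty \<sigma> \<and> has_type t \<sigma>)"


section \<open>Formulas of the target language\<close>

datatype tfm =
    TEq ty tm tm | TMem ty tm tm | TBot | TAnd tfm tfm | TImp tfm tfm
  | TAll var tfm | TEx var tfm

primrec tfm_ok :: "tfm \<Rightarrow> bool" where
  "tfm_ok (TEq \<sigma> s t) \<longleftrightarrow> has_type s \<sigma> \<and> has_type t \<sigma>"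
| "tfm_ok (TMem \<sigma> s t) \<longleftrightarrow> has_type s \<sigma> \<and> has_type t (Star \<sigma>)"
| "tfm_ok TBot \<longleftrightarrow> True"
| "tfm_ok (TAnd \<phi> \<psi>) \<longleftrightarrow> tfm_ok \<phi> \<and> tfm_ok \<psi>"
| "tfm_ok (TImp \<phi> \<psi>) \<longleftrightarrow> tfm_ok \<phi> \<and> tfm_ok \<psi>"
| "tfm_ok (TAll v \<phi>) \<longleftrightarrow> tfm_ok \<phi>"
| "tfm_ok (TEx v \<phi>) \<longleftrightarrow> tfm_ok \<phi>"

primrec fv_tfm :: "tfm \<Rightarrow> var list" where
  "fv_tfm (TEq \<sigma> s t) = fv_tm s @ fv_tm t"
| "fv_tfm (TMem \<sigma> s t) = fv_tm s @ fv_tm t"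
| "fv_tfm TBot = []"
| "fv_tfm (TAnd \<phi> \<psi>) = fv_tfm \<phi> @ fv_tfm \<psi>"
| "fv_tfm (TImp \<phi> \<psi>) = fv_tfm \<phi> @ fv_tfm \<psi>"
| "fv_tfm (TAll v \<phi>) = removeAll v (fv_tfm \<phi>)"
| "fv_tfm (TEx v \<phi>) = removeAll v (fv_tfm \<phi>)"

abbreviation TAlls :: "var list \<Rightarrow> tfm \<Rightarrow> tfm" where
  "TAlls vs \<phi> \<equiv> foldr TAll vs \<phi>"

text \<open>
  \<open>x \<le> n\<close> is not primitive. It is rendered as \<open>\<exists>z. x + z \<equiv> n\<close> with \<open>x + z = R z x (\<Pi> S)\<close>;
  the index \<open>k\<close> of the bound variable must not occur in the two terms.
\<close>

definition plus_tm :: "tm \<Rightarrow> tm \<Rightarrow> tm" where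
  "plus_tm s t = Apps (Con (cRec [TN] 0)) [t, s, App (Con (cPi (TN \<Rrightarrow> TN) TN)) (Con cSuc)]"

definition TLeq :: "nat \<Rightarrow> tm \<Rightarrow> tm \<Rightarrow> tfm" where
  "TLeq k s t = TEx (k, TN) (TEq TN (plus_tm s (Var (k, TN))) t)"

text \<open>
  \<open>TBall bs Bs \<phi>\<close> is the componentwise bounded quantification
  \<open>\<forall>b\<^sub>1 \<in> B\<^sub>1 \<dots> \<forall>b\<^sub>m \<in> B\<^sub>m. \<phi>\<close>, for variables not occurring in the terms \<open>Bs\<close>.
\<close>

fun TBall :: "var list \<Rightarrow> tm list \<Rightarrow> tfm \<Rightarrow> tfm" where
  "TBall (b # bs) (B # Bs) \<phi> = TAll b (TImp (TMem (snd b) (Var b) B) (TBall bs Bs \<phi>))"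
| "TBall _ _ \<phi> = \<phi>"


section \<open>The full set-theoretic structure and its theory\<close>

text \<open>
  \<open>\<S>\<^sup>\<omega>\<^sub>*\<close> is described up to isomorphism: \<open>obj S \<sigma>\<close> is the set of objects of type \<open>\<sigma>\<close>, as
  a subset of a carrier type \<open>'u\<close>; \<open>num S\<close> and \<open>bl S\<close> enumerate the objects of ground type;
  \<open>ap S\<close> is function application and \<open>elts S\<close> the set of elements of an object of star type.
  The carrier has to be a parameter: the union of all \<open>obj S \<sigma>\<close> has cardinality
  \<open>\<beth>\<^sub>\<omega>\<close>, and no type of that size can be constructed in HOL. That \<open>ap\<close> and \<open>elts\<close> do not
  depend on types is no restriction, since objects of different types may be taken distinct.
\<close>

record 'u type_structure =
  obj :: "ty \<Rightarrow> 'u set"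
  num :: "nat \<Rightarrow> 'u"
  bl :: "bool \<Rightarrow> 'u"
  ap :: "'u \<Rightarrow> 'u \<Rightarrow> 'u"
  elts :: "'u \<Rightarrow> 'u set"

definition full_structure :: "'u type_structure \<Rightarrow> bool" where
  "full_structure S \<longleftrightarrow>
     bij_betw (num S) UNIV (obj S TN) \<and>
     bij_betw (bl S) UNIV (obj S TB) \<and>
     (\<forall>\<rho> \<sigma>. bij_betw (\<lambda>f. restrict (ap S f) (obj S \<rho>)) (obj S (\<rho> \<Rrightarrow> \<sigma>))
               (obj S \<rho> \<rightarrow>\<^sub>E obj S \<sigma>)) \<and>
     (\<forall>\<sigma>. bij_betw (elts S) (obj S (Star \<sigma>)) {X. X \<subseteq> obj S \<sigma> \<and> finite X \<and> X \<noteq> {}})"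

definition nat_of :: "'u type_structure \<Rightarrow> 'u \<Rightarrow> nat" where
  "nat_of S u = (THE n. num S n = u)"

definition lam :: "'u type_structure \<Rightarrow> ty \<Rightarrow> ty \<Rightarrow> ('u \<Rightarrow> 'u) \<Rightarrow> 'u" where
  "lam S \<rho> \<sigma> F = (THE f. f \<in> obj S (\<rho> \<Rrightarrow> \<sigma>) \<and> (\<forall>x\<in>obj S \<rho>. ap S f x = F x))"

definition mk_set :: "'u type_structure \<Rightarrow> ty \<Rightarrow> 'u set \<Rightarrow> 'u" where
  "mk_set S \<sigma> X = (THE u. u \<in> obj S (Star \<sigma>) \<and> elts S u = X)"

text \<open>The curried function of type \<open>Fns \<rho>s \<sigma>\<close> given by a function of the argument list.\<close>

primrec lams :: "'u type_structure \<Rightarrow> ty list \<Rightarrow> ty \<Rightarrow> ('u list \<Rightarrow> 'u) \<Rightarrow> 'u" where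
  "lams S [] \<sigma> F = F []"
| "lams S (\<rho> # \<rho>s) \<sigma> F = lam S \<rho> (Fns \<rho>s \<sigma>) (\<lambda>x. lams S \<rho>s \<sigma> (\<lambda>xs. F (x # xs)))"

primrec rec_val :: "'u type_structure \<Rightarrow> nat \<Rightarrow> 'u list \<Rightarrow> 'u list \<Rightarrow> 'u list" where
  "rec_val S 0 ws fs = ws"
| "rec_val S (Suc n) ws fs =
     map (\<lambda>f. foldl (ap S) (ap S f (num S n)) (rec_val S n ws fs)) fs"

primrec cst_val :: "'u type_structure \<Rightarrow> cst \<Rightarrow> 'u" where
  "cst_val S cZero = num S 0"
| "cst_val S cSuc = lams S [TN] TN (\<lambda>xs. num S (Suc (nat_of S (xs ! 0))))"
| "cst_val S (cPi \<rho> \<sigma>) = lams S [\<rho>, \<sigma>] \<rho> (\<lambda>xs. xs ! 0)"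
| "cst_val S (cSigma \<rho> \<sigma> \<tau>) = lams S [\<rho> \<Rrightarrow> \<sigma> \<Rrightarrow> \<tau>, \<rho> \<Rrightarrow> \<sigma>, \<rho>] \<tau>
     (\<lambda>xs. ap S (ap S (xs ! 0) (xs ! 2)) (ap S (xs ! 1) (xs ! 2)))"
| "cst_val S (cRec \<sigma>s i) = lams S (TN # \<sigma>s @ step_tys \<sigma>s) (\<sigma>s ! i)
     (\<lambda>xs. rec_val S (nat_of S (hd xs)) (take (length \<sigma>s) (tl xs)) (drop (length \<sigma>s) (tl xs)) ! i)"
| "cst_val S cB0 = bl S False"
| "cst_val S cB1 = bl S True"
| "cst_val S (cCond \<sigma>) = lams S [TB, \<sigma>, \<sigma>] \<sigma>
     (\<lambda>xs. if xs ! 0 = bl S False then xs ! 1 else xs ! 2)"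
| "cst_val S (cSing \<sigma>) = lams S [\<sigma>] (Star \<sigma>) (\<lambda>xs. mk_set S \<sigma> {xs ! 0})"
| "cst_val S (cUnion \<sigma>) = lams S [Star \<sigma>, Star \<sigma>] (Star \<sigma>)
     (\<lambda>xs. mk_set S \<sigma> (elts S (xs ! 0) \<union> elts S (xs ! 1)))"
| "cst_val S (cBigUnion \<rho> \<sigma>) = lams S [Star \<rho>, \<rho> \<Rrightarrow> Star \<sigma>] (Star \<sigma>)
     (\<lambda>xs. mk_set S \<sigma> (\<Union>w\<in>elts S (xs ! 0). elts S (ap S (xs ! 1) w)))"
| "cst_val S cMax = lams S [Star TN] TN (\<lambda>xs. num S (Max (nat_of S ` elts S (xs ! 0))))"

primrec tm_val :: "'u type_structure \<Rightarrow> (var \<Rightarrow> 'u) \<Rightarrow> tm \<Rightarrow> 'u" where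
  "tm_val S e (Var v) = e v"
| "tm_val S e (Con c) = cst_val S c"
| "tm_val S e (App s t) = ap S (tm_val S e s) (tm_val S e t)"

primrec sat :: "'u type_structure \<Rightarrow> (var \<Rightarrow> 'u) \<Rightarrow> tfm \<Rightarrow> bool" where
  "sat S e (TEq \<sigma> s t) \<longleftrightarrow> tm_val S e s = tm_val S e t"
| "sat S e (TMem \<sigma> s t) \<longleftrightarrow> tm_val S e s \<in> elts S (tm_val S e t)"
| "sat S e TBot \<longleftrightarrow> False"
| "sat S e (TAnd \<phi> \<psi>) \<longleftrightarrow> sat S e \<phi> \<and> sat S e \<psi>"
| "sat S e (TImp \<phi> \<psi>) \<longleftrightarrow> (sat S e \<phi> \<longrightarrow> sat S e \<psi>)"
| "sat S e (TAll v \<phi>) \<longleftrightarrow> (\<forall>u\<in>obj S (snd v). sat S (e(v := u)) \<phi>)"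
| "sat S e (TEx v \<phi>) \<longleftrightarrow> (\<exists>u\<in>obj S (snd v). sat S (e(v := u)) \<phi>)"

definition valuation :: "'u type_structure \<Rightarrow> (var \<Rightarrow> 'u) \<Rightarrow> bool" where
  "valuation S e \<longleftrightarrow> (\<forall>v. e v \<in> obj S (snd v))"

definition target_theory :: "'u type_structure \<Rightarrow> tfm set" where
  "target_theory S =
     {\<phi>. tfm_ok \<phi> \<and> fv_tfm \<phi> = [] \<and> (\<forall>e. valuation S e \<longrightarrow> sat S e \<phi>)}"

text \<open>
  The theory of a structure is deductively closed, so a formula is derivable from it
  iff the universal closure of the formula belongs to it.
\<close>

definition proves :: "tfm set \<Rightarrow> tfm \<Rightarrow> bool" (infix "\<turnstile>" 50) where
  "T \<turnstile> \<phi> \<longleftrightarrow> TAlls (fv_tfm \<phi>) \<phi> \<in> T"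


section \<open>Formulas of \<open>HA\<^sup>\<omega>\<close> and of its extension by the predicates \<open>\<I>\<^sub>\<sigma>\<close>\<close>

text \<open>\<open>IAt \<sigma> t\<close> is the atomic formula \<open>\<I>\<^sub>\<sigma>(t)\<close>.\<close>

datatype fm =
    Eq ty tm tm | IAt ty tm | Bot | And fm fm | Imp fm fm | All var fm | Ex var fm

abbreviation Neg :: "fm \<Rightarrow> fm" where "Neg A \<equiv> Imp A Bot"
abbreviation Top :: fm where "Top \<equiv> Imp Bot Bot"

abbreviation Alls :: "var list \<Rightarrow> fm \<Rightarrow> fm" where
  "Alls vs A \<equiv> foldr All vs A"

primrec ha_ty :: "ty \<Rightarrow> bool" where
  "ha_ty TN \<longleftrightarrow> True"
| "ha_ty TB \<longleftrightarrow> True"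
| "ha_ty (\<rho> \<Rrightarrow> \<sigma>) \<longleftrightarrow> ha_ty \<rho> \<and> ha_ty \<sigma>"
| "ha_ty (Star \<sigma>) \<longleftrightarrow> False"

primrec ha_cst :: "cst \<Rightarrow> bool" where
  "ha_cst cZero \<longleftrightarrow> True"
| "ha_cst cSuc \<longleftrightarrow> True"
| "ha_cst (cPi \<rho> \<sigma>) \<longleftrightarrow> ha_ty \<rho> \<and> ha_ty \<sigma>"
| "ha_cst (cSigma \<rho> \<sigma> \<tau>) \<longleftrightarrow> ha_ty \<rho> \<and> ha_ty \<sigma> \<and> ha_ty \<tau>"
| "ha_cst (cRec \<sigma>s i) \<longleftrightarrow> i < length \<sigma>s \<and> (\<forall>\<sigma>\<in>set \<sigma>s. ha_ty \<sigma>)"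
| "ha_cst cB0 \<longleftrightarrow> True"
| "ha_cst cB1 \<longleftrightarrow> True"
| "ha_cst (cCond \<sigma>) \<longleftrightarrow> ha_ty \<sigma>"
| "ha_cst (cSing \<sigma>) \<longleftrightarrow> False"
| "ha_cst (cUnion \<sigma>) \<longleftrightarrow> False"
| "ha_cst (cBigUnion \<rho> \<sigma>) \<longleftrightarrow> False"
| "ha_cst cMax \<longleftrightarrow> False"

primrec ha_tm :: "tm \<Rightarrow> bool" where
  "ha_tm (Var v) \<longleftrightarrow> ha_ty (snd v)"
| "ha_tm (Con c) \<longleftrightarrow> ha_cst c"
| "ha_tm (App s t) \<longleftrightarrow> ha_tm s \<and> ha_tm t"

primrec ha_fm :: "fm \<Rightarrow> bool" where
  "ha_fm (Eq \<sigma> s t) \<longleftrightarrow> ha_tm s \<and> has_type s \<sigma> \<and> ha_tm t \<and> has_type t \<sigma>"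
| "ha_fm (IAt \<sigma> t) \<longleftrightarrow> False"
| "ha_fm Bot \<longleftrightarrow> True"
| "ha_fm (And A B) \<longleftrightarrow> ha_fm A \<and> ha_fm B"
| "ha_fm (Imp A B) \<longleftrightarrow> ha_fm A \<and> ha_fm B"
| "ha_fm (All v A) \<longleftrightarrow> ha_ty (snd v) \<and> ha_fm A"
| "ha_fm (Ex v A) \<longleftrightarrow> ha_ty (snd v) \<and> ha_fm A"

primrec fv :: "fm \<Rightarrow> var list" where
  "fv (Eq \<sigma> s t) = fv_tm s @ fv_tm t"
| "fv (IAt \<sigma> t) = fv_tm t"
| "fv Bot = []"
| "fv (And A B) = fv A @ fv B"
| "fv (Imp A B) = fv A @ fv B"
| "fv (All v A) = removeAll v (fv A)"
| "fv (Ex v A) = removeAll v (fv A)"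

primrec subst_tm :: "var \<Rightarrow> tm \<Rightarrow> tm \<Rightarrow> tm" where
  "subst_tm v r (Var w) = (if w = v then r else Var w)"
| "subst_tm v r (Con c) = Con c"
| "subst_tm v r (App s t) = App (subst_tm v r s) (subst_tm v r t)"

text \<open>Substitution for the free occurrences of \<open>v\<close>, without renaming of bound variables.\<close>

primrec subst :: "var \<Rightarrow> tm \<Rightarrow> fm \<Rightarrow> fm" where
  "subst v r (Eq \<sigma> s t) = Eq \<sigma> (subst_tm v r s) (subst_tm v r t)"
| "subst v r (IAt \<sigma> t) = IAt \<sigma> (subst_tm v r t)"
| "subst v r Bot = Bot"
| "subst v r (And A B) = And (subst v r A) (subst v r B)"
| "subst v r (Imp A B) = Imp (subst v r A) (subst v r B)"
| "subst v r (All w A) = All w (if w = v then A else subst v r A)"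
| "subst v r (Ex w A) = Ex w (if w = v then A else subst v r A)"

text \<open>\<open>free_for v r A\<close>: no variable of \<open>r\<close> is captured in \<open>subst v r A\<close>.\<close>

primrec free_for :: "var \<Rightarrow> tm \<Rightarrow> fm \<Rightarrow> bool" where
  "free_for v r (Eq \<sigma> s t) \<longleftrightarrow> True"
| "free_for v r (IAt \<sigma> t) \<longleftrightarrow> True"
| "free_for v r Bot \<longleftrightarrow> True"
| "free_for v r (And A B) \<longleftrightarrow> free_for v r A \<and> free_for v r B"
| "free_for v r (Imp A B) \<longleftrightarrow> free_for v r A \<and> free_for v r B"
| "free_for v r (All w A) \<longleftrightarrow>
     v \<notin> set (fv (All w A)) \<or> (w \<notin> set (fv_tm r) \<and> free_for v r A)"
| "free_for v r (Ex w A) \<longleftrightarrow>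
     v \<notin> set (fv (Ex w A)) \<or> (w \<notin> set (fv_tm r) \<and> free_for v r A)"


section \<open>The non-logical axioms of \<open>HA\<^sup>\<omega>\<close>\<close>

text \<open>
  In the axioms \<open>x, y, z, f, w, n, \<dots>\<close> are arbitrary variables of the indicated types.
  The substitutions in the rules \<open>bool_cases\<close> and \<open>induction\<close> cannot capture variables.
\<close>

inductive ha_axiom :: "fm \<Rightarrow> bool" where
  eq_refl: "ha_ty \<sigma> \<Longrightarrow> ha_axiom (Eq \<sigma> (Var (x, \<sigma>)) (Var (x, \<sigma>)))"
| eq_repl: "ha_ty \<sigma> \<Longrightarrow> ha_fm A \<Longrightarrow>
    free_for (z, \<sigma>) (Var (x, \<sigma>)) A \<Longrightarrow> free_for (z, \<sigma>) (Var (y, \<sigma>)) A \<Longrightarrow>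
    ha_axiom (Imp (And (Eq \<sigma> (Var (x, \<sigma>)) (Var (y, \<sigma>))) (subst (z, \<sigma>) (Var (x, \<sigma>)) A))
                  (subst (z, \<sigma>) (Var (y, \<sigma>)) A))"
| Pi: "ha_ty \<rho> \<Longrightarrow> ha_ty \<sigma> \<Longrightarrow>
    ha_axiom (Eq \<rho> (Apps (Con (cPi \<rho> \<sigma>)) [Var (x, \<rho>), Var (y, \<sigma>)]) (Var (x, \<rho>)))"
| Sigma: "ha_ty \<rho> \<Longrightarrow> ha_ty \<sigma> \<Longrightarrow> ha_ty \<tau> \<Longrightarrow>
    vx = (x, \<rho> \<Rrightarrow> \<sigma> \<Rrightarrow> \<tau>) \<Longrightarrow> vy = (y, \<rho> \<Rrightarrow> \<sigma>) \<Longrightarrow> vz = (z, \<rho>) \<Longrightarrow>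
    ha_axiom (Eq \<tau> (Apps (Con (cSigma \<rho> \<sigma> \<tau>)) [Var vx, Var vy, Var vz])
                   (App (App (Var vx) (Var vz)) (App (Var vy) (Var vz))))"
| suc_inj:
    "ha_axiom (Imp (Eq TN (App (Con cSuc) (Var (x, TN))) (App (Con cSuc) (Var (y, TN))))
                   (Eq TN (Var (x, TN)) (Var (y, TN))))"
| zero_suc: "ha_axiom (Neg (Eq TN (App (Con cSuc) (Var (x, TN))) (Con cZero)))"
| rec_zero: "\<forall>\<sigma>\<in>set \<sigma>s. ha_ty \<sigma> \<Longrightarrow> i < length \<sigma>s \<Longrightarrow>
    map snd ws = \<sigma>s \<Longrightarrow> map snd fs = step_tys \<sigma>s \<Longrightarrow>
    ha_axiom (Eq (\<sigma>s ! i)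
      (Apps (Con (cRec \<sigma>s i)) (Con cZero # map Var ws @ map Var fs))
      (Var (ws ! i)))"
| rec_suc: "\<forall>\<sigma>\<in>set \<sigma>s. ha_ty \<sigma> \<Longrightarrow> i < length \<sigma>s \<Longrightarrow>
    map snd ws = \<sigma>s \<Longrightarrow> map snd fs = step_tys \<sigma>s \<Longrightarrow>
    ha_axiom (Eq (\<sigma>s ! i)
      (Apps (Con (cRec \<sigma>s i)) (App (Con cSuc) (Var (n, TN)) # map Var ws @ map Var fs))
      (Apps (Var (fs ! i)) (Var (n, TN) #
        map (\<lambda>j. Apps (Con (cRec \<sigma>s j)) (Var (n, TN) # map Var ws @ map Var fs))
          [0..<length \<sigma>s])))"
| bool_distinct: "ha_axiom (Neg (Eq TB (Con cB0) (Con cB1)))"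
| bool_cases: "ha_fm D \<Longrightarrow>
    ha_axiom (Imp (And (subst (i, TB) (Con cB0) D) (subst (i, TB) (Con cB1) D)) (All (i, TB) D))"
| cond_0: "ha_ty \<sigma> \<Longrightarrow>
    ha_axiom (Eq \<sigma> (Apps (Con (cCond \<sigma>)) [Con cB0, Var (x, \<sigma>), Var (y, \<sigma>)]) (Var (x, \<sigma>)))"
| cond_1: "ha_ty \<sigma> \<Longrightarrow>
    ha_axiom (Eq \<sigma> (Apps (Con (cCond \<sigma>)) [Con cB1, Var (x, \<sigma>), Var (y, \<sigma>)]) (Var (y, \<sigma>)))"
| induction: "ha_fm D \<Longrightarrow>
    ha_axiom (Imp (And (subst (n, TN) (Con cZero) D)
                       (All (n, TN) (Imp D (subst (n, TN) (App (Con cSuc) (Var (n, TN))) D))))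
                  (All (n, TN) D))"


section \<open>The \<open>\<U>\<close>-interpretation upon a base interpretation\<close>

text \<open>
  A base interpretation gives for each \<open>\<I>\<^sub>\<sigma>(t)\<close> the types of its positive and negative witnesses
  and, for terms \<open>ps\<close>, \<open>ns\<close> of these types, the target formula with \<open>ps\<close>, \<open>ns\<close> in place of the
  witness variables. Throughout, the number \<open>k\<close> is a strict upper bound of the indices of all
  variables occurring in the other arguments; new bound variables have indices \<open>\<ge> k\<close>.
\<close>

record base_interp =
  bpos :: "ty \<Rightarrow> ty list"
  bneg :: "ty \<Rightarrow> ty list"
  bfm :: "nat \<Rightarrow> ty \<Rightarrow> tm \<Rightarrow> tm list \<Rightarrow> tm list \<Rightarrow> tfm"

text \<open>Types of the positive and negative witnesses of a formula.\<close>

abbreviation imp_pos :: "ty list \<Rightarrow> ty list \<Rightarrow> ty list \<Rightarrow> ty list \<Rightarrow> ty list" where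
  "imp_pos as bs cs ds \<equiv> map (Fns as) cs @ map (\<lambda>\<beta>. Fns (as @ ds) (Star \<beta>)) bs"

primrec pos_neg :: "base_interp \<Rightarrow> fm \<Rightarrow> ty list \<times> ty list" where
  "pos_neg I (Eq \<sigma> s t) = ([], [])"
| "pos_neg I (IAt \<sigma> t) = (bpos I \<sigma>, bneg I \<sigma>)"
| "pos_neg I Bot = ([], [])"
| "pos_neg I (And A B) =
     (case (pos_neg I A, pos_neg I B) of ((as, bs), (cs, ds)) \<Rightarrow> (as @ cs, bs @ ds))"
| "pos_neg I (Imp A B) =
     (case (pos_neg I A, pos_neg I B) of ((as, bs), (cs, ds)) \<Rightarrow> (imp_pos as bs cs ds, as @ ds))"
| "pos_neg I (All v A) = pos_neg I A"
| "pos_neg I (Ex v A) = (case pos_neg I A of (as, bs) \<Rightarrow> (as, map Star bs))"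

abbreviation "pos I A \<equiv> fst (pos_neg I A)"
abbreviation "neg I A \<equiv> snd (pos_neg I A)"

definition new_vars :: "nat \<Rightarrow> ty list \<Rightarrow> var list" where
  "new_vars k \<sigma>s = zip [k..<k + length \<sigma>s] \<sigma>s"

primrec interp :: "base_interp \<Rightarrow> nat \<Rightarrow> fm \<Rightarrow> tm list \<Rightarrow> tm list \<Rightarrow> tfm" where
  "interp I k (Eq \<sigma> s t) ps ns = TEq \<sigma> s t"
| "interp I k (IAt \<sigma> t) ps ns = bfm I k \<sigma> t ps ns"
| "interp I k Bot ps ns = TBot"
| "interp I k (And A B) ps ns =
     TAnd (interp I k A (take (length (pos I A)) ps) (take (length (neg I A)) ns))
          (interp I k B (drop (length (pos I A)) ps) (drop (length (neg I A)) ns))"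
| "interp I k (Imp A B) ps ns =
     (let fs = take (length (pos I B)) ps; gs = drop (length (pos I B)) ps;
          as = take (length (pos I A)) ns; ds = drop (length (pos I A)) ns;
          bs = new_vars k (neg I A)
      in TImp (TBall bs (map (\<lambda>g. Apps g (as @ ds)) gs)
                 (interp I (k + length bs) A as (map Var bs)))
              (interp I k B (map (\<lambda>f. Apps f as) fs) ds))"
| "interp I k (All v A) ps ns = TAll v (interp I k A ps ns)"
| "interp I k (Ex v A) ps ns =
     (let bs = new_vars k (neg I A)
      in TEx v (TBall bs ns (interp I (k + length bs) A ps (map Var bs))))"

primrec bound_tm :: "tm \<Rightarrow> nat" where
  "bound_tm (Var v) = Suc (fst v)"
| "bound_tm (Con c) = 0"
| "bound_tm (App s t) = max (bound_tm s) (bound_tm t)"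

primrec bound_fm :: "fm \<Rightarrow> nat" where
  "bound_fm (Eq \<sigma> s t) = max (bound_tm s) (bound_tm t)"
| "bound_fm (IAt \<sigma> t) = bound_tm t"
| "bound_fm Bot = 0"
| "bound_fm (And A B) = max (bound_fm A) (bound_fm B)"
| "bound_fm (Imp A B) = max (bound_fm A) (bound_fm B)"
| "bound_fm (All v A) = max (Suc (fst v)) (bound_fm A)"
| "bound_fm (Ex v A) = max (Suc (fst v)) (bound_fm A)"

definition U_interpretable :: "'u type_structure \<Rightarrow> base_interp \<Rightarrow> fm \<Rightarrow> bool" where
  "U_interpretable S I A \<longleftrightarrow>
     (\<exists>ts. list_all2 has_type ts (pos I A) \<and>
           (\<forall>t\<in>set ts. witnessing_tm t \<and> fv_tm t = []) \<and>
           (let bs = new_vars (bound_fm A) (neg I A)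
            in target_theory S \<turnstile>
                 TAlls bs (interp I (bound_fm A + length bs) A ts (map Var bs))))"

primrec relativize :: "fm \<Rightarrow> fm" where
  "relativize (Eq \<sigma> s t) = Eq \<sigma> s t"
| "relativize (IAt \<sigma> t) = IAt \<sigma> t"
| "relativize Bot = Bot"
| "relativize (And A B) = And (relativize A) (relativize B)"
| "relativize (Imp A B) = Imp (relativize A) (relativize B)"
| "relativize (All v A) = All v (Imp (IAt (snd v) (Var v)) (relativize A))"
| "relativize (Ex v A) = Ex v (And (IAt (snd v) (Var v)) (relativize A))"

text \<open>\<open>\<I>(x\<^sub>1) \<and> \<dots> \<and> \<I>(x\<^sub>m) \<and> \<top>\<close>; the trailing \<open>\<top>\<close> has no witnesses and covers the empty tuple.\<close>

abbreviation IAt_tuple :: "var list \<Rightarrow> fm" where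
  "IAt_tuple vs \<equiv> foldr And (map (\<lambda>v. IAt (snd v) (Var v)) vs) Top"

definition I_interpretable :: "'u type_structure \<Rightarrow> base_interp \<Rightarrow> fm \<Rightarrow> bool" where
  "I_interpretable S I A \<longleftrightarrow>
     (let xs = remdups (fv A) in U_interpretable S I (Alls xs (Imp (IAt_tuple xs) (relativize A))))"

definition sound_type_informative_base_interp :: "'u type_structure \<Rightarrow> base_interp \<Rightarrow> bool" where
  "sound_type_informative_base_interp S I \<longleftrightarrow>
     (\<forall>c. ha_cst c \<longrightarrow> U_interpretable S I (IAt (cst_ty c) (Con c))) \<and>
     (\<forall>\<sigma> \<tau>. ha_ty \<sigma> \<longrightarrow> ha_ty \<tau> \<longrightarrow>
        (let x = (0, \<sigma>); f = (1, \<sigma> \<Rrightarrow> \<tau>)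
         in U_interpretable S I
              (All x (All f (Imp (And (IAt \<sigma> (Var x)) (IAt (\<sigma> \<Rrightarrow> \<tau>) (Var f)))
                                 (IAt \<tau> (App (Var f) (Var x)))))))) \<and>
     (\<forall>A. ha_axiom A \<longrightarrow> I_interpretable S I A)"


section \<open>The interpretation \<open>\<I>\<^sup>c\<^sup>b\<close>\<close>

text \<open>There are no predicates \<open>\<I>\<^sub>\<sigma>\<close> at star types; the clauses for \<open>Star\<close> are dummies.\<close>

primrec cb_pos_neg :: "ty \<Rightarrow> ty list \<times> ty list" where
  "cb_pos_neg TN = ([TN], [])"
| "cb_pos_neg TB = ([], [])"
| "cb_pos_neg (\<rho> \<Rrightarrow> \<sigma>) =
     (case (cb_pos_neg \<rho>, cb_pos_neg \<sigma>) of ((as, bs), (cs, ds)) \<Rightarrow> (imp_pos as bs cs ds, as @ ds))"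
| "cb_pos_neg (Star \<sigma>) = ([], [])"

abbreviation "cb_pos \<sigma> \<equiv> fst (cb_pos_neg \<sigma>)"
abbreviation "cb_neg \<sigma> \<equiv> snd (cb_pos_neg \<sigma>)"

primrec cb_fm :: "ty \<Rightarrow> nat \<Rightarrow> tm \<Rightarrow> tm list \<Rightarrow> tm list \<Rightarrow> tfm" where
  "cb_fm TN k h ps ns = TLeq k h (hd ps)"
| "cb_fm TB k h ps ns = TImp TBot TBot"
| "cb_fm (\<rho> \<Rrightarrow> \<sigma>) k h ps ns =
     (let fs = take (length (cb_pos \<sigma>)) ps; gs = drop (length (cb_pos \<sigma>)) ps;
          as = take (length (cb_pos \<rho>)) ns; ds = drop (length (cb_pos \<rho>)) ns;
          x = (k, \<rho>); bs = new_vars (Suc k) (cb_neg \<rho>); k' = Suc k + length bs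
      in TAll x (TImp (TBall bs (map (\<lambda>g. Apps g (as @ ds)) gs)
                         (cb_fm \<rho> k' (Var x) as (map Var bs)))
                      (cb_fm \<sigma> k' (App h (Var x)) (map (\<lambda>f. Apps f as) fs) ds)))"
| "cb_fm (Star \<sigma>) k h ps ns = TBot"

definition I_cb :: base_interp where
  "I_cb = \<lparr>bpos = cb_pos, bneg = cb_neg, bfm = (\<lambda>k \<sigma>. cb_fm \<sigma> k)\<rparr>"

end

theory Submission
  imports Defs
begin

text \<open>
  A function of finitely many objects is definable if it is the value of a closed term.
  Definable functions are closed under composition, abstraction (by \<open>\<Pi>\<close> and \<open>\<Sigma>\<close>),
  finite unions and recursion. Let \<open>A \<tturnstile> B\<close> mean that \<open>A \<rightarrow> B\<close> has definable realizers that work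
  for all values of the free variables. The rules of intuitionistic logic hold for \<open>\<tturnstile>\<close>, where
  cut and contraction use unions of sets of negative witnesses. Three more facts suffice.

  The clause for \<open>\<I>\<^bsub>\<rho>\<rightarrow>\<sigma>\<^esub>(h)\<close> is the interpretation of \<open>\<forall>x. \<I>\<^sub>\<rho>(x) \<rightarrow> \<I>\<^sub>\<sigma>(h x)\<close>, hence the
  constants are treated by logical derivations from their defining equations.

  Positive witnesses have a join (maximum on \<open>\<nat>\<close>, pointwise at function types, union at star
  types), and joining a witness with any other one preserves realization. A join of witnesses for
  both cases therefore realizes a distinction of cases over a Boolean, about which a realizer knows
  nothing.

  A bound \<open>N\<close> is all that a realizer knows about a number \<open>n\<close>. Iterating the realizer of an
  induction step and taking joins yields a witness that is valid for all \<open>n \<le> N\<close> at once; applied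
  to implications \<open>P \<rightarrow> D\<close>, this gives induction over arbitrary hypotheses and the recursors.
\<close>

section \<open>The full structure\<close>

text \<open>Quantifiers add no witness for the quantified value. Realizers are therefore chosen
  before the values of the variables, and whatever they use about a value has to come through
  \<open>\<I>\<close>.

  Arguments are carried out with functions on objects rather than with terms, which keeps
  substitution and beta conversion out of them. Syntax returns only at the end: closed terms are
  read off definable functions of no argument, and truth of the interpreted formula is compared with
  its semantic clauses.

  Joins preserve realization of an implication because the argument tuple \<open>a\<close> stays
  fixed: the values of the \<open>f\<close> are joined, and the challenge sets given by the
  \<open>g\<close> only grow, which makes the premise more demanding.

  A side hypothesis \<open>P\<close> of an induction would force its challenges to be collected
  along the recursion. With \<open>P \<rightarrow> D\<close> as the induction statement these
  challenges are part of its positive witnesses, so that the recursor and the joins carry them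
  along.\<close>

lemma bij_betw_the:
  assumes "bij_betw f A B" "y \<in> B"
  shows "\<exists>!x. x \<in> A \<and> f x = y"
  using assms unfolding bij_betw_def inj_on_def by blast

locale full =
  fixes S :: "'u type_structure"
  assumes full: "full_structure S"
begin

abbreviation app (infixl "\<cdot>" 75) where "f \<cdot> x \<equiv> ap S f x"
abbreviation apps (infixl "\<cdot>\<cdot>" 75) where "f \<cdot>\<cdot> xs \<equiv> foldl (ap S) f xs"

definition objs :: "ty list \<Rightarrow> 'u list \<Rightarrow> bool" where
  "objs \<Gamma> xs \<longleftrightarrow> list_all2 (\<lambda>x \<sigma>. x \<in> obj S \<sigma>) xs \<Gamma>"

lemma objs_Nil [simp]: "objs [] xs \<longleftrightarrow> xs = []" "objs \<Gamma> [] \<longleftrightarrow> \<Gamma> = []"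
  by (auto simp: objs_def)

lemma objs_Cons [simp]: "objs (\<gamma> # \<Gamma>) (x # xs) \<longleftrightarrow> x \<in> obj S \<gamma> \<and> objs \<Gamma> xs"
  by (auto simp: objs_def)

lemma objs_ConsE:
  assumes "objs (\<gamma> # \<Gamma>) xs"
  obtains y ys where "xs = y # ys" "y \<in> obj S \<gamma>" "objs \<Gamma> ys"
  using assms by (cases xs) (auto simp: objs_def)

lemma objs_appendI: "objs \<Gamma> xs \<Longrightarrow> objs \<Delta> ys \<Longrightarrow> objs (\<Gamma> @ \<Delta>) (xs @ ys)"
  by (auto simp: objs_def intro: list_all2_appendI)

lemma objs_appendE:
  assumes "objs (\<Gamma> @ \<Delta>) zs"
  obtains xs ys where "zs = xs @ ys" "objs \<Gamma> xs" "objs \<Delta> ys"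
  using assms by (auto simp: objs_def list_all2_append2)

lemma objs_length: "objs \<Gamma> xs \<Longrightarrow> length xs = length \<Gamma>"
  by (auto simp: objs_def dest: list_all2_lengthD)

lemma objs_conv_nth:
  "objs \<Gamma> xs \<longleftrightarrow> length xs = length \<Gamma> \<and> (\<forall>i<length \<Gamma>. xs ! i \<in> obj S (\<Gamma> ! i))"
  by (auto simp: objs_def list_all2_conv_all_nth)

section \<open>Ground objects, functions and finite sets of the structure\<close>

lemma num_in [simp]: "num S n \<in> obj S TN"
  using full by (auto simp: full_structure_def bij_betw_def)

lemma nat_of_num [simp]: "nat_of S (num S n) = n"
proof -
  have "inj (num S)" using full by (auto simp: full_structure_def bij_betw_def)
  then show ?thesis unfolding nat_of_def by (auto simp: inj_def)
qed

lemma num_inj [simp]: "num S m = num S n \<longleftrightarrow> m = n"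
  by (metis nat_of_num)

lemma num_cases:
  assumes "u \<in> obj S TN" obtains n where "u = num S n"
proof -
  have "u \<in> range (num S)" using assms full by (auto simp: full_structure_def bij_betw_def)
  then show thesis using that by blast
qed

lemma num_nat_of [simp]: "u \<in> obj S TN \<Longrightarrow> num S (nat_of S u) = u"
  by (auto elim: num_cases)

lemma bl_in [simp]: "bl S b \<in> obj S TB"
  using full by (auto simp: full_structure_def bij_betw_def)

lemma bl_inj [simp]: "bl S a = bl S b \<longleftrightarrow> a = b"
proof -
  have "inj (bl S)" using full by (auto simp: full_structure_def bij_betw_def)
  then show ?thesis by (auto simp: inj_def)
qed

lemma bl_cases:
  assumes "u \<in> obj S TB" obtains "u = bl S False" | "u = bl S True"
proof -
  have "u \<in> range (bl S)" using assms full by (auto simp: full_structure_def bij_betw_def)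
  then obtain b where "u = bl S b" by blast
  then show thesis using that by (cases b) auto
qed

lemma fun_bij:
  "bij_betw (\<lambda>f. restrict (ap S f) (obj S \<rho>)) (obj S (\<rho> \<Rrightarrow> \<sigma>)) (obj S \<rho> \<rightarrow>\<^sub>E obj S \<sigma>)"
  using full by (auto simp: full_structure_def)

lemma ap_in [simp]:
  assumes "f \<in> obj S (\<rho> \<Rrightarrow> \<sigma>)" "x \<in> obj S \<rho>" shows "f \<cdot> x \<in> obj S \<sigma>"
proof -
  have "restrict (ap S f) (obj S \<rho>) \<in> obj S \<rho> \<rightarrow>\<^sub>E obj S \<sigma>"
    by (rule bij_betw_apply[OF fun_bij assms(1)])
  then show ?thesis using assms(2) PiE_mem by fastforce
qed

lemma fun_ext:
  assumes "f \<in> obj S (\<rho> \<Rrightarrow> \<sigma>)" "g \<in> obj S (\<rho> \<Rrightarrow> \<sigma>)" "\<And>x. x \<in> obj S \<rho> \<Longrightarrow> f \<cdot> x = g \<cdot> x"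
  shows "f = g"
proof -
  have "restrict (ap S f) (obj S \<rho>) = restrict (ap S g) (obj S \<rho>)"
    using assms(3) by (rule restrict_ext)
  then show ?thesis using fun_bij[of \<rho> \<sigma>] assms(1,2) by (meson bij_betw_imp_inj_on inj_onD)
qed

text \<open>Existence is surjectivity in \<open>fun_bij\<close>, uniqueness is extensionality;
  together they resolve the description in \<open>lam\<close>.\<close>

lemma lam_spec:
  assumes "\<And>x. x \<in> obj S \<rho> \<Longrightarrow> F x \<in> obj S \<sigma>"
  shows "lam S \<rho> \<sigma> F \<in> obj S (\<rho> \<Rrightarrow> \<sigma>) \<and> (\<forall>x\<in>obj S \<rho>. lam S \<rho> \<sigma> F \<cdot> x = F x)"
proof -
  have "restrict F (obj S \<rho>) \<in> obj S \<rho> \<rightarrow>\<^sub>E obj S \<sigma>" using assms by auto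
  then obtain f where f: "f \<in> obj S (\<rho> \<Rrightarrow> \<sigma>)" "restrict (ap S f) (obj S \<rho>) = restrict F (obj S \<rho>)"
    using bij_betw_the[OF fun_bij] by blast
  then have "\<forall>x\<in>obj S \<rho>. f \<cdot> x = F x" by (metis restrict_apply')
  with f(1) have "f \<in> obj S (\<rho> \<Rrightarrow> \<sigma>) \<and> (\<forall>x\<in>obj S \<rho>. f \<cdot> x = F x)" by blast
  then show ?thesis unfolding lam_def
  proof (rule theI)
    fix g assume "g \<in> obj S (\<rho> \<Rrightarrow> \<sigma>) \<and> (\<forall>x\<in>obj S \<rho>. g \<cdot> x = F x)"
    with f(1) \<open>\<forall>x\<in>obj S \<rho>. f \<cdot> x = F x\<close> show "g = f" by (intro fun_ext[of g \<rho> \<sigma> f]) simp_all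
  qed
qed

lemma lam_in: "(\<And>x. x \<in> obj S \<rho> \<Longrightarrow> F x \<in> obj S \<sigma>) \<Longrightarrow> lam S \<rho> \<sigma> F \<in> obj S (\<rho> \<Rrightarrow> \<sigma>)"
  using lam_spec by blast

lemma ap_lam:
  "(\<And>x. x \<in> obj S \<rho> \<Longrightarrow> F x \<in> obj S \<sigma>) \<Longrightarrow> x \<in> obj S \<rho> \<Longrightarrow> lam S \<rho> \<sigma> F \<cdot> x = F x"
  using lam_spec by blast

lemma star_bij:
  "bij_betw (elts S) (obj S (Star \<sigma>)) {X. X \<subseteq> obj S \<sigma> \<and> finite X \<and> X \<noteq> {}}"
  using full by (auto simp: full_structure_def)

lemma elts_props:
  assumes "B \<in> obj S (Star \<sigma>)"
  shows "elts S B \<subseteq> obj S \<sigma>" "finite (elts S B)" "elts S B \<noteq> {}"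
  using bij_betw_apply[OF star_bij assms] by simp_all

lemma mk_set_spec:
  assumes "X \<subseteq> obj S \<sigma>" "finite X" "X \<noteq> {}"
  shows "mk_set S \<sigma> X \<in> obj S (Star \<sigma>) \<and> elts S (mk_set S \<sigma> X) = X"
  unfolding mk_set_def
  using theI'[OF bij_betw_the[OF star_bij[of \<sigma>]], of X] assms by simp

section \<open>Curried functions of several arguments and the typing of the constants\<close>

lemma apps_in: "f \<in> obj S (Fns \<Gamma> \<sigma>) \<Longrightarrow> objs \<Gamma> xs \<Longrightarrow> f \<cdot>\<cdot> xs \<in> obj S \<sigma>"
proof (induction \<Gamma> arbitrary: f xs)
  case (Cons \<gamma> \<Gamma>)
  then obtain y ys where "xs = y # ys" "y \<in> obj S \<gamma>" "objs \<Gamma> ys" by (elim objs_ConsE)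
  with Cons show ?case by (auto intro!: Cons.IH)
qed auto

lemma lams_spec:
  assumes "\<And>xs. objs \<Gamma> xs \<Longrightarrow> F xs \<in> obj S \<sigma>"
  shows "lams S \<Gamma> \<sigma> F \<in> obj S (Fns \<Gamma> \<sigma>) \<and> (\<forall>xs. objs \<Gamma> xs \<longrightarrow> lams S \<Gamma> \<sigma> F \<cdot>\<cdot> xs = F xs)"
  using assms
proof (induction \<Gamma> arbitrary: F)
  case (Cons \<gamma> \<Gamma>)
  let ?G = "\<lambda>x. lams S \<Gamma> \<sigma> (\<lambda>xs. F (x # xs))"
  have *: "?G x \<in> obj S (Fns \<Gamma> \<sigma>) \<and> (\<forall>xs. objs \<Gamma> xs \<longrightarrow> ?G x \<cdot>\<cdot> xs = F (x # xs))"
    if "x \<in> obj S \<gamma>" for x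
    by (rule Cons.IH) (use Cons.prems that in auto)
  show ?case
    using * by (auto simp: ap_lam intro!: lam_in elim!: objs_ConsE)
qed auto

lemma lams_in: "(\<And>xs. objs \<Gamma> xs \<Longrightarrow> F xs \<in> obj S \<sigma>) \<Longrightarrow> lams S \<Gamma> \<sigma> F \<in> obj S (Fns \<Gamma> \<sigma>)"
  using lams_spec by blast

lemma apps_lams:
  "(\<And>xs. objs \<Gamma> xs \<Longrightarrow> F xs \<in> obj S \<sigma>) \<Longrightarrow> objs \<Gamma> xs \<Longrightarrow> lams S \<Gamma> \<sigma> F \<cdot>\<cdot> xs = F xs"
  using lams_spec by blast

lemma rec_val_in:
  assumes "objs \<sigma>s ws" "objs (step_tys \<sigma>s) fs"
  shows "objs \<sigma>s (rec_val S n ws fs)"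
proof (induction n)
  case (Suc n)
  show ?case unfolding objs_conv_nth
  proof (intro conjI allI impI)
    show "length (rec_val S (Suc n) ws fs) = length \<sigma>s"
      using objs_length[OF assms(2)] by (simp add: step_tys_def)
  next
    fix j assume j: "j < length \<sigma>s"
    have fj: "fs ! j \<in> obj S (TN \<Rrightarrow> Fns \<sigma>s (\<sigma>s ! j))"
      using assms(2) j by (auto simp: objs_conv_nth step_tys_def)
    have "fs ! j \<cdot> num S n \<cdot>\<cdot> rec_val S n ws fs \<in> obj S (\<sigma>s ! j)"
      using fj Suc by (intro apps_in[of _ \<sigma>s] ap_in[of _ TN]) auto
    then show "rec_val S (Suc n) ws fs ! j \<in> obj S (\<sigma>s ! j)"
      using j objs_length[OF assms(2)] by (simp add: step_tys_def)
  qed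
qed (use assms in auto)

lemma objs1E: assumes "objs [a] xs" obtains x where "xs = [x]" "x \<in> obj S a"
  using assms by (auto elim!: objs_ConsE)
lemma objs2E: assumes "objs [a, b] xs" obtains x y where "xs = [x, y]" "x \<in> obj S a" "y \<in> obj S b"
  using assms by (auto elim!: objs_ConsE)
lemma objs3E: assumes "objs [a, b, c] xs"
  obtains x y z where "xs = [x, y, z]" "x \<in> obj S a" "y \<in> obj S b" "z \<in> obj S c"
  using assms by (auto elim!: objs_ConsE)

text \<open>These are the conditions for being an object of star type. Non-emptiness uses both that
  the index set is non-empty and that every member of the family is.\<close>

lemma big_union_props:
  assumes "B \<in> obj S (Star \<rho>)" "f \<in> obj S (\<rho> \<Rrightarrow> Star \<sigma>)"
  shows "(\<Union>w\<in>elts S B. elts S (f \<cdot> w)) \<subseteq> obj S \<sigma>"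
    "finite (\<Union>w\<in>elts S B. elts S (f \<cdot> w))" "(\<Union>w\<in>elts S B. elts S (f \<cdot> w)) \<noteq> {}"
proof -
  have *: "f \<cdot> w \<in> obj S (Star \<sigma>)" if "w \<in> elts S B" for w
    using elts_props[OF assms(1)] assms(2) that by auto
  show "(\<Union>w\<in>elts S B. elts S (f \<cdot> w)) \<subseteq> obj S \<sigma>" using elts_props(1)[OF *] by blast
  show "finite (\<Union>w\<in>elts S B. elts S (f \<cdot> w))"
    using elts_props(2)[OF *] elts_props(2)[OF assms(1)] by blast
  obtain w where "w \<in> elts S B" using elts_props(3)[OF assms(1)] by blast
  then show "(\<Union>w\<in>elts S B. elts S (f \<cdot> w)) \<noteq> {}" using elts_props(3)[OF *] by blast
qed

lemma cst_val_in: "cst_ok c \<Longrightarrow> cst_val S c \<in> obj S (cst_ty c)"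
proof (induction c)
  case cSuc show ?case using lams_in[of "[TN]" "\<lambda>xs. num S (Suc (nat_of S (xs ! 0)))" TN] by simp
next
  case (cPi \<rho> \<sigma>)
  have "lams S [\<rho>, \<sigma>] \<rho> (\<lambda>xs. xs ! 0) \<in> obj S (Fns [\<rho>, \<sigma>] \<rho>)"
    by (rule lams_in) (auto elim!: objs2E)
  then show ?case by simp
next
  case (cSigma \<rho> \<sigma> \<tau>)
  have "lams S [\<rho> \<Rrightarrow> \<sigma> \<Rrightarrow> \<tau>, \<rho> \<Rrightarrow> \<sigma>, \<rho>] \<tau> (\<lambda>xs. (xs ! 0 \<cdot> (xs ! 2)) \<cdot> (xs ! 1 \<cdot> (xs ! 2)))
     \<in> obj S (Fns [\<rho> \<Rrightarrow> \<sigma> \<Rrightarrow> \<tau>, \<rho> \<Rrightarrow> \<sigma>, \<rho>] \<tau>)"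
    by (rule lams_in) (auto elim!: objs3E, metis ap_in)
  then show ?case by simp
next
  case (cRec \<sigma>s i)
  have "lams S (TN # \<sigma>s @ step_tys \<sigma>s) (\<sigma>s ! i)
     (\<lambda>xs. rec_val S (nat_of S (hd xs)) (take (length \<sigma>s) (tl xs)) (drop (length \<sigma>s) (tl xs)) ! i)
     \<in> obj S (Fns (TN # \<sigma>s @ step_tys \<sigma>s) (\<sigma>s ! i))"
  proof (rule lams_in)
    fix xs assume "objs (TN # \<sigma>s @ step_tys \<sigma>s) xs"
    then obtain n ws fs where xs: "xs = n # ws @ fs" "objs \<sigma>s ws" "objs (step_tys \<sigma>s) fs"
      by (elim objs_ConsE objs_appendE) auto
    then show "rec_val S (nat_of S (hd xs)) (take (length \<sigma>s) (tl xs)) (drop (length \<sigma>s) (tl xs)) ! i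
       \<in> obj S (\<sigma>s ! i)"
      using rec_val_in[OF xs(2,3)] cRec objs_length[OF xs(2)] by (auto simp: objs_conv_nth)
  qed
  then show ?case by simp
next
  case (cCond \<sigma>)
  have "lams S [TB, \<sigma>, \<sigma>] \<sigma> (\<lambda>xs. if xs ! 0 = bl S False then xs ! 1 else xs ! 2)
     \<in> obj S (Fns [TB, \<sigma>, \<sigma>] \<sigma>)"
    by (rule lams_in) (auto elim!: objs3E)
  then show ?case by simp
next
  case (cSing \<sigma>)
  have "lams S [\<sigma>] (Star \<sigma>) (\<lambda>xs. mk_set S \<sigma> {xs ! 0}) \<in> obj S (Fns [\<sigma>] (Star \<sigma>))"
    by (rule lams_in) (auto elim!: objs1E simp: mk_set_spec)
  then show ?case by simp
next
  case (cUnion \<sigma>)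
  have "lams S [Star \<sigma>, Star \<sigma>] (Star \<sigma>)
     (\<lambda>xs. mk_set S \<sigma> (elts S (xs ! 0) \<union> elts S (xs ! 1))) \<in> obj S (Fns [Star \<sigma>, Star \<sigma>] (Star \<sigma>))"
    by (rule lams_in) (auto elim!: objs2E simp: mk_set_spec elts_props)
  then show ?case by simp
next
  case (cBigUnion \<rho> \<sigma>)
  have "lams S [Star \<rho>, \<rho> \<Rrightarrow> Star \<sigma>] (Star \<sigma>)
     (\<lambda>xs. mk_set S \<sigma> (\<Union>w\<in>elts S (xs ! 0). elts S (xs ! 1 \<cdot> w)))
      \<in> obj S (Fns [Star \<rho>, \<rho> \<Rrightarrow> Star \<sigma>] (Star \<sigma>))"
  proof (rule lams_in)
    fix xs assume "objs [Star \<rho>, \<rho> \<Rrightarrow> Star \<sigma>] xs"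
    then show "mk_set S \<sigma> (\<Union>w\<in>elts S (xs ! 0). elts S (xs ! 1 \<cdot> w)) \<in> obj S (Star \<sigma>)"
      using mk_set_spec[OF big_union_props] by (auto elim!: objs2E)
  qed
  then show ?case by simp
next
  case cMax
  have "lams S [Star TN] TN (\<lambda>xs. num S (Max (nat_of S ` elts S (xs ! 0)))) \<in> obj S (Fns [Star TN] TN)"
    by (rule lams_in) auto
  then show ?case by simp
qed auto

section \<open>Application equations of the constants\<close>

declare cst_val.simps [simp del]
declare cst_val.simps(1,6,7) [simp]

lemma Suc_ap: "u \<in> obj S TN \<Longrightarrow> cst_val S cSuc \<cdot> u = num S (Suc (nat_of S u))"
  using apps_lams[of "[TN]" "\<lambda>xs. num S (Suc (nat_of S (xs ! 0)))" TN "[u]"]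
  by (auto simp: cst_val.simps)

lemma Pi_ap:
  assumes "x \<in> obj S \<rho>" "y \<in> obj S \<sigma>"
  shows "cst_val S (cPi \<rho> \<sigma>) \<cdot> x \<cdot> y = x"
proof -
  have "cst_val S (cPi \<rho> \<sigma>) \<cdot>\<cdot> [x, y] = x"
    unfolding cst_val.simps
    by (subst apps_lams) (use assms in \<open>auto elim!: objs2E\<close>)
  then show ?thesis by simp
qed

lemma Sigma_ap:
  assumes "x \<in> obj S (\<rho> \<Rrightarrow> \<sigma> \<Rrightarrow> \<tau>)" "y \<in> obj S (\<rho> \<Rrightarrow> \<sigma>)" "z \<in> obj S \<rho>"
  shows "cst_val S (cSigma \<rho> \<sigma> \<tau>) \<cdot> x \<cdot> y \<cdot> z = (x \<cdot> z) \<cdot> (y \<cdot> z)"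
proof -
  have "cst_val S (cSigma \<rho> \<sigma> \<tau>) \<cdot>\<cdot> [x, y, z] = (x \<cdot> z) \<cdot> (y \<cdot> z)"
    unfolding cst_val.simps
    by (subst apps_lams) (use assms in \<open>(auto elim!: objs3E, (metis ap_in)+)?\<close>)
  then show ?thesis by simp
qed

lemma Rec_apps:
  assumes "n \<in> obj S TN" "objs \<sigma>s ws" "objs (step_tys \<sigma>s) fs" "i < length \<sigma>s"
  shows "cst_val S (cRec \<sigma>s i) \<cdot>\<cdot> (n # ws @ fs) = rec_val S (nat_of S n) ws fs ! i"
proof -
  note len = objs_length[OF assms(2)]
  show ?thesis unfolding cst_val.simps
  proof (subst apps_lams)
    fix xs assume "objs (TN # \<sigma>s @ step_tys \<sigma>s) xs"
    then obtain n ws fs where xs: "xs = n # ws @ fs" "objs \<sigma>s ws" "objs (step_tys \<sigma>s) fs"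
      by (elim objs_ConsE objs_appendE) auto
    then show "rec_val S (nat_of S (hd xs)) (take (length \<sigma>s) (tl xs)) (drop (length \<sigma>s) (tl xs)) ! i
       \<in> obj S (\<sigma>s ! i)"
      using rec_val_in[OF xs(2,3)] assms(4) objs_length[OF xs(2)] by (auto simp: objs_conv_nth)
  qed (use assms len in \<open>auto intro: objs_appendI\<close>)
qed

lemma Cond_ap:
  assumes "x \<in> obj S \<sigma>" "y \<in> obj S \<sigma>"
  shows "cst_val S (cCond \<sigma>) \<cdot> bl S b \<cdot> x \<cdot> y = (if b then y else x)"
proof -
  have "cst_val S (cCond \<sigma>) \<cdot>\<cdot> [bl S b, x, y] = (if b then y else x)"
    unfolding cst_val.simps
    by (subst apps_lams) (use assms in \<open>auto elim!: objs3E\<close>)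
  then show ?thesis by simp
qed

lemma elts_Sing:
  assumes "x \<in> obj S \<sigma>"
  shows "elts S (cst_val S (cSing \<sigma>) \<cdot> x) = {x}"
proof -
  have "cst_val S (cSing \<sigma>) \<cdot>\<cdot> [x] = mk_set S \<sigma> {x}"
    unfolding cst_val.simps
    by (subst apps_lams) (use assms in \<open>auto elim!: objs1E simp: mk_set_spec\<close>)
  then show ?thesis using mk_set_spec assms by simp
qed

lemma elts_Union:
  assumes "x \<in> obj S (Star \<sigma>)" "y \<in> obj S (Star \<sigma>)"
  shows "elts S (cst_val S (cUnion \<sigma>) \<cdot> x \<cdot> y) = elts S x \<union> elts S y"
proof -
  have "cst_val S (cUnion \<sigma>) \<cdot>\<cdot> [x, y] = mk_set S \<sigma> (elts S x \<union> elts S y)"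
    unfolding cst_val.simps
    by (subst apps_lams) (use assms in \<open>auto elim!: objs2E simp: mk_set_spec elts_props\<close>)
  then show ?thesis using mk_set_spec assms elts_props by simp
qed

lemma elts_BigUnion:
  assumes "B \<in> obj S (Star \<rho>)" "f \<in> obj S (\<rho> \<Rrightarrow> Star \<sigma>)"
  shows "elts S (cst_val S (cBigUnion \<rho> \<sigma>) \<cdot> B \<cdot> f) = (\<Union>w\<in>elts S B. elts S (f \<cdot> w))"
proof -
  have "cst_val S (cBigUnion \<rho> \<sigma>) \<cdot>\<cdot> [B, f] = mk_set S \<sigma> (\<Union>w\<in>elts S B. elts S (f \<cdot> w))"
    unfolding cst_val.simps
  proof (subst apps_lams)
    fix xs assume "objs [Star \<rho>, \<rho> \<Rrightarrow> Star \<sigma>] xs"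
    then show "mk_set S \<sigma> (\<Union>w\<in>elts S (xs ! 0). elts S (xs ! 1 \<cdot> w)) \<in> obj S (Star \<sigma>)"
      using mk_set_spec[OF big_union_props] by (auto elim!: objs2E)
  qed (use assms in auto)
  then show ?thesis using mk_set_spec[OF big_union_props[OF assms]] by simp
qed

lemma Max_ap:
  assumes "B \<in> obj S (Star TN)"
  shows "cst_val S cMax \<cdot> B = num S (Max (nat_of S ` elts S B))"
proof -
  have "cst_val S cMax \<cdot>\<cdot> [B] = num S (Max (nat_of S ` elts S B))"
    unfolding cst_val.simps by (subst apps_lams) (use assms in auto)
  then show ?thesis by simp
qed

lemma tm_val_in:
  "has_type t \<sigma> \<Longrightarrow> (\<And>v. v \<in> set (fv_tm t) \<Longrightarrow> e v \<in> obj S (snd v)) \<Longrightarrow> tm_val S e t \<in> obj S \<sigma>"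
  by (induction rule: has_type.induct) (auto simp: cst_val_in)

lemma tm_val_cong: "(\<And>v. v \<in> set (fv_tm t) \<Longrightarrow> e v = e' v) \<Longrightarrow> tm_val S e t = tm_val S e' t"
  by (induction t) auto

section \<open>Definable functions\<close>

text \<open>Meant for closed terms, whose value is the same in every environment;
  \<open>undefined\<close> is a placeholder.\<close>

definition cval :: "tm \<Rightarrow> 'u" where "cval t = tm_val S (\<lambda>_. undefined) t"

lemma cval_simps [simp]:
  "cval (Con c) = cst_val S c" "cval (App s t) = cval s \<cdot> cval t"
  by (simp_all add: cval_def)

lemma cval_in: "has_type t \<sigma> \<Longrightarrow> fv_tm t = [] \<Longrightarrow> cval t \<in> obj S \<sigma>"
  unfolding cval_def by (rule tm_val_in) auto

lemma tm_val_closed: "fv_tm t = [] \<Longrightarrow> tm_val S e t = cval t"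
  unfolding cval_def by (rule tm_val_cong) auto

text \<open>The list \<open>\<Gamma>\<close> takes the place of a context of free variables, and
  functions on well-typed argument lists take the place of open terms. The closed term is the one
  obtained by abstracting all of them.\<close>

definition dfn :: "ty list \<Rightarrow> ty \<Rightarrow> ('u list \<Rightarrow> 'u) \<Rightarrow> bool" where
  "dfn \<Gamma> \<sigma> \<Phi> \<longleftrightarrow> (\<exists>t. has_type t (Fns \<Gamma> \<sigma>) \<and> fv_tm t = [] \<and>
     (\<forall>xs. objs \<Gamma> xs \<longrightarrow> cval t \<cdot>\<cdot> xs = \<Phi> xs))"

section \<open>Combinatory completeness: currying, abstraction, constants, application and
  projections\<close>

lemma dfn_cong:
  "dfn \<Gamma> \<sigma> \<Phi> \<Longrightarrow> (\<And>xs. objs \<Gamma> xs \<Longrightarrow> \<Phi> xs = \<Phi>' xs) \<Longrightarrow> dfn \<Gamma> \<sigma> \<Phi>'"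
  unfolding dfn_def by metis

lemma dfn_in: "dfn \<Gamma> \<sigma> \<Phi> \<Longrightarrow> objs \<Gamma> xs \<Longrightarrow> \<Phi> xs \<in> obj S \<sigma>"
  unfolding dfn_def using apps_in cval_in by metis

text \<open>One closed term serves for both groupings of the arguments, since
  \<open>Fns (\<Gamma> @ \<Delta>) \<sigma>\<close> and
  \<open>Fns \<Gamma> (Fns \<Delta> \<sigma>)\<close> are the same type.\<close>

lemma dfn_curry:
  assumes "dfn (\<Gamma> @ \<Delta>) \<sigma> \<Phi>"
  shows "\<exists>C. dfn \<Gamma> (Fns \<Delta> \<sigma>) C \<and>
    (\<forall>xs ys. objs \<Gamma> xs \<longrightarrow> objs \<Delta> ys \<longrightarrow> C xs \<cdot>\<cdot> ys = \<Phi> (xs @ ys))"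
proof -
  obtain t where "has_type t (Fns (\<Gamma> @ \<Delta>) \<sigma>)" "fv_tm t = []"
    "\<forall>zs. objs (\<Gamma> @ \<Delta>) zs \<longrightarrow> cval t \<cdot>\<cdot> zs = \<Phi> zs"
    using assms unfolding dfn_def by blast
  then show ?thesis
    unfolding dfn_def using objs_appendI
    by (intro exI[of _ "\<lambda>xs. cval t \<cdot>\<cdot> xs"] conjI exI[of _ t]) (force simp flip: foldl_append)+
qed

lemma dfn_uncurry:
  assumes "dfn \<Gamma> (Fns \<Delta> \<sigma>) C"
  shows "dfn (\<Gamma> @ \<Delta>) \<sigma> (\<lambda>zs. C (take (length \<Gamma>) zs) \<cdot>\<cdot> drop (length \<Gamma>) zs)"
  using assms unfolding dfn_def by (auto elim!: objs_appendE simp: objs_length)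

text \<open>The curried function already is the abstraction: by extensionality it coincides with the
  object that \<open>lam\<close> describes, so the closed term remains the same.\<close>

lemma dfn_lam:
  assumes "dfn (\<Gamma> @ [\<rho>]) \<sigma> \<Phi>"
  shows "dfn \<Gamma> (\<rho> \<Rrightarrow> \<sigma>) (\<lambda>xs. lam S \<rho> \<sigma> (\<lambda>y. \<Phi> (xs @ [y])))"
proof -
  obtain C where C: "dfn \<Gamma> (Fns [\<rho>] \<sigma>) C"
    "\<forall>xs ys. objs \<Gamma> xs \<longrightarrow> objs [\<rho>] ys \<longrightarrow> C xs \<cdot>\<cdot> ys = \<Phi> (xs @ ys)"
    using dfn_curry[OF assms] by blast
  show ?thesis
  proof (rule dfn_cong)
    show "dfn \<Gamma> (\<rho> \<Rrightarrow> \<sigma>) C" using C(1) by simp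
    fix xs assume xs: "objs \<Gamma> xs"
    have \<Phi>: "\<Phi> (xs @ [y]) \<in> obj S \<sigma>" if "y \<in> obj S \<rho>" for y
      using dfn_in[OF assms] objs_appendI[OF xs, of "[\<rho>]" "[y]"] that by simp
    show "C xs = lam S \<rho> \<sigma> (\<lambda>y. \<Phi> (xs @ [y]))"
    proof (rule fun_ext[of _ \<rho> \<sigma>])
      show "C xs \<in> obj S (\<rho> \<Rrightarrow> \<sigma>)" using dfn_in[OF C(1) xs] by simp
      show "lam S \<rho> \<sigma> (\<lambda>y. \<Phi> (xs @ [y])) \<in> obj S (\<rho> \<Rrightarrow> \<sigma>)" using \<Phi> by (rule lam_in)
      fix y assume "y \<in> obj S \<rho>"
      then show "C xs \<cdot> y = lam S \<rho> \<sigma> (\<lambda>y. \<Phi> (xs @ [y])) \<cdot> y"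
        using C(2)[rule_format, OF xs, of "[y]"] \<Phi> by (simp add: ap_lam)
    qed
  qed
qed

lemma dfn_unlam:
  "dfn \<Gamma> (\<rho> \<Rrightarrow> \<sigma>) F \<Longrightarrow> dfn (\<Gamma> @ [\<rho>]) \<sigma> (\<lambda>zs. F (butlast zs) \<cdot> last zs)"
  by (rule dfn_cong[OF dfn_uncurry[of \<Gamma> "[\<rho>]"]])
    (auto elim!: objs_appendE objs_ConsE simp: objs_length)

lemma objs_snocE:
  assumes "objs (\<Gamma> @ [\<gamma>]) zs"
  obtains xs y where "zs = xs @ [y]" "objs \<Gamma> xs" "y \<in> obj S \<gamma>"
  using assms by (auto elim!: objs_appendE objs_ConsE)

text \<open>Each further argument is absorbed by one \<open>\<Pi>\<close>. The induction runs from
  the right because abstraction acts on the last argument of the context.\<close>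

lemma dfn_const: "has_type t \<sigma> \<Longrightarrow> fv_tm t = [] \<Longrightarrow> dfn \<Gamma> \<sigma> (\<lambda>_. cval t)"
proof (induction \<Gamma> arbitrary: t \<sigma> rule: rev_induct)
  case Nil
  then show ?case unfolding dfn_def by auto
next
  case (snoc \<gamma> \<Gamma>)
  let ?k = "App (Con (cPi \<sigma> \<gamma>)) t"
  have "has_type ?k (\<gamma> \<Rrightarrow> \<sigma>)" "fv_tm ?k = []"
    using snoc.prems has_type.intros(2)[of "cPi \<sigma> \<gamma>"] by (auto intro: has_type.intros(3))
  from dfn_unlam[OF snoc.IH[OF this]] show ?case
    by (rule dfn_cong) (use snoc.prems in \<open>auto elim!: objs_snocE simp: Pi_ap cval_in\<close>)
qed

lemma dfn_Con: "cst_ok c \<Longrightarrow> dfn \<Gamma> (cst_ty c) (\<lambda>_. cst_val S c)"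
  using dfn_const[of "Con c"] by (auto intro: has_type.intros)

lemma dfn_Con': "cst_ok c \<Longrightarrow> cst_ty c = \<sigma> \<Longrightarrow> dfn \<Gamma> \<sigma> (\<lambda>_. cst_val S c)"
  using dfn_Con by auto

text \<open>The classical elimination of a variable from an application: both parts are abstracted
  over the last argument, and \<open>\<Sigma>\<close> hands this argument to both of them.\<close>

lemma dfn_app:
  "dfn \<Gamma> (\<rho> \<Rrightarrow> \<sigma>) F \<Longrightarrow> dfn \<Gamma> \<rho> A \<Longrightarrow> dfn \<Gamma> \<sigma> (\<lambda>xs. F xs \<cdot> A xs)"
proof (induction \<Gamma> arbitrary: \<rho> \<sigma> F A rule: rev_induct)
  case Nil
  then obtain s t where "has_type s (\<rho> \<Rrightarrow> \<sigma>)" "fv_tm s = []" "cval s = F []"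
    "has_type t \<rho>" "fv_tm t = []" "cval t = A []"
    unfolding dfn_def by auto
  then show ?case unfolding dfn_def
    by (intro exI[of _ "App s t"]) (auto intro: has_type.intros(3))
next
  case (snoc \<gamma> \<Gamma>)
  have "dfn \<Gamma> (\<gamma> \<Rrightarrow> \<sigma>) (\<lambda>xs. cst_val S (cSigma \<gamma> \<rho> \<sigma>) \<cdot>
      lam S \<gamma> (\<rho> \<Rrightarrow> \<sigma>) (\<lambda>y. F (xs @ [y])) \<cdot> lam S \<gamma> \<rho> (\<lambda>y. A (xs @ [y])))"
    using dfn_Con[of "cSigma \<gamma> \<rho> \<sigma>"] dfn_lam[OF snoc.prems(1)] dfn_lam[OF snoc.prems(2)]
    by (intro snoc.IH) simp_all
  from dfn_unlam[OF this] show ?case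
  proof (rule dfn_cong)
    fix zs assume "objs (\<Gamma> @ [\<gamma>]) zs"
    then obtain xs y where zs: "zs = xs @ [y]" "objs \<Gamma> xs" "y \<in> obj S \<gamma>" by (elim objs_snocE)
    have F: "F (xs @ [y]) \<in> obj S (\<rho> \<Rrightarrow> \<sigma>)" "A (xs @ [y]) \<in> obj S \<rho>" if "y \<in> obj S \<gamma>" for y
      using dfn_in[OF snoc.prems(1)] dfn_in[OF snoc.prems(2)] objs_appendI[OF zs(2), of "[\<gamma>]" "[y]"] that
      by simp_all
    show "cst_val S (cSigma \<gamma> \<rho> \<sigma>) \<cdot> lam S \<gamma> (\<rho> \<Rrightarrow> \<sigma>) (\<lambda>y. F (butlast zs @ [y])) \<cdot>
        lam S \<gamma> \<rho> (\<lambda>y. A (butlast zs @ [y])) \<cdot> last zs = F zs \<cdot> A zs"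
      using zs F by (simp add: Sigma_ap ap_lam lam_in)
  qed
qed

text \<open>For the last argument the identity combinator is used; for an earlier one the last
  argument is discarded by \<open>\<Pi>\<close> and the shorter context takes over.\<close>

lemma dfn_nth: "i < length \<Gamma> \<Longrightarrow> dfn \<Gamma> (\<Gamma> ! i) (\<lambda>xs. xs ! i)"
proof (induction \<Gamma> rule: rev_induct)
  case (snoc \<gamma> \<Gamma>)
  show ?case
  proof (cases "i = length \<Gamma>")
    case True
    \<comment> \<open>The identity as \<open>\<Sigma> \<Pi> \<Pi>\<close>.\<close>
    let ?I = "Apps (Con (cSigma \<gamma> (\<gamma> \<Rrightarrow> \<gamma>) \<gamma>)) [Con (cPi \<gamma> (\<gamma> \<Rrightarrow> \<gamma>)), Con (cPi \<gamma> \<gamma>)]"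
    have "has_type ?I (\<gamma> \<Rrightarrow> \<gamma>)"
      using has_type.intros(2)[of "cSigma \<gamma> (\<gamma> \<Rrightarrow> \<gamma>) \<gamma>"] has_type.intros(2)[of "cPi \<gamma> (\<gamma> \<Rrightarrow> \<gamma>)"]
        has_type.intros(2)[of "cPi \<gamma> \<gamma>"]
      by (auto intro!: has_type.intros(3))
    from dfn_unlam[OF dfn_const[OF this, of \<Gamma>]]
    have "dfn (\<Gamma> @ [\<gamma>]) \<gamma> (\<lambda>zs. cval ?I \<cdot> last zs)" by simp
    then have "dfn (\<Gamma> @ [\<gamma>]) \<gamma> (\<lambda>xs. xs ! i)"
    proof (rule dfn_cong)
      fix zs assume "objs (\<Gamma> @ [\<gamma>]) zs"
      then obtain xs y where zs: "zs = xs @ [y]" "objs \<Gamma> xs" "y \<in> obj S \<gamma>" by (elim objs_snocE)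
      have P: "cst_val S (cPi \<gamma> \<sigma>) \<in> obj S (\<gamma> \<Rrightarrow> \<sigma> \<Rrightarrow> \<gamma>)" for \<sigma>
        using cst_val_in[of "cPi \<gamma> \<sigma>"] by simp
      have "cst_val S (cSigma \<gamma> (\<gamma> \<Rrightarrow> \<gamma>) \<gamma>) \<cdot> cst_val S (cPi \<gamma> (\<gamma> \<Rrightarrow> \<gamma>)) \<cdot> cst_val S (cPi \<gamma> \<gamma>) \<cdot> y = y"
        using zs(3) P by (subst Sigma_ap) (auto intro: Pi_ap ap_in)
      then show "cval ?I \<cdot> last zs = zs ! i"
        using zs True by (simp add: objs_length nth_append)
    qed
    then show ?thesis using True by simp
  next
    case False
    then have i: "i < length \<Gamma>" using snoc.prems by simp
    have "dfn \<Gamma> (\<gamma> \<Rrightarrow> \<Gamma> ! i) (\<lambda>xs. cst_val S (cPi (\<Gamma> ! i) \<gamma>) \<cdot> xs ! i)"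
      using dfn_app[OF _ snoc.IH[OF i]] dfn_Con[of "cPi (\<Gamma> ! i) \<gamma>" \<Gamma>] by simp
    from dfn_unlam[OF this] have "dfn (\<Gamma> @ [\<gamma>]) (\<Gamma> ! i) (\<lambda>xs. xs ! i)"
    proof (rule dfn_cong)
      fix zs assume "objs (\<Gamma> @ [\<gamma>]) zs"
      then obtain xs y where zs: "zs = xs @ [y]" "objs \<Gamma> xs" "y \<in> obj S \<gamma>" by (elim objs_snocE)
      then show "cst_val S (cPi (\<Gamma> ! i) \<gamma>) \<cdot> butlast zs ! i \<cdot> last zs = zs ! i"
        using i by (simp add: objs_conv_nth nth_append Pi_ap)
    qed
    then show ?thesis using i by (simp add: nth_append)
  qed
qed simp

section \<open>Tuples of definable functions\<close>

definition dfns :: "ty list \<Rightarrow> ty list \<Rightarrow> ('u list \<Rightarrow> 'u list) \<Rightarrow> bool" where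
  "dfns \<Gamma> \<Delta> \<Phi> \<longleftrightarrow> (\<forall>xs. objs \<Gamma> xs \<longrightarrow> length (\<Phi> xs) = length \<Delta>) \<and>
     (\<forall>j<length \<Delta>. dfn \<Gamma> (\<Delta> ! j) (\<lambda>xs. \<Phi> xs ! j))"

lemma dfns_in: "dfns \<Gamma> \<Delta> \<Phi> \<Longrightarrow> objs \<Gamma> xs \<Longrightarrow> objs \<Delta> (\<Phi> xs)"
  unfolding objs_conv_nth[of \<Delta>]
proof (intro conjI allI impI)
  assume "dfns \<Gamma> \<Delta> \<Phi>" and xs: "objs \<Gamma> xs"
  then show "length (\<Phi> xs) = length \<Delta>" by (simp add: dfns_def)
  fix i assume "i < length \<Delta>"
  with \<open>dfns \<Gamma> \<Delta> \<Phi>\<close> have "dfn \<Gamma> (\<Delta> ! i) (\<lambda>xs. \<Phi> xs ! i)" by (simp add: dfns_def)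
  from dfn_in[OF this xs] show "\<Phi> xs ! i \<in> obj S (\<Delta> ! i)" .
qed

lemma dfns_cong:
  assumes "dfns \<Gamma> \<Delta> \<Phi>" "\<And>xs. objs \<Gamma> xs \<Longrightarrow> \<Phi> xs = \<Phi>' xs"
  shows "dfns \<Gamma> \<Delta> \<Phi>'"
  unfolding dfns_def
proof (intro conjI allI impI)
  fix xs assume "objs \<Gamma> xs"
  with assms(1) assms(2)[of xs] show "length (\<Phi>' xs) = length \<Delta>" unfolding dfns_def by metis
next
  fix j assume "j < length \<Delta>"
  with assms(1) have "dfn \<Gamma> (\<Delta> ! j) (\<lambda>xs. \<Phi> xs ! j)" by (simp add: dfns_def)
  then show "dfn \<Gamma> (\<Delta> ! j) (\<lambda>xs. \<Phi>' xs ! j)" by (rule dfn_cong) (simp add: assms(2))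
qed

lemma dfns_Nil [simp]: "dfns \<Gamma> [] (\<lambda>_. [])"
  by (simp add: dfns_def)

lemma dfns_single: "dfn \<Gamma> \<sigma> \<Phi> \<Longrightarrow> dfns \<Gamma> [\<sigma>] (\<lambda>xs. [\<Phi> xs])"
  by (simp add: dfns_def)

lemma dfns_append:
  assumes "dfns \<Gamma> \<Delta> \<Phi>" "dfns \<Gamma> \<Delta>' \<Phi>'"
  shows "dfns \<Gamma> (\<Delta> @ \<Delta>') (\<lambda>xs. \<Phi> xs @ \<Phi>' xs)"
  unfolding dfns_def
proof (intro conjI allI impI)
  fix xs assume "objs \<Gamma> xs"
  then show "length (\<Phi> xs @ \<Phi>' xs) = length (\<Delta> @ \<Delta>')" using assms by (simp add: dfns_def)
next
  fix j assume j: "j < length (\<Delta> @ \<Delta>')"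
  show "dfn \<Gamma> ((\<Delta> @ \<Delta>') ! j) (\<lambda>xs. (\<Phi> xs @ \<Phi>' xs) ! j)"
  proof (cases "j < length \<Delta>")
    case True
    then have "dfn \<Gamma> (\<Delta> ! j) (\<lambda>xs. \<Phi> xs ! j)" using assms(1) by (simp add: dfns_def)
    then have "dfn \<Gamma> (\<Delta> ! j) (\<lambda>xs. (\<Phi> xs @ \<Phi>' xs) ! j)"
      by (rule dfn_cong) (use assms(1) True in \<open>simp add: dfns_def nth_append\<close>)
    then show ?thesis using True by (simp add: nth_append)
  next
    case False
    then have "dfn \<Gamma> (\<Delta>' ! (j - length \<Delta>)) (\<lambda>xs. \<Phi>' xs ! (j - length \<Delta>))"
      using assms(2) j by (simp add: dfns_def)
    then have "dfn \<Gamma> (\<Delta>' ! (j - length \<Delta>)) (\<lambda>xs. (\<Phi> xs @ \<Phi>' xs) ! j)"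
      by (rule dfn_cong) (use assms(1) False in \<open>simp add: dfns_def nth_append\<close>)
    then show ?thesis using False by (simp add: nth_append)
  qed
qed

lemma dfns_Cons: "dfn \<Gamma> \<sigma> \<phi> \<Longrightarrow> dfns \<Gamma> \<Delta> \<Phi> \<Longrightarrow> dfns \<Gamma> (\<sigma> # \<Delta>) (\<lambda>xs. \<phi> xs # \<Phi> xs)"
  using dfns_append[OF dfns_single] by force

lemma dfns_take: 
  assumes "dfns \<Gamma> \<Delta> \<Phi>" shows "dfns \<Gamma> (take n \<Delta>) (\<lambda>xs. take n (\<Phi> xs))"
  using assms by (simp add: dfns_def)

lemma dfns_drop:
  assumes "dfns \<Gamma> \<Delta> \<Phi>" shows "dfns \<Gamma> (drop n \<Delta>) (\<lambda>xs. drop n (\<Phi> xs))"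
  unfolding dfns_def
proof (intro conjI allI impI)
  fix xs assume "objs \<Gamma> xs"
  then show "length (drop n (\<Phi> xs)) = length (drop n \<Delta>)" using assms by (simp add: dfns_def)
next
  fix j assume j: "j < length (drop n \<Delta>)"
  with assms have "dfn \<Gamma> (\<Delta> ! (n + j)) (\<lambda>xs. \<Phi> xs ! (n + j))" by (simp add: dfns_def)
  then show "dfn \<Gamma> (drop n \<Delta> ! j) (\<lambda>xs. drop n (\<Phi> xs) ! j)"
    using assms j by (simp add: dfns_def dfn_cong[where \<Phi> = "\<lambda>xs. \<Phi> xs ! (n + j)"])
qed

lemma dfns_id: "dfns \<Gamma> \<Gamma> (\<lambda>xs. xs)"
  by (auto simp: dfns_def dfn_nth objs_length)

lemma dfn_apps: "dfn \<Gamma> (Fns \<Delta> \<sigma>) F \<Longrightarrow> dfns \<Gamma> \<Delta> X \<Longrightarrow> dfn \<Gamma> \<sigma> (\<lambda>xs. F xs \<cdot>\<cdot> X xs)"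
proof (induction \<Delta> arbitrary: F X)
  case Nil
  then show ?case by (simp add: dfns_def dfn_cong[of \<Gamma> \<sigma> F])
next
  case (Cons \<delta> \<Delta>)
  have "dfn \<Gamma> \<sigma> (\<lambda>xs. (F xs \<cdot> X xs ! 0) \<cdot>\<cdot> drop 1 (X xs))"
    using Cons.prems dfns_drop[OF Cons.prems(2), of 1]
    by (intro Cons.IH dfn_app) (auto simp: dfns_def)
  then show ?case
  proof (rule dfn_cong)
    fix xs assume "objs \<Gamma> xs"
    then have "length (X xs) = Suc (length \<Delta>)" using Cons.prems(2) by (simp add: dfns_def)
    then show "(F xs \<cdot> X xs ! 0) \<cdot>\<cdot> drop 1 (X xs) = F xs \<cdot>\<cdot> X xs" by (cases "X xs") auto
  qed
qed

lemma dfn_comp: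
  assumes "dfn \<Delta> \<sigma> \<Phi>" "dfns \<Gamma> \<Delta> X" shows "dfn \<Gamma> \<sigma> (\<lambda>xs. \<Phi> (X xs))"
proof -
  obtain t where t: "has_type t (Fns \<Delta> \<sigma>)" "fv_tm t = []" "\<forall>xs. objs \<Delta> xs \<longrightarrow> cval t \<cdot>\<cdot> xs = \<Phi> xs"
    using assms(1) unfolding dfn_def by blast
  from dfn_apps[OF dfn_const[OF t(1,2)] assms(2)] show ?thesis
    by (rule dfn_cong) (use t(3) dfns_in[OF assms(2)] in auto)
qed

lemma dfns_comp: "dfns \<Delta> \<Theta> \<Phi> \<Longrightarrow> dfns \<Gamma> \<Delta> X \<Longrightarrow> dfns \<Gamma> \<Theta> (\<lambda>xs. \<Phi> (X xs))"
  by (simp add: dfns_def[of _ \<Theta>] dfns_in dfn_comp[of \<Delta> _ "\<lambda>xs. \<Phi> xs ! _"])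

lemma dfns_map_apps:
  assumes "dfns \<Gamma> (map (Fns \<Delta>) \<tau>s) C" "dfns \<Gamma> \<Delta> Y"
  shows "dfns \<Gamma> \<tau>s (\<lambda>xs. map (\<lambda>c. c \<cdot>\<cdot> Y xs) (C xs))"
  unfolding dfns_def
proof (intro conjI allI impI)
  fix xs assume "objs \<Gamma> xs"
  then show "length (map (\<lambda>c. c \<cdot>\<cdot> Y xs) (C xs)) = length \<tau>s" using assms by (simp add: dfns_def)
next
  fix j assume j: "j < length \<tau>s"
  with assms have "dfn \<Gamma> (\<tau>s ! j) (\<lambda>xs. C xs ! j \<cdot>\<cdot> Y xs)" by (auto simp: dfns_def intro: dfn_apps)
  then show "dfn \<Gamma> (\<tau>s ! j) (\<lambda>xs. map (\<lambda>c. c \<cdot>\<cdot> Y xs) (C xs) ! j)"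
    by (rule dfn_cong) (use assms j in \<open>auto simp: dfns_def\<close>)
qed

text \<open>Tuples of realizers are assembled by this: each component is found separately, together
  with the property for which it is chosen.\<close>

lemma dfns_choice:
  assumes "\<And>j. j < length \<Delta> \<Longrightarrow> \<exists>\<phi>. dfn \<Gamma> (\<Delta> ! j) \<phi> \<and> P j \<phi>"
  shows "\<exists>\<Phi>. dfns \<Gamma> \<Delta> \<Phi> \<and> (\<forall>xs. length (\<Phi> xs) = length \<Delta>) \<and>
    (\<forall>j<length \<Delta>. P j (\<lambda>xs. \<Phi> xs ! j))"
proof -
  obtain \<phi> where "\<forall>j<length \<Delta>. dfn \<Gamma> (\<Delta> ! j) (\<phi> j) \<and> P j (\<phi> j)"
    using assms by metis
  then show ?thesis
    by (intro exI[of _ "\<lambda>xs. map (\<lambda>j. \<phi> j xs) [0..<length \<Delta>]"]) (auto simp: dfns_def)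
qed

text \<open>Turns realizers with additional arguments into function-valued ones, as required for the
  positive witnesses of an implication and for the step functions of the recursors.\<close>

lemma dfns_curry:
  assumes "dfns (\<Gamma> @ \<Delta>) \<tau>s \<Phi>"
  shows "\<exists>C. dfns \<Gamma> (map (Fns \<Delta>) \<tau>s) C \<and>
    (\<forall>xs ys. objs \<Gamma> xs \<longrightarrow> objs \<Delta> ys \<longrightarrow> map (\<lambda>c. c \<cdot>\<cdot> ys) (C xs) = \<Phi> (xs @ ys))"
proof -
  have "\<exists>C. dfns \<Gamma> (map (Fns \<Delta>) \<tau>s) C \<and> (\<forall>xs. length (C xs) = length (map (Fns \<Delta>) \<tau>s)) \<and>
    (\<forall>j<length (map (Fns \<Delta>) \<tau>s). \<forall>xs ys. objs \<Gamma> xs \<longrightarrow> objs \<Delta> ys \<longrightarrow> C xs ! j \<cdot>\<cdot> ys = \<Phi> (xs @ ys) ! j)"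
    by (rule dfns_choice) (use assms dfn_curry[of \<Gamma> \<Delta> _ "\<lambda>xs. \<Phi> xs ! _"] in \<open>simp add: dfns_def\<close>)
  then obtain C where C: "dfns \<Gamma> (map (Fns \<Delta>) \<tau>s) C"
    "\<forall>xs. length (C xs) = length (map (Fns \<Delta>) \<tau>s)"
    "\<forall>j<length (map (Fns \<Delta>) \<tau>s). \<forall>xs ys. objs \<Gamma> xs \<longrightarrow> objs \<Delta> ys \<longrightarrow> C xs ! j \<cdot>\<cdot> ys = \<Phi> (xs @ ys) ! j"
    by blast
  have "length (\<Phi> (xs @ ys)) = length \<tau>s" if "objs \<Gamma> xs" "objs \<Delta> ys" for xs ys
    using assms objs_appendI[OF that] by (simp add: dfns_def)
  with C show ?thesis by (intro exI[of _ C]) (auto intro!: nth_equalityI)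
qed

text \<open>Default witnesses, for challenges to a formula about which nothing is asked. Objects of
  star type are non-empty, so a singleton stands where one might expect the empty set.\<close>

primrec dflt :: "ty \<Rightarrow> tm" where
  "dflt TN = Con cZero"
| "dflt TB = Con cB0"
| "dflt (\<rho> \<Rrightarrow> \<sigma>) = App (Con (cPi \<sigma> \<rho>)) (dflt \<sigma>)"
| "dflt (Star \<sigma>) = App (Con (cSing \<sigma>)) (dflt \<sigma>)"

lemma dflt_type: "has_type (dflt \<sigma>) \<sigma> \<and> fv_tm (dflt \<sigma>) = []"
proof (induction \<sigma>)
  case TN show ?case using has_type.intros(2)[of cZero] by simp
next
  case TB show ?case using has_type.intros(2)[of cB0] by simp
next
  case (Fn \<rho> \<sigma>)
  then show ?case using has_type.intros(2)[of "cPi \<sigma> \<rho>"] by (auto intro: has_type.intros(3))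
next
  case (Star \<sigma>)
  then show ?case using has_type.intros(2)[of "cSing \<sigma>"] by (auto intro: has_type.intros(3))
qed

lemma dfns_dflt: "\<exists>\<Phi>. dfns \<Gamma> \<Delta> \<Phi>"
  using dfns_choice[of \<Delta> \<Gamma> "\<lambda>_ _. True"] dfn_const dflt_type by blast

section \<open>Products of finite sets, the ranges of the componentwise bounded quantifiers\<close>

definition box :: "'u list \<Rightarrow> 'u list \<Rightarrow> bool" where
  "box bs Bs \<longleftrightarrow> list_all2 (\<lambda>b B. b \<in> elts S B) bs Bs"

lemma box_in: "objs (map Star \<sigma>s) Bs \<Longrightarrow> box bs Bs \<Longrightarrow> objs \<sigma>s bs"
  unfolding box_def objs_conv_nth list_all2_conv_all_nth using elts_props(1) by fastforce

lemma box_append: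
  "length bs = length Bs \<Longrightarrow> box (bs @ bs') (Bs @ Bs') \<longleftrightarrow> box bs Bs \<and> box bs' Bs'"
  by (simp add: box_def list_all2_append)

lemma box_Nil [simp]: "box [] Bs \<longleftrightarrow> Bs = []" "box bs [] \<longleftrightarrow> bs = []"
  by (auto simp: box_def)

lemma box_Cons [simp]: "box (b # bs) (B # Bs) \<longleftrightarrow> b \<in> elts S B \<and> box bs Bs"
  by (auto simp: box_def)

text \<open>The reason why star types contain only non-empty sets: a premise about all pairs from a
  product of two boxes gives information on one factor only if the other one is inhabited.\<close>

lemma box_nonempty:
  assumes "objs (map Star \<sigma>s) Bs" shows "\<exists>b. box b Bs"
proof
  show "box (map (\<lambda>B. SOME b. b \<in> elts S B) Bs) Bs"
    using assms elts_props(3) by (auto simp: box_def objs_conv_nth list_all2_conv_all_nth some_in_eq)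
qed

lemma box_length: "box bs Bs \<Longrightarrow> length bs = length Bs"
  by (auto simp: box_def dest: list_all2_lengthD)

definition subs :: "'u list \<Rightarrow> 'u list \<Rightarrow> bool" where
  "subs As Bs \<longleftrightarrow> list_all2 (\<lambda>A B. elts S A \<subseteq> elts S B) As Bs"

lemma box_mono: "box bs As \<Longrightarrow> subs As Bs \<Longrightarrow> box bs Bs"
  unfolding box_def subs_def list_all2_conv_all_nth by (auto, blast)

section \<open>Definable singletons, unions and indexed unions of tuples\<close>

lemma dfn_Sing: "dfn \<Gamma> \<sigma> \<Phi> \<Longrightarrow> dfn \<Gamma> (Star \<sigma>) (\<lambda>xs. cst_val S (cSing \<sigma>) \<cdot> \<Phi> xs)"
  by (rule dfn_app[OF dfn_Con'[of "cSing \<sigma>"]]) simp_all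

lemma dfn_Union: "dfn \<Gamma> (Star \<sigma>) \<Phi> \<Longrightarrow> dfn \<Gamma> (Star \<sigma>) \<Psi> \<Longrightarrow>
    dfn \<Gamma> (Star \<sigma>) (\<lambda>xs. cst_val S (cUnion \<sigma>) \<cdot> \<Phi> xs \<cdot> \<Psi> xs)"
  by (rule dfn_app[OF dfn_app[OF dfn_Con'[of "cUnion \<sigma>"]]]) simp_all

lemma dfns_Sing:
  assumes "dfns \<Gamma> \<sigma>s X"
  shows "\<exists>Z. dfns \<Gamma> (map Star \<sigma>s) Z \<and> (\<forall>xs. objs \<Gamma> xs \<longrightarrow> box (X xs) (Z xs))"
proof -
  have "\<exists>Z. dfns \<Gamma> (map Star \<sigma>s) Z \<and> (\<forall>xs. length (Z xs) = length (map Star \<sigma>s)) \<and>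
    (\<forall>j<length (map Star \<sigma>s). \<forall>xs. objs \<Gamma> xs \<longrightarrow> X xs ! j \<in> elts S (Z xs ! j))"
  proof (rule dfns_choice)
    fix j assume "j < length (map Star \<sigma>s)"
    with assms have *: "dfn \<Gamma> (\<sigma>s ! j) (\<lambda>xs. X xs ! j)" "j < length \<sigma>s" by (simp_all add: dfns_def)
    show "\<exists>\<phi>. dfn \<Gamma> (map Star \<sigma>s ! j) \<phi> \<and> (\<forall>xs. objs \<Gamma> xs \<longrightarrow> X xs ! j \<in> elts S (\<phi> xs))"
      using dfn_Sing[OF *(1)] dfn_in[OF *(1)] *(2) 
      by (intro exI[of _ "\<lambda>xs. cst_val S (cSing (\<sigma>s ! j)) \<cdot> X xs ! j"])
        (simp add: elts_Sing)
  qed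
  then show ?thesis using assms
    by (auto simp: box_def list_all2_conv_all_nth dfns_def)
qed

lemma dfns_Union:
  assumes "dfns \<Gamma> (map Star \<sigma>s) A" "dfns \<Gamma> (map Star \<sigma>s) B"
  shows "\<exists>Z. dfns \<Gamma> (map Star \<sigma>s) Z \<and>
    (\<forall>xs. objs \<Gamma> xs \<longrightarrow> subs (A xs) (Z xs) \<and> subs (B xs) (Z xs))"
proof -
  have "\<exists>Z. dfns \<Gamma> (map Star \<sigma>s) Z \<and> (\<forall>xs. length (Z xs) = length (map Star \<sigma>s)) \<and>
    (\<forall>j<length (map Star \<sigma>s). \<forall>xs. objs \<Gamma> xs \<longrightarrow>
      elts S (A xs ! j) \<subseteq> elts S (Z xs ! j) \<and> elts S (B xs ! j) \<subseteq> elts S (Z xs ! j))"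
  proof (rule dfns_choice)
    fix j assume "j < length (map Star \<sigma>s)"
    with assms have *: "dfn \<Gamma> (Star (\<sigma>s ! j)) (\<lambda>xs. A xs ! j)" "dfn \<Gamma> (Star (\<sigma>s ! j)) (\<lambda>xs. B xs ! j)"
      "j < length \<sigma>s" by (simp_all add: dfns_def)
    show "\<exists>\<phi>. dfn \<Gamma> (map Star \<sigma>s ! j) \<phi> \<and> (\<forall>xs. objs \<Gamma> xs \<longrightarrow>
      elts S (A xs ! j) \<subseteq> elts S (\<phi> xs) \<and> elts S (B xs ! j) \<subseteq> elts S (\<phi> xs))"
      using dfn_Union[OF *(1,2)] dfn_in[OF *(1)] dfn_in[OF *(2)] *(3) 
      by (intro exI[of _ "\<lambda>xs. cst_val S (cUnion (\<sigma>s ! j)) \<cdot> A xs ! j \<cdot> B xs ! j"])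
        (simp add: elts_Union)
  qed
  then obtain Z where "dfns \<Gamma> (map Star \<sigma>s) Z" "\<forall>xs. length (Z xs) = length (map Star \<sigma>s)"
    "\<forall>j<length (map Star \<sigma>s). \<forall>xs. objs \<Gamma> xs \<longrightarrow>
      elts S (A xs ! j) \<subseteq> elts S (Z xs ! j) \<and> elts S (B xs ! j) \<subseteq> elts S (Z xs ! j)" by blast
  then show ?thesis using assms
    by (intro exI[of _ Z] conjI allI impI)
      (simp_all add: subs_def list_all2_conv_all_nth dfns_def)
qed

text \<open>
  Only inclusions are recorded for unions: enlarging the sets of negative witnesses
  of a hypothesis only strengthens the hypothesis.
\<close>

lemma dfn_BigUnion:
  assumes "dfns \<Gamma> (map Star \<beta>s) B" "dfn (\<Gamma> @ \<beta>s) (Star \<tau>) H"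
  shows "\<exists>U. dfn \<Gamma> (Star \<tau>) U \<and>
    (\<forall>xs b. objs \<Gamma> xs \<longrightarrow> box b (B xs) \<longrightarrow> elts S (H (xs @ b)) \<subseteq> elts S (U xs))"
  using assms
proof (induction \<beta>s arbitrary: \<Gamma> B H)
  case Nil
  then show ?case by (auto simp: dfns_def)
next
  case (Cons \<beta> \<beta>s)
  \<comment> \<open>The induction hypothesis is applied in the context enlarged by an element of the
    first set; the remaining sets do not depend on that element.\<close>
  have w: "dfns (\<Gamma> @ [\<beta>]) \<Gamma> (\<lambda>zs. take (length \<Gamma>) zs)"
    using dfns_take[OF dfns_id, of "\<Gamma> @ [\<beta>]" "length \<Gamma>"] by simp
  have "dfns (\<Gamma> @ [\<beta>]) (map Star \<beta>s) (\<lambda>zs. drop 1 (B (take (length \<Gamma>) zs)))"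
    using dfns_comp[OF dfns_drop[OF Cons.prems(1), of 1] w] by simp
  moreover have "dfn ((\<Gamma> @ [\<beta>]) @ \<beta>s) (Star \<tau>) H" using Cons.prems(2) by simp
  ultimately obtain U where U: "dfn (\<Gamma> @ [\<beta>]) (Star \<tau>) U"
    "\<forall>xs b. objs (\<Gamma> @ [\<beta>]) xs \<longrightarrow> box b (drop 1 (B (take (length \<Gamma>) xs))) \<longrightarrow>
       elts S (H (xs @ b)) \<subseteq> elts S (U xs)"
    using Cons.IH by blast
  \<comment> \<open>The union over the remaining sets is abstracted over the element of the first
    set and then collected by one further indexed union.\<close>
  let ?V = "\<lambda>xs. cst_val S (cBigUnion \<beta> \<tau>) \<cdot> B xs ! 0 \<cdot> lam S \<beta> (Star \<tau>) (\<lambda>y. U (xs @ [y]))"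
  have B0: "dfn \<Gamma> (Star \<beta>) (\<lambda>xs. B xs ! 0)" using Cons.prems(1) by (auto simp: dfns_def)
  have V: "dfn \<Gamma> (Star \<tau>) ?V"
    by (rule dfn_app[OF dfn_app[OF dfn_Con'[of "cBigUnion \<beta> \<tau>"] B0] dfn_lam[OF U(1)]]) simp_all
  moreover have "elts S (H (xs @ b)) \<subseteq> elts S (?V xs)" if xs: "objs \<Gamma> xs" and b: "box b (B xs)" for xs b
  proof -
    have B: "objs (map Star (\<beta> # \<beta>s)) (B xs)" using dfns_in[OF Cons.prems(1) xs] .
    then obtain B0 Bs where Bs: "B xs = B0 # Bs" by (cases "B xs") auto
    with b obtain b0 bs where bs: "b = b0 # bs" by (cases b) auto
    have b0: "b0 \<in> elts S B0" "b0 \<in> obj S \<beta>" "box bs Bs"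
      using b B elts_props(1) by (auto simp: Bs bs)
    have Uin: "U (xs @ [y]) \<in> obj S (Star \<tau>)" if "y \<in> obj S \<beta>" for y
      using dfn_in[OF U(1)] objs_appendI[OF xs, of "[\<beta>]" "[y]"] that by simp
    have "elts S (H ((xs @ [b0]) @ bs)) \<subseteq> elts S (U (xs @ [b0]))"
      using U(2)[rule_format, of "xs @ [b0]" bs] objs_appendI[OF xs, of "[\<beta>]" "[b0]"] b0
      by (simp add: objs_length[OF xs] Bs)
    also have "\<dots> = elts S (lam S \<beta> (Star \<tau>) (\<lambda>y. U (xs @ [y])) \<cdot> b0)"
      using Uin b0 by (simp add: ap_lam)
    also have "\<dots> \<subseteq> elts S (?V xs)"
    proof -
      have "B0 \<in> obj S (Star \<beta>)" using B by (simp add: Bs)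
      from elts_BigUnion[OF this lam_in[OF Uin]] show ?thesis using b0(1)
        by (auto simp: Bs)
    qed
    finally show ?thesis by (simp add: bs)
  qed
  ultimately show ?case by blast
qed

lemma dfns_BigUnion:
  assumes "dfns \<Gamma> (map Star \<beta>s) B" "dfns (\<Gamma> @ \<beta>s) (map Star \<tau>s) H"
  shows "\<exists>U. dfns \<Gamma> (map Star \<tau>s) U \<and>
    (\<forall>xs b. objs \<Gamma> xs \<longrightarrow> box b (B xs) \<longrightarrow> subs (H (xs @ b)) (U xs))"
proof -
  have "\<exists>U. dfns \<Gamma> (map Star \<tau>s) U \<and> (\<forall>xs. length (U xs) = length (map Star \<tau>s)) \<and>
    (\<forall>j<length (map Star \<tau>s). \<forall>xs b. objs \<Gamma> xs \<longrightarrow> box b (B xs) \<longrightarrow>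
      elts S (H (xs @ b) ! j) \<subseteq> elts S (U xs ! j))"
    by (rule dfns_choice, rule dfn_BigUnion[OF assms(1), of _ "\<lambda>xs. H xs ! _", THEN exE])
      (use assms(2) in \<open>auto simp: dfns_def\<close>)
  then obtain U where U: "dfns \<Gamma> (map Star \<tau>s) U" "\<forall>xs. length (U xs) = length (map Star \<tau>s)"
    "\<forall>j<length (map Star \<tau>s). \<forall>xs b. objs \<Gamma> xs \<longrightarrow> box b (B xs) \<longrightarrow>
      elts S (H (xs @ b) ! j) \<subseteq> elts S (U xs ! j)" by blast
  have "length (H (xs @ b)) = length \<tau>s" if "objs \<Gamma> xs" "box b (B xs)" for xs b
    using assms(2) objs_appendI[OF that(1) box_in[OF dfns_in[OF assms(1) that(1)] that(2)]]
    by (simp add: dfns_def)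
  with U show ?thesis by (intro exI[of _ U]) (auto simp: subs_def list_all2_conv_all_nth)
qed

section \<open>Joins of witnesses\<close>

text \<open>No witness has type \<open>TB\<close>; the clause there is a dummy.\<close>

primrec jn :: "ty \<Rightarrow> 'u \<Rightarrow> 'u \<Rightarrow> 'u" where
  "jn TN x y = num S (max (nat_of S x) (nat_of S y))"
| "jn TB x y = x"
| "jn (\<rho> \<Rrightarrow> \<sigma>) f g = lam S \<rho> \<sigma> (\<lambda>x. jn \<sigma> (f \<cdot> x) (g \<cdot> x))"
| "jn (Star \<sigma>) x y = cst_val S (cUnion \<sigma>) \<cdot> x \<cdot> y"

lemma dfn_jn: "dfn \<Gamma> \<sigma> F \<Longrightarrow> dfn \<Gamma> \<sigma> G \<Longrightarrow> dfn \<Gamma> \<sigma> (\<lambda>xs. jn \<sigma> (F xs) (G xs))"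
proof (induction \<sigma> arbitrary: \<Gamma> F G)
  case TN
  \<comment> \<open>The maximum of two numbers is obtained as \<open>m\<close> of the union of their
    singletons.\<close>
  have "dfn \<Gamma> TN (\<lambda>xs. cst_val S cMax \<cdot>
     (cst_val S (cUnion TN) \<cdot> (cst_val S (cSing TN) \<cdot> F xs) \<cdot> (cst_val S (cSing TN) \<cdot> G xs)))"
    by (rule dfn_app[OF dfn_Con'[of cMax] dfn_Union[OF dfn_Sing[OF TN(1)] dfn_Sing[OF TN(2)]]]) simp_all
  then show ?case
  proof (rule dfn_cong)
    fix xs assume xs: "objs \<Gamma> xs"
    note F = dfn_in[OF TN(1) xs] and G = dfn_in[OF TN(2) xs]
    have s: "cst_val S (cSing TN) \<cdot> x \<in> obj S (Star TN)" if "x \<in> obj S TN" for x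
      using ap_in[OF _ that, of _ "Star TN"] cst_val_in[of "cSing TN"] by simp
    have u: "cst_val S (cUnion TN) \<cdot> x \<cdot> y \<in> obj S (Star TN)"
      if "x \<in> obj S (Star TN)" "y \<in> obj S (Star TN)" for x y
      using cst_val_in[of "cUnion TN"] that
      by (auto intro!: ap_in[of _ "Star TN"])
    show "cst_val S cMax \<cdot>
     (cst_val S (cUnion TN) \<cdot> (cst_val S (cSing TN) \<cdot> F xs) \<cdot> (cst_val S (cSing TN) \<cdot> G xs))
      = jn TN (F xs) (G xs)"
      using F G s u by (simp add: Max_ap elts_Union elts_Sing)
  qed
next
  case TB
  then show ?case by simp
next
  case (Fn \<rho> \<sigma>)
  have w: "dfns (\<Gamma> @ [\<rho>]) \<Gamma> (\<lambda>zs. take (length \<Gamma>) zs)"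
    using dfns_take[OF dfns_id, of "\<Gamma> @ [\<rho>]" "length \<Gamma>"] by simp
  have y: "dfn (\<Gamma> @ [\<rho>]) \<rho> (\<lambda>zs. zs ! length \<Gamma>)" using dfn_nth[of "length \<Gamma>" "\<Gamma> @ [\<rho>]"] by simp
  have "dfn (\<Gamma> @ [\<rho>]) \<sigma> (\<lambda>zs. jn \<sigma> (F (take (length \<Gamma>) zs) \<cdot> zs ! length \<Gamma>)
     (G (take (length \<Gamma>) zs) \<cdot> zs ! length \<Gamma>))"
    by (intro Fn.IH dfn_app[OF dfn_comp[OF Fn.prems(1) w] y] dfn_app[OF dfn_comp[OF Fn.prems(2) w] y])
  from dfn_lam[OF this] show ?case
    by (rule dfn_cong) (simp add: nth_append flip: objs_length)
next
  case (Star \<sigma>)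
  then show ?case using dfn_Union[OF Star.prems] by simp
qed

text \<open>Typing is inherited from definability: the join of two projections is a definable
  function of two arguments.\<close>

lemma jn_in:
  assumes "x \<in> obj S \<sigma>" "y \<in> obj S \<sigma>" shows "jn \<sigma> x y \<in> obj S \<sigma>"
proof -
  have "dfn [\<sigma>, \<sigma>] \<sigma> (\<lambda>xs. jn \<sigma> (xs ! 0) (xs ! 1))"
    using dfn_nth[of 0 "[\<sigma>, \<sigma>]"] dfn_nth[of 1 "[\<sigma>, \<sigma>]"] by (auto intro: dfn_jn)
  from dfn_in[OF this, of "[x, y]"] assms show ?thesis by simp
qed

lemma jn_apps:
  "f \<in> obj S (Fns \<Delta> \<sigma>) \<Longrightarrow> g \<in> obj S (Fns \<Delta> \<sigma>) \<Longrightarrow> objs \<Delta> xs \<Longrightarrow>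
   jn (Fns \<Delta> \<sigma>) f g \<cdot>\<cdot> xs = jn \<sigma> (f \<cdot>\<cdot> xs) (g \<cdot>\<cdot> xs)"
proof (induction \<Delta> arbitrary: f g xs)
  case (Cons \<delta> \<Delta>)
  then obtain y ys where xs: "xs = y # ys" "y \<in> obj S \<delta>" "objs \<Delta> ys" by (elim objs_ConsE)
  have *: "f \<cdot> x \<in> obj S (Fns \<Delta> \<sigma>)" "g \<cdot> x \<in> obj S (Fns \<Delta> \<sigma>)" if "x \<in> obj S \<delta>" for x
    using Cons.prems that by (auto intro: ap_in[of _ \<delta>])
  show ?case using xs * by (simp add: ap_lam jn_in Cons.IH)
qed auto

definition jns :: "ty list \<Rightarrow> 'u list \<Rightarrow> 'u list \<Rightarrow> 'u list" where
  "jns \<sigma>s xs ys = map (\<lambda>i. jn (\<sigma>s ! i) (xs ! i) (ys ! i)) [0..<length \<sigma>s]"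

lemma dfns_jns: "dfns \<Gamma> \<sigma>s F \<Longrightarrow> dfns \<Gamma> \<sigma>s G \<Longrightarrow> dfns \<Gamma> \<sigma>s (\<lambda>xs. jns \<sigma>s (F xs) (G xs))"
  by (auto simp: dfns_def jns_def intro!: dfn_jn)

lemma jns_append:
  assumes "objs \<sigma>s xs" "objs \<sigma>s xs'"
  shows "jns (\<sigma>s @ \<tau>s) (xs @ ys) (xs' @ ys') = jns \<sigma>s xs xs' @ jns \<tau>s ys ys'"
  using objs_length[OF assms(1)] objs_length[OF assms(2)]
  by (intro nth_equalityI) (auto simp: jns_def nth_append)

lemma jns_map_apps:
  assumes "objs (map (Fns \<Delta>) \<sigma>s) fs" "objs (map (Fns \<Delta>) \<sigma>s) gs" "objs \<Delta> xs"
  shows "map (\<lambda>f. f \<cdot>\<cdot> xs) (jns (map (Fns \<Delta>) \<sigma>s) fs gs)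
    = jns \<sigma>s (map (\<lambda>f. f \<cdot>\<cdot> xs) fs) (map (\<lambda>f. f \<cdot>\<cdot> xs) gs)"
  using assms by (intro nth_equalityI) (auto simp: jns_def objs_conv_nth jn_apps)

lemma subs_jns:
  assumes "objs (map Star \<sigma>s) As" "objs (map Star \<sigma>s) Bs"
  shows "subs As (jns (map Star \<sigma>s) As Bs)" "subs Bs (jns (map Star \<sigma>s) As Bs)"
  using assms
  by (auto simp: subs_def jns_def objs_conv_nth list_all2_conv_all_nth elts_Union)

text \<open>Each component of \<open>F\<close> may use all components of the previous tuple. Hence
  the recursor for simultaneous recursion at the whole tuple is applied, with the curried components
  of \<open>F\<close> as steps.\<close>

lemma dfns_rec:
  assumes F: "dfns (TN # \<sigma>s) \<sigma>s F" and x0: "dfns [] \<sigma>s (\<lambda>_. x0)"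
  shows "\<exists>R. dfns [TN] \<sigma>s R \<and> R [num S 0] = x0 \<and>
    (\<forall>n. R [num S (Suc n)] = F (num S n # R [num S n]))"
proof -
  obtain C where C: "dfns [] (map (Fns (TN # \<sigma>s)) \<sigma>s) C"
    "\<forall>xs ys. objs [] xs \<longrightarrow> objs (TN # \<sigma>s) ys \<longrightarrow> map (\<lambda>c. c \<cdot>\<cdot> ys) (C xs) = F (xs @ ys)"
    using dfns_curry[of "[]" "TN # \<sigma>s" \<sigma>s F] F unfolding append_Nil by blast
  define fs where "fs = C []"
  \<comment> \<open>Currying \<open>F\<close> over the counter and the previous tuple gives exactly
    the step types that the recursor expects.\<close>
  have st: "map (Fns (TN # \<sigma>s)) \<sigma>s = step_tys \<sigma>s" by (simp add: step_tys_def)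
  have f: "dfns [] (step_tys \<sigma>s) (\<lambda>_. fs)"
    unfolding fs_def by (rule dfns_cong[OF C(1)[unfolded st]]) simp
  have fs: "objs (step_tys \<sigma>s) fs" using dfns_in[OF f] by simp
  have x0': "objs \<sigma>s x0" using dfns_in[OF x0] by simp
  have fF: "map (\<lambda>c. c \<cdot>\<cdot> (n # ys)) fs = F (n # ys)" if "n \<in> obj S TN" "objs \<sigma>s ys" for n ys
    using C(2)[rule_format, of "[]" "n # ys"] that by (simp add: fs_def)
  let ?R = "\<lambda>xs. map (\<lambda>i. cst_val S (cRec \<sigma>s i) \<cdot>\<cdot> (xs ! 0 # x0 @ fs)) [0..<length \<sigma>s]"
  have R: "?R [num S n] = rec_val S n x0 fs" for n
    using Rec_apps[of "num S n" \<sigma>s x0 fs] x0' fs objs_length[OF rec_val_in[OF x0' fs]]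
    by (intro nth_equalityI) (simp_all del: cst_val.simps foldl_Cons)
  have "dfns [TN] \<sigma>s ?R" unfolding dfns_def
  proof (intro conjI allI impI)
    fix j assume j: "j < length \<sigma>s"
    have c: "dfns [TN] \<Delta> (\<lambda>_. ys)" if "dfns [] \<Delta> (\<lambda>_. ys)" for \<Delta> ys
      using dfns_comp[OF that, of "[TN]" "\<lambda>_. []"] by simp
    have "dfn [TN] (\<sigma>s ! j) (\<lambda>xs. cst_val S (cRec \<sigma>s j) \<cdot>\<cdot> (xs ! 0 # x0 @ fs))"
    proof (rule dfn_apps)
      show "dfn [TN] (Fns (TN # \<sigma>s @ step_tys \<sigma>s) (\<sigma>s ! j)) (\<lambda>xs. cst_val S (cRec \<sigma>s j))"
        using dfn_Con[of "cRec \<sigma>s j"] j by simp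
      show "dfns [TN] (TN # \<sigma>s @ step_tys \<sigma>s) (\<lambda>xs. xs ! 0 # x0 @ fs)"
        using dfn_nth[of 0 "[TN]"] by (intro dfns_Cons dfns_append c f x0) simp
    qed
    then show "dfn [TN] (\<sigma>s ! j) (\<lambda>xs. ?R xs ! j)" using j by simp
  qed simp
  moreover have "?R [num S 0] = x0" unfolding R by simp
  moreover have "?R [num S (Suc n)] = F (num S n # ?R [num S n])" for n
    unfolding R using fF[OF num_in rec_val_in[OF x0' fs]] by simp
  ultimately show ?thesis by blast
qed

end

section \<open>Witnesses and the semantic interpretation\<close>

abbreviation "posc \<equiv> pos I_cb"
abbreviation "negc \<equiv> neg I_cb"

lemma pos_neg_IAt [simp]: "pos_neg I_cb (IAt \<sigma> t) = cb_pos_neg \<sigma>"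
  by (simp add: I_cb_def)

lemma pos_neg_And [simp]: "pos_neg I (And A B) = (pos I A @ pos I B, neg I A @ neg I B)"
  by (simp split: prod.splits)

lemma pos_neg_Imp [simp]:
  "pos_neg I (Imp A B) = (imp_pos (pos I A) (neg I A) (pos I B) (neg I B), pos I A @ neg I B)"
  by (simp split: prod.splits)

lemma pos_neg_Ex [simp]: "pos_neg I (Ex v A) = (pos I A, map Star (neg I A))"
  by (simp split: prod.splits)

lemma cb_pos_neg_Fn [simp]:
  "cb_pos_neg (\<rho> \<Rrightarrow> \<sigma>) = (imp_pos (cb_pos \<rho>) (cb_neg \<rho>) (cb_pos \<sigma>) (cb_neg \<sigma>), cb_pos \<rho> @ cb_neg \<sigma>)"
  by (simp split: prod.splits)

declare pos_neg.simps(2,4,5,7) [simp del]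
declare cb_pos_neg.simps(3) [simp del]

lemma imp_pos_eq: "imp_pos as bs cs ds = map (Fns as) cs @ map (Fns (as @ ds)) (map Star bs)"
  by simp

lemma pos_neg_subst [simp]: "pos_neg I (subst v r A) = pos_neg I A"
  by (induction A) (auto simp: pos_neg.simps(2))

context full begin

text \<open>In \<open>\<langle>A \<rightarrow> B\<rangle>\<close>, \<open>m\<close> and \<open>n\<close> are the lengths of the tuples \<open>a\<close> and \<open>f\<close> of witnesses.\<close>

definition imps :: "nat \<Rightarrow> nat \<Rightarrow> ('u list \<Rightarrow> 'u list \<Rightarrow> bool) \<Rightarrow> ('u list \<Rightarrow> 'u list \<Rightarrow> bool) \<Rightarrow>
    'u list \<Rightarrow> 'u list \<Rightarrow> bool" where
  "imps m n P Q ps ns \<longleftrightarrow>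
     (\<forall>bs. box bs (map (\<lambda>g. g \<cdot>\<cdot> ns) (drop n ps)) \<longrightarrow> P (take m ns) bs) \<longrightarrow>
     Q (map (\<lambda>f. f \<cdot>\<cdot> take m ns) (take n ps)) (drop m ns)"

text \<open>The clauses of \<open>cb_fm\<close> with objects in place of terms, so that no bound
  variables have to be chosen; \<open>sem\<close> relates to \<open>interp\<close> in the same
  way.\<close>

primrec cbs :: "ty \<Rightarrow> 'u \<Rightarrow> 'u list \<Rightarrow> 'u list \<Rightarrow> bool" where
  "cbs TN h ps ns \<longleftrightarrow> nat_of S h \<le> nat_of S (hd ps)"
| "cbs TB h ps ns \<longleftrightarrow> True"
| "cbs (\<rho> \<Rrightarrow> \<sigma>) h ps ns \<longleftrightarrow>
     (\<forall>x\<in>obj S \<rho>. imps (length (cb_pos \<rho>)) (length (cb_pos \<sigma>)) (cbs \<rho> x) (cbs \<sigma> (h \<cdot> x)) ps ns)"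
| "cbs (Star \<sigma>) h ps ns \<longleftrightarrow> False"

primrec sem :: "fm \<Rightarrow> (var \<Rightarrow> 'u) \<Rightarrow> 'u list \<Rightarrow> 'u list \<Rightarrow> bool" where
  "sem (Eq \<sigma> s t) e ps ns \<longleftrightarrow> tm_val S e s = tm_val S e t"
| "sem (IAt \<sigma> t) e ps ns \<longleftrightarrow> cbs \<sigma> (tm_val S e t) ps ns"
| "sem Bot e ps ns \<longleftrightarrow> False"
| "sem (And A B) e ps ns \<longleftrightarrow>
     sem A e (take (length (posc A)) ps) (take (length (negc A)) ns) \<and>
     sem B e (drop (length (posc A)) ps) (drop (length (negc A)) ns)"
| "sem (Imp A B) e ps ns \<longleftrightarrow> imps (length (posc A)) (length (posc B)) (sem A e) (sem B e) ps ns"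
| "sem (All v A) e ps ns \<longleftrightarrow> (\<forall>u\<in>obj S (snd v). sem A (e(v := u)) ps ns)"
| "sem (Ex v A) e ps ns \<longleftrightarrow>
     (\<exists>u\<in>obj S (snd v). \<forall>bs. box bs ns \<longrightarrow> sem A (e(v := u)) ps bs)"

section \<open>Dependence on the valuation, and substitution\<close>

lemma sem_cong: "(\<And>v. v \<in> set (fv A) \<Longrightarrow> e v = e' v) \<Longrightarrow> sem A e = sem A e'"
proof (induction A arbitrary: e e')
  case (Eq \<sigma> s t)
  then have "tm_val S e s = tm_val S e' s" "tm_val S e t = tm_val S e' t"
    by (auto intro!: tm_val_cong)
  then show ?case by (intro ext) simp
next
  case (IAt \<sigma> t)
  then have "tm_val S e t = tm_val S e' t" by (auto intro!: tm_val_cong)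
  then show ?case by (intro ext) simp
next
  case (And A B)
  have "sem A e = sem A e'" "sem B e = sem B e'" using And.prems by (auto intro!: And.IH)
  then show ?case by (intro ext) simp
next
  case (Imp A B)
  have "sem A e = sem A e'" "sem B e = sem B e'" using Imp.prems by (auto intro!: Imp.IH)
  then show ?case by (intro ext) simp
next
  case (All v A)
  have "sem A (e(v := u)) = sem A (e'(v := u))" for u using All.prems by (auto intro!: All.IH)
  then show ?case by (intro ext) simp
next
  case (Ex v A)
  have "sem A (e(v := u)) = sem A (e'(v := u))" for u using Ex.prems by (auto intro!: Ex.IH)
  then show ?case by (intro ext) simp
qed (intro ext, simp)

lemma sem_upd [simp]: "v \<notin> set (fv A) \<Longrightarrow> sem A (e(v := u)) = sem A e"
  by (rule sem_cong) auto

lemma tm_val_upd [simp]: "v \<notin> set (fv_tm t) \<Longrightarrow> tm_val S (e(v := u)) t = tm_val S e t"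
  by (rule tm_val_cong) auto

lemma tm_val_subst: "tm_val S e (subst_tm v r t) = tm_val S (e(v := tm_val S e r)) t"
  by (induction t) auto

lemma subst_tm_fresh: "v \<notin> set (fv_tm t) \<Longrightarrow> subst_tm v r t = t"
  by (induction t) auto

lemma subst_fresh: "v \<notin> set (fv A) \<Longrightarrow> subst v r A = A"
  by (induction A) (auto simp: subst_tm_fresh)

lemma sem_subst: "free_for v r A \<Longrightarrow> sem (subst v r A) e = sem A (e(v := tm_val S e r))"
proof (induction A arbitrary: e)
  case (Eq \<sigma> s t)
  show ?case by (rule ext, rule ext) (simp only: subst.simps sem.simps tm_val_subst)
next
  case (IAt \<sigma> t)
  show ?case by (rule ext, rule ext) (simp only: subst.simps sem.simps tm_val_subst)
next
  case (And A B)
  have "sem (subst v r A) e = sem A (e(v := tm_val S e r))"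
    "sem (subst v r B) e = sem B (e(v := tm_val S e r))"
    using And.prems by (auto intro: And.IH)
  then show ?case by (simp add: fun_eq_iff fun_upd_def)
next
  case (Imp A B)
  have *: "sem (subst v r A) e = sem A (e(v := tm_val S e r))"
    "sem (subst v r B) e = sem B (e(v := tm_val S e r))"
    using Imp.prems by (auto intro: Imp.IH)
  show ?case by (rule ext, rule ext) (simp only: subst.simps sem.simps pos_neg_subst *)
next
  case (All w A)
  have "sem (if w = v then A else subst v r A) (e(w := u)) = sem A (e(v := tm_val S e r, w := u))" for u
  \<comment> \<open>In the first case \<open>free_for\<close> excludes no capture, but then
    \<open>v\<close> has no free occurrence below the quantifier that could be replaced.\<close>
  proof (cases "w = v \<or> v \<notin> set (fv A)")
    case True
    then show ?thesis by (auto simp: subst_fresh fun_upd_twist[of v w])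
  next
    case False
    then have *: "w \<noteq> v" "w \<notin> set (fv_tm r)" "free_for v r A" using All.prems by auto
    show ?thesis using *(1)
      by (simp only: if_False All.IH[OF *(3)] tm_val_upd[OF *(2)] fun_upd_twist[OF *(1)])
  qed
  then show ?case by (simp add: fun_eq_iff fun_upd_def)
next
  case (Ex w A)
  have "sem (if w = v then A else subst v r A) (e(w := u)) = sem A (e(v := tm_val S e r, w := u))" for u
  proof (cases "w = v \<or> v \<notin> set (fv A)")
    case True
    then show ?thesis by (auto simp: subst_fresh fun_upd_twist[of v w])
  next
    case False
    then have *: "w \<noteq> v" "w \<notin> set (fv_tm r)" "free_for v r A" using Ex.prems by auto
    show ?thesis using *(1)
      by (simp only: if_False Ex.IH[OF *(3)] tm_val_upd[OF *(2)] fun_upd_twist[OF *(1)])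
  qed
  then show ?case by (simp add: fun_eq_iff fun_upd_def)
qed (simp add: fun_eq_iff)

section \<open>Realization is preserved by joins\<close>

lemma subs_apps_jns:
  assumes "objs (map (Fns \<Delta>) (map Star \<beta>s)) gs" "objs (map (Fns \<Delta>) (map Star \<beta>s)) gs'" "objs \<Delta> ns"
  shows "subs (map (\<lambda>g. g \<cdot>\<cdot> ns) gs) (map (\<lambda>g. g \<cdot>\<cdot> ns) (jns (map (Fns \<Delta>) (map Star \<beta>s)) gs gs'))"
    "subs (map (\<lambda>g. g \<cdot>\<cdot> ns) gs) (map (\<lambda>g. g \<cdot>\<cdot> ns) (jns (map (Fns \<Delta>) (map Star \<beta>s)) gs' gs))"
proof -
  have *: "objs (map Star \<beta>s) (map (\<lambda>g. g \<cdot>\<cdot> ns) hs)" if "objs (map (Fns \<Delta>) (map Star \<beta>s)) hs" for hs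
    using that assms(3) by (auto simp: objs_conv_nth intro: apps_in)
  show "subs (map (\<lambda>g. g \<cdot>\<cdot> ns) gs) (map (\<lambda>g. g \<cdot>\<cdot> ns) (jns (map (Fns \<Delta>) (map Star \<beta>s)) gs gs'))"
    "subs (map (\<lambda>g. g \<cdot>\<cdot> ns) gs) (map (\<lambda>g. g \<cdot>\<cdot> ns) (jns (map (Fns \<Delta>) (map Star \<beta>s)) gs' gs))"
    unfolding jns_map_apps[OF assms(1-3)] jns_map_apps[OF assms(2,1,3)]
    using *[OF assms(1)] *[OF assms(2)] by (auto intro: subs_jns)
qed

text \<open>Both orders are listed because the valid witness may stand on either side of a join: it
  may be the one accumulated so far or the new one.\<close>

definition join_closed :: "ty list \<Rightarrow> ty list \<Rightarrow> ('u list \<Rightarrow> 'u list \<Rightarrow> bool) \<Rightarrow> bool" where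
  "join_closed as bs P \<longleftrightarrow> (\<forall>a a' b. objs as a \<longrightarrow> objs as a' \<longrightarrow> objs bs b \<longrightarrow> P a b \<longrightarrow>
     P (jns as a a') b \<and> P (jns as a' a) b)"

text \<open>Closure is inherited from the conclusion. For a fixed argument \<open>a\<close>, joining
  the \<open>f\<close> joins the witnesses of the conclusion, and joining the \<open>g\<close>
  enlarges the sets from which challenges to the premise are taken.\<close>

lemma imps_join_closed:
  assumes Q: "join_closed cs ds Q"
  shows "join_closed (imp_pos as bs cs ds) (as @ ds) (imps (length as) (length cs) P Q)"
  unfolding join_closed_def
proof (intro allI impI)
  let ?F = "map (Fns as) cs" and ?G = "map (Fns (as @ ds)) (map Star bs)"
  fix ps ps' ns
  assume "objs (imp_pos as bs cs ds) ps" "objs (imp_pos as bs cs ds) ps'" and ns: "objs (as @ ds) ns"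
    and H: "imps (length as) (length cs) P Q ps ns"
  then have "objs (?F @ ?G) ps" "objs (?F @ ?G) ps'" by (simp_all add: o_def)
  then obtain fs gs fs' gs' where ps: "ps = fs @ gs" "ps' = fs' @ gs'" "objs ?F fs" "objs ?F fs'"
    "objs ?G gs" "objs ?G gs'"
    by (elim objs_appendE)
  obtain a d where a: "ns = a @ d" "objs as a" "objs ds d" using ns by (elim objs_appendE)
  have len: "length fs = length cs" "length fs' = length cs" "length a = length as"
    using ps a objs_length by fastforce+
  have lj: "length (jns ?F x y) = length cs" for x y by (simp add: jns_def)
  have f: "objs cs (map (\<lambda>f. f \<cdot>\<cdot> a) fs)" "objs cs (map (\<lambda>f. f \<cdot>\<cdot> a) fs')"
    using ps a by (auto simp: objs_conv_nth intro: apps_in)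
  \<comment> \<open>Isolates what matters for either order of the join: challenge sets that only
    grow and values that remain valid.\<close>
  have gen: "imps (length as) (length cs) P Q (fj @ gj) ns"
    if "length fj = length cs" "subs (map (\<lambda>g. g \<cdot>\<cdot> ns) gs) (map (\<lambda>g. g \<cdot>\<cdot> ns) gj)"
      "Q (map (\<lambda>f. f \<cdot>\<cdot> a) fs) d \<Longrightarrow> Q (map (\<lambda>f. f \<cdot>\<cdot> a) fj) d" for fj gj
    unfolding imps_def
  proof (intro impI)
    assume *: "\<forall>bs. box bs (map (\<lambda>g. g \<cdot>\<cdot> ns) (drop (length cs) (fj @ gj))) \<longrightarrow> P (take (length as) ns) bs"
    have "\<forall>bs. box bs (map (\<lambda>g. g \<cdot>\<cdot> ns) gs) \<longrightarrow> P a bs"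
      using * box_mono[OF _ that(2)] by (simp add: that(1) a(1) len)
    then have "Q (map (\<lambda>f. f \<cdot>\<cdot> a) fs) d"
      using H by (simp add: imps_def ps(1) a(1) len)
    from that(3)[OF this]
    show "Q (map (\<lambda>f. f \<cdot>\<cdot> take (length as) ns) (take (length cs) (fj @ gj))) (drop (length as) ns)"
      by (simp add: that(1) a(1) len)
  qed
  have Qm: "Q (jns cs (map (\<lambda>f. f \<cdot>\<cdot> a) fs) (map (\<lambda>f. f \<cdot>\<cdot> a) fs')) d \<and>
      Q (jns cs (map (\<lambda>f. f \<cdot>\<cdot> a) fs') (map (\<lambda>f. f \<cdot>\<cdot> a) fs)) d" if "Q (map (\<lambda>f. f \<cdot>\<cdot> a) fs) d"
    using Q[unfolded join_closed_def, rule_format, OF f a(3) that] .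
  have main: "imps (length as) (length cs) P Q (jns (?F @ ?G) ps ps') ns \<and>
     imps (length as) (length cs) P Q (jns (?F @ ?G) ps' ps) ns"
    unfolding ps(1,2) jns_append[OF ps(3,4)] jns_append[OF ps(4,3)]
    by (intro conjI gen lj subs_apps_jns[OF ps(5,6) ns])
      (simp_all only: jns_map_apps[OF ps(3,4) a(2)] jns_map_apps[OF ps(4,3) a(2)] Qm)
  then show "imps (length as) (length cs) P Q (jns (imp_pos as bs cs ds) ps ps') ns \<and>
     imps (length as) (length cs) P Q (jns (imp_pos as bs cs ds) ps' ps) ns"
    by (simp only: imp_pos_eq)
qed

lemma join_closed_all: "(\<And>x. x \<in> X \<Longrightarrow> join_closed as bs (P x)) \<Longrightarrow> join_closed as bs (\<lambda>a b. \<forall>x\<in>X. P x a b)"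
  unfolding join_closed_def by metis

lemma cbs_join_closed: "join_closed (cb_pos \<sigma>) (cb_neg \<sigma>) (cbs \<sigma> h)"
proof (induction \<sigma> arbitrary: h)
  case TN
  then show ?case by (auto simp: join_closed_def jns_def elim!: objs1E)
next
  case (Fn \<rho> \<sigma>)
  have "join_closed (imp_pos (cb_pos \<rho>) (cb_neg \<rho>) (cb_pos \<sigma>) (cb_neg \<sigma>)) (cb_pos \<rho> @ cb_neg \<sigma>)
    (\<lambda>a b. \<forall>x\<in>obj S \<rho>. imps (length (cb_pos \<rho>)) (length (cb_pos \<sigma>)) (cbs \<rho> x) (cbs \<sigma> (h \<cdot> x)) a b)"
    by (intro join_closed_all imps_join_closed Fn.IH)
  then show ?case by (simp add: join_closed_def)
qed (auto simp: join_closed_def)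

lemma sem_join_closed: "join_closed (posc A) (negc A) (sem A e)"
proof (induction A arbitrary: e)
  case (IAt \<sigma> t)
  then show ?case using cbs_join_closed[of \<sigma> "tm_val S e t"] by (simp add: join_closed_def)
next
  case (And A B)
  show ?case unfolding join_closed_def
  proof (intro allI impI)
    fix a a' b assume H: "objs (posc (And A B)) a" "objs (posc (And A B)) a'" "objs (negc (And A B)) b"
      "sem (And A B) e a b"
    then have "objs (posc A @ posc B) a" "objs (posc A @ posc B) a'" "objs (negc A @ negc B) b"
      by simp_all
    then obtain a1 a2 a1' a2' b1 b2 where *: "a = a1 @ a2" "objs (posc A) a1" "objs (posc B) a2"
      "a' = a1' @ a2'" "objs (posc A) a1'" "objs (posc B) a2'"
      "b = b1 @ b2" "objs (negc A) b1" "objs (negc B) b2"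
      by (elim objs_appendE)
    have len: "length a1 = length (posc A)" "length b1 = length (negc A)"
      using * objs_length by fastforce+
    have lj: "length (jns (posc A) x y) = length (posc A)" for x y by (simp add: jns_def)
    show "sem (And A B) e (jns (posc (And A B)) a a') b \<and> sem (And A B) e (jns (posc (And A B)) a' a) b"
      using H(4) And.IH[of e] * unfolding join_closed_def
      by (simp add: len lj jns_append[OF *(2,5)] jns_append[OF *(5,2)])
  qed
next
  case (Imp A B)
  show ?case using imps_join_closed[OF Imp.IH(2)] by (simp add: join_closed_def)
next
  case (All v A)
  then show ?case using join_closed_all[of "obj S (snd v)" _ _ "\<lambda>u. sem A (e(v := u))"]
    by (simp add: join_closed_def)
next
  case (Ex v A)
  show ?case unfolding join_closed_def
  proof (intro allI impI)
    fix a a' B assume H: "objs (posc (Ex v A)) a" "objs (posc (Ex v A)) a'"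
      "objs (negc (Ex v A)) B" "sem (Ex v A) e a B"
    \<comment> \<open>The object \<open>u\<close> found for \<open>a\<close> also serves for the
      joins, because joining preserves realization of the instance at \<open>u\<close>.\<close>
    then obtain u where u: "u \<in> obj S (snd v)" "\<forall>b. box b B \<longrightarrow> sem A (e(v := u)) a b" by auto
    have "objs (negc A) b" if "box b B" for b using H(3) that by (auto intro: box_in)
    then show "sem (Ex v A) e (jns (posc (Ex v A)) a a') B \<and> sem (Ex v A) e (jns (posc (Ex v A)) a' a) B"
      using u H(1,2) Ex.IH[of "e(v := u)"] unfolding join_closed_def by (simp, blast)
  qed
qed (auto simp: join_closed_def)

section \<open>Entailment\<close>

text \<open>\<open>\<Phi>\<close> and \<open>\<Psi>\<close> are the witnesses \<open>f\<close> and
  \<open>g\<close> of the implication in uncurried form: \<open>\<Phi>\<close> sees only the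
  witnesses of \<open>A\<close>, while \<open>\<Psi>\<close> also sees the challenge
  \<open>d\<close> to \<open>B\<close> that is to be met.\<close>

definition ent :: "fm \<Rightarrow> fm \<Rightarrow> bool" (infix "\<tturnstile>" 50) where
  "A \<tturnstile> B \<longleftrightarrow> (\<exists>\<Phi> \<Psi>. dfns (posc A) (posc B) \<Phi> \<and>
     dfns (posc A @ negc B) (map Star (negc A)) \<Psi> \<and>
     (\<forall>e a d. valuation S e \<longrightarrow> objs (posc A) a \<longrightarrow> objs (negc B) d \<longrightarrow>
        (\<forall>b. box b (\<Psi> (a @ d)) \<longrightarrow> sem A e a b) \<longrightarrow> sem B e (\<Phi> a) d))"

lemma dfns_fst: "dfns (\<Gamma> @ \<Delta>) \<Gamma> (\<lambda>z. take (length \<Gamma>) z)"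
  using dfns_take[OF dfns_id, of "\<Gamma> @ \<Delta>" "length \<Gamma>"] by simp

lemma dfns_snd: "dfns (\<Gamma> @ \<Delta>) \<Delta> (\<lambda>z. drop (length \<Gamma>) z)"
  using dfns_drop[OF dfns_id, of "\<Gamma> @ \<Delta>" "length \<Gamma>"] by simp

lemma valuation_upd: "valuation S e \<Longrightarrow> u \<in> obj S (snd v) \<Longrightarrow> valuation S (e(v := u))"
  by (auto simp: valuation_def)

text \<open>Witnesses are passed on unchanged, and the challenge \<open>d\<close> is passed back as
  the singleton of \<open>d\<close>.\<close>

lemma ent_semI:
  assumes "posc A = posc B" "negc A = negc B"
    "\<And>e a b. valuation S e \<Longrightarrow> objs (posc A) a \<Longrightarrow> objs (negc A) b \<Longrightarrow> sem A e a b \<Longrightarrow> sem B e a b"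
  shows "A \<tturnstile> B"
proof -
  obtain Z where Z: "dfns (posc A @ negc B) (map Star (negc B)) Z"
    "\<forall>z. objs (posc A @ negc B) z \<longrightarrow> box (drop (length (posc A)) z) (Z z)"
    using dfns_Sing[OF dfns_snd] by blast
  show ?thesis unfolding ent_def
  proof (rule exI[of _ "\<lambda>a. a"], rule exI[of _ Z], intro conjI allI impI)
    fix e a d
    assume *: "valuation S e" "objs (posc A) a" "objs (negc B) d" "\<forall>b. box b (Z (a @ d)) \<longrightarrow> sem A e a b"
    have "box d (Z (a @ d))"
      using Z(2)[rule_format, OF objs_appendI[OF *(2,3)]] by (simp add: objs_length[OF *(2)])
    with * show "sem B e a d" using assms(2,3) by simp
  qed (use assms Z dfns_id in auto)
qed

section \<open>Rules of intuitionistic logic\<close>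

lemma ent_refl: "A \<tturnstile> A"
  by (rule ent_semI) auto

text \<open>Challenges travel backwards. \<open>\<Psi>'\<close> turns a challenge to
  \<open>C\<close> into a box of challenges to \<open>B\<close>, and \<open>\<Psi>\<close> answers
  each element of this box with challenges to \<open>A\<close>. All these answers have to be met, so
  they are collected by an indexed union.\<close>

lemma ent_trans:
  assumes "A \<tturnstile> B" "B \<tturnstile> C" shows "A \<tturnstile> C"
proof -
  obtain \<Phi> \<Psi> where 1: "dfns (posc A) (posc B) \<Phi>" "dfns (posc A @ negc B) (map Star (negc A)) \<Psi>"
    "\<And>e a d. valuation S e \<Longrightarrow> objs (posc A) a \<Longrightarrow> objs (negc B) d \<Longrightarrow>
        (\<forall>b. box b (\<Psi> (a @ d)) \<longrightarrow> sem A e a b) \<Longrightarrow> sem B e (\<Phi> a) d"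
    using assms(1) unfolding ent_def by metis
  obtain \<Phi>' \<Psi>' where 2: "dfns (posc B) (posc C) \<Phi>'" "dfns (posc B @ negc C) (map Star (negc B)) \<Psi>'"
    "\<And>e a d. valuation S e \<Longrightarrow> objs (posc B) a \<Longrightarrow> objs (negc C) d \<Longrightarrow>
        (\<forall>b. box b (\<Psi>' (a @ d)) \<longrightarrow> sem B e a b) \<Longrightarrow> sem C e (\<Phi>' a) d"
    using assms(2) unfolding ent_def by metis
  let ?\<Gamma> = "posc A @ negc C"
  let ?B = "\<lambda>z. \<Psi>' (\<Phi> (take (length (posc A)) z) @ drop (length (posc A)) z)"
  let ?H = "\<lambda>z. \<Psi> (take (length (posc A)) (take (length ?\<Gamma>) z) @ drop (length ?\<Gamma>) z)"
  have B: "dfns ?\<Gamma> (map Star (negc B)) ?B"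
    by (intro dfns_comp[OF 2(2)] dfns_append dfns_comp[OF 1(1)] dfns_fst dfns_snd)
  have H: "dfns (?\<Gamma> @ negc B) (map Star (negc A)) ?H"
    by (intro dfns_comp[OF 1(2)] dfns_append dfns_comp[OF dfns_fst[of "posc A"] dfns_fst] dfns_snd)
  obtain U where U: "dfns ?\<Gamma> (map Star (negc A)) U"
    "\<And>z b. objs ?\<Gamma> z \<Longrightarrow> box b (?B z) \<Longrightarrow> subs (?H (z @ b)) (U z)"
    using dfns_BigUnion[OF B H] by blast
  show ?thesis unfolding ent_def
  proof (rule exI[of _ "\<lambda>a. \<Phi>' (\<Phi> a)"], rule exI[of _ U], intro conjI allI impI)
    fix e a d
    assume e: "valuation S e" and a: "objs (posc A) a" and d: "objs (negc C) d"
      and *: "\<forall>b. box b (U (a @ d)) \<longrightarrow> sem A e a b"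
    show "sem C e (\<Phi>' (\<Phi> a)) d"
    proof (rule 2(3)[OF e dfns_in[OF 1(1) a] d], intro allI impI)
      fix b assume b: "box b (\<Psi>' (\<Phi> a @ d))"
      have b': "objs (negc B) b"
        by (rule box_in[OF dfns_in[OF 2(2) objs_appendI[OF dfns_in[OF 1(1) a] d]] b])
      show "sem B e (\<Phi> a) b"
      proof (rule 1(3)[OF e a b'], intro allI impI)
        fix c assume "box c (\<Psi> (a @ b))"
        moreover have "subs (\<Psi> (a @ b)) (U (a @ d))"
          using U(2)[OF objs_appendI[OF a d], of b] b objs_length[OF a] objs_length[OF d] by simp
        ultimately show "sem A e a c" using * box_mono by blast
      qed
    qed
  qed (use U dfns_comp[OF 2(1) 1(1)] in auto)
qed

text \<open>The premise is used twice, with two sets of challenges to it; their union makes the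
  premise available for both uses.\<close>

lemma ent_conjI:
  assumes "A \<tturnstile> B" "A \<tturnstile> C" shows "A \<tturnstile> And B C"
proof -
  obtain \<Phi> \<Psi> where 1: "dfns (posc A) (posc B) \<Phi>" "dfns (posc A @ negc B) (map Star (negc A)) \<Psi>"
    "\<And>e a d. valuation S e \<Longrightarrow> objs (posc A) a \<Longrightarrow> objs (negc B) d \<Longrightarrow>
        (\<forall>b. box b (\<Psi> (a @ d)) \<longrightarrow> sem A e a b) \<Longrightarrow> sem B e (\<Phi> a) d"
    using assms(1) unfolding ent_def by metis
  obtain \<Phi>' \<Psi>' where 2: "dfns (posc A) (posc C) \<Phi>'" "dfns (posc A @ negc C) (map Star (negc A)) \<Psi>'"
    "\<And>e a d. valuation S e \<Longrightarrow> objs (posc A) a \<Longrightarrow> objs (negc C) d \<Longrightarrow>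
        (\<forall>b. box b (\<Psi>' (a @ d)) \<longrightarrow> sem A e a b) \<Longrightarrow> sem C e (\<Phi>' a) d"
    using assms(2) unfolding ent_def by metis
  let ?\<Gamma> = "posc A @ negc B @ negc C" and ?n = "length (posc A)" and ?m = "length (negc B)"
  have h1: "dfns ?\<Gamma> (map Star (negc A)) (\<lambda>z. \<Psi> (take ?n z @ take ?m (drop ?n z)))"
    by (intro dfns_comp[OF 1(2)] dfns_append dfns_comp[OF dfns_fst[of "negc B"] dfns_snd] dfns_fst)
  have h2: "dfns ?\<Gamma> (map Star (negc A)) (\<lambda>z. \<Psi>' (take ?n z @ drop ?m (drop ?n z)))"
    by (intro dfns_comp[OF 2(2)] dfns_append dfns_comp[OF dfns_snd[of "negc B"] dfns_snd] dfns_fst)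
  obtain U where U: "dfns ?\<Gamma> (map Star (negc A)) U"
    "\<And>z. objs ?\<Gamma> z \<Longrightarrow> subs (\<Psi> (take ?n z @ take ?m (drop ?n z))) (U z)"
    "\<And>z. objs ?\<Gamma> z \<Longrightarrow> subs (\<Psi>' (take ?n z @ drop ?m (drop ?n z))) (U z)"
    using dfns_Union[OF h1 h2] by blast
  show ?thesis unfolding ent_def
  proof (rule exI[of _ "\<lambda>a. \<Phi> a @ \<Phi>' a"], rule exI[of _ U], intro conjI allI impI)
    fix e a z
    assume e: "valuation S e" and a: "objs (posc A) a" and "objs (negc (And B C)) z"
      and *: "\<forall>b. box b (U (a @ z)) \<longrightarrow> sem A e a b"
    then have "objs (negc B @ negc C) z" by simp
    then obtain d d' where d: "z = d @ d'" "objs (negc B) d" "objs (negc C) d'" by (elim objs_appendE)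
    have z: "objs ?\<Gamma> (a @ z)" unfolding d(1) by (intro objs_appendI a d)
    have "subs (\<Psi> (a @ d)) (U (a @ z))" "subs (\<Psi>' (a @ d')) (U (a @ z))"
      using U(2,3)[OF z] objs_length[OF a] objs_length[OF d(2)] by (simp_all add: d(1))
    with * have "\<forall>b. box b (\<Psi> (a @ d)) \<longrightarrow> sem A e a b" "\<forall>b. box b (\<Psi>' (a @ d')) \<longrightarrow> sem A e a b"
      using box_mono by blast+
    then have "sem B e (\<Phi> a) d" "sem C e (\<Phi>' a) d'" using 1(3) 2(3) e a d by auto
    then show "sem (And B C) e (\<Phi> a @ \<Phi>' a) z"
      using objs_length[OF dfns_in[OF 1(1) a]] objs_length[OF d(2)] by (simp add: d(1))
  qed (use U dfns_append[OF 1(1) 2(1)] in auto)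
qed

lemma ent_conj1: "And A B \<tturnstile> A"
proof -
  let ?\<Gamma> = "(posc A @ posc B) @ negc A"
  obtain Z where Z: "dfns ?\<Gamma> (map Star (negc A)) Z"
    "\<And>z. objs ?\<Gamma> z \<Longrightarrow> box (drop (length (posc A @ posc B)) z) (Z z)"
    using dfns_Sing[OF dfns_snd] by blast
  \<comment> \<open>The discarded conjunct is challenged by arbitrary defaults. Their box is
    inhabited, which completes \<open>d\<close> to a challenge for the conjunction.\<close>
  obtain D where D: "dfns ?\<Gamma> (map Star (negc B)) D" using dfns_dflt by blast
  show ?thesis unfolding ent_def
  proof (rule exI[of _ "\<lambda>z. take (length (posc A)) z"], rule exI[of _ "\<lambda>z. Z z @ D z"], intro conjI allI impI)
    fix e z d
    assume e: "valuation S e" and "objs (posc (And A B)) z" and d: "objs (negc A) d"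
      and *: "\<forall>b. box b (Z (z @ d) @ D (z @ d)) \<longrightarrow> sem (And A B) e z b"
    then have z: "objs (posc A @ posc B) z" by simp
    have zd: "objs ?\<Gamma> (z @ d)" by (intro objs_appendI z d)
    obtain b' where "box b' (D (z @ d))" using box_nonempty[OF dfns_in[OF D zd]] by blast
    moreover have bd: "box d (Z (z @ d))" using Z(2)[OF zd] by (simp add: objs_length[OF z])
    ultimately have "box (d @ b') (Z (z @ d) @ D (z @ d))" by (simp add: box_append box_length)
    with * have "sem (And A B) e z (d @ b')" by blast
    then show "sem A e (take (length (posc A)) z) d" by (simp add: objs_length[OF d])
  qed (use dfns_fst dfns_append[OF Z(1) D] in auto)
qed

lemma ent_conj2: "And A B \<tturnstile> B"
proof -
  let ?\<Gamma> = "(posc A @ posc B) @ negc B"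
  obtain Z where Z: "dfns ?\<Gamma> (map Star (negc B)) Z"
    "\<And>z. objs ?\<Gamma> z \<Longrightarrow> box (drop (length (posc A @ posc B)) z) (Z z)"
    using dfns_Sing[OF dfns_snd] by blast
  obtain D where D: "dfns ?\<Gamma> (map Star (negc A)) D" using dfns_dflt by blast
  show ?thesis unfolding ent_def
  proof (rule exI[of _ "\<lambda>z. drop (length (posc A)) z"], rule exI[of _ "\<lambda>z. D z @ Z z"], intro conjI allI impI)
    fix e z d
    assume e: "valuation S e" and "objs (posc (And A B)) z" and d: "objs (negc B) d"
      and *: "\<forall>b. box b (D (z @ d) @ Z (z @ d)) \<longrightarrow> sem (And A B) e z b"
    then have z: "objs (posc A @ posc B) z" by simp
    have zd: "objs ?\<Gamma> (z @ d)" by (intro objs_appendI z d)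
    have D': "objs (map Star (negc A)) (D (z @ d))" using dfns_in[OF D zd] .
    then obtain b' where b': "box b' (D (z @ d))" using box_nonempty by blast
    moreover have bd: "box d (Z (z @ d))" using Z(2)[OF zd] by (simp add: objs_length[OF z])
    ultimately have "box (b' @ d) (D (z @ d) @ Z (z @ d))" by (simp add: box_append box_length)
    with * have "sem (And A B) e z (b' @ d)" by blast
    moreover have "length b' = length (negc A)" using box_in[OF D' b'] by (rule objs_length)
    ultimately show "sem B e (drop (length (posc A)) z) d" by simp
  qed (use dfns_snd dfns_append[OF D Z(1)] in auto)
qed

text \<open>\<open>\<Psi>\<close> is split: its part for \<open>Q\<close> is curried and becomes the
  \<open>g\<close> of the implication, a positive witness, while its part for \<open>P\<close>
  remains the function that produces challenges.\<close>

lemma ent_impI: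
  assumes "And P Q \<tturnstile> R" shows "P \<tturnstile> Imp Q R"
proof -
  obtain \<Phi> \<Psi> where 1: "dfns (posc P @ posc Q) (posc R) \<Phi>"
    "dfns ((posc P @ posc Q) @ negc R) (map Star (negc P @ negc Q)) \<Psi>"
    "\<And>e a d. valuation S e \<Longrightarrow> objs (posc P @ posc Q) a \<Longrightarrow> objs (negc R) d \<Longrightarrow>
        (\<forall>b. box b (\<Psi> (a @ d)) \<longrightarrow> sem (And P Q) e a b) \<Longrightarrow> sem R e (\<Phi> a) d"
    using assms unfolding ent_def by auto
  let ?n = "length (negc P)"
  have \<Psi>: "dfns (posc P @ (posc Q @ negc R)) (map Star (negc P @ negc Q)) \<Psi>" using 1(2) by simp
  obtain C where C: "dfns (posc P) (map (Fns (posc Q)) (posc R)) C"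
    "\<And>a q. objs (posc P) a \<Longrightarrow> objs (posc Q) q \<Longrightarrow> map (\<lambda>c. c \<cdot>\<cdot> q) (C a) = \<Phi> (a @ q)"
    using dfns_curry[OF 1(1)] by blast
  have "dfns (posc P @ (posc Q @ negc R)) (map Star (negc Q)) (\<lambda>z. drop ?n (\<Psi> z))"
    using dfns_drop[OF \<Psi>, of ?n] by simp
  then obtain D where D: "dfns (posc P) (map (Fns (posc Q @ negc R)) (map Star (negc Q))) D"
    "\<And>a q. objs (posc P) a \<Longrightarrow> objs (posc Q @ negc R) q \<Longrightarrow> map (\<lambda>c. c \<cdot>\<cdot> q) (D a) = drop ?n (\<Psi> (a @ q))"
    using dfns_curry by blast
  show ?thesis unfolding ent_def
  proof (rule exI[of _ "\<lambda>a. C a @ D a"], rule exI[of _ "\<lambda>z. take ?n (\<Psi> z)"], intro conjI allI impI)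
    show "dfns (posc P) (posc (Imp Q R)) (\<lambda>a. C a @ D a)"
      using dfns_append[OF C(1) D(1)] by (simp add: o_def)
    show "dfns (posc P @ negc (Imp Q R)) (map Star (negc P)) (\<lambda>z. take ?n (\<Psi> z))"
      using dfns_take[OF \<Psi>, of ?n] by simp
    fix e a z
    assume e: "valuation S e" and a: "objs (posc P) a" and "objs (negc (Imp Q R)) z"
      and *: "\<forall>b. box b (take ?n (\<Psi> (a @ z))) \<longrightarrow> sem P e a b"
    then have z: "objs (posc Q @ negc R) z" by simp
    then obtain q d where q: "z = q @ d" "objs (posc Q) q" "objs (negc R) d" by (elim objs_appendE)
    have lC: "length (C a) = length (posc R)" using objs_length[OF dfns_in[OF C(1) a]] by simp
    have az: "objs (posc P @ (posc Q @ negc R)) (a @ z)" by (intro objs_appendI a z)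
    show "sem (Imp Q R) e (C a @ D a) z"
      unfolding sem.simps imps_def
    proof (intro impI)
      assume "\<forall>b. box b (map (\<lambda>g. g \<cdot>\<cdot> z) (drop (length (posc R)) (C a @ D a))) \<longrightarrow>
        sem Q e (take (length (posc Q)) z) b"
      then have **: "\<And>b. box b (drop ?n (\<Psi> (a @ z))) \<Longrightarrow> sem Q e q b"
        using D(2)[OF a z] by (simp add: lC q(1) objs_length[OF q(2)])
      have "sem R e (\<Phi> (a @ q)) d"
      proof (rule 1(3)[OF e objs_appendI[OF a q(2)] q(3)], intro allI impI)
        fix b assume b: "box b (\<Psi> ((a @ q) @ d))"
        have lb: "length b = length (negc P @ negc Q)"
          using objs_length[OF box_in[OF dfns_in[OF \<Psi> az]]] b by (simp add: q(1))
        have l\<Psi>: "length (\<Psi> (a @ z)) = length b" using box_length[OF b] by (simp add: q(1))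
        have "box (take ?n b @ drop ?n b) (take ?n (\<Psi> (a @ z)) @ drop ?n (\<Psi> (a @ z)))"
          using b by (simp add: q(1))
        then have "box (take ?n b) (take ?n (\<Psi> (a @ z)))" "box (drop ?n b) (drop ?n (\<Psi> (a @ z)))"
          by (subst (asm) box_append; simp add: l\<Psi>)+
        with * ** show "sem (And P Q) e (a @ q) b" by (simp add: objs_length[OF a])
      qed
      then show "sem R e (map (\<lambda>f. f \<cdot>\<cdot> take (length (posc Q)) z) (take (length (posc R)) (C a @ D a)))
         (drop (length (posc Q)) z)"
        using C(2)[OF a q(2)] by (simp add: lC q(1) objs_length[OF q(2)])
    qed
  qed
qed

text \<open>The converse regrouping: the components \<open>g\<close> of the implication are applied
  to the witnesses of \<open>B\<close> and the challenge to \<open>C\<close>, and their values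
  become the challenges to \<open>B\<close>.\<close>

lemma ent_impE:
  assumes "A \<tturnstile> Imp B C" shows "And A B \<tturnstile> C"
proof -
  obtain \<Phi> \<Psi> where 1:
    "dfns (posc A) (map (Fns (posc B)) (posc C) @ map (Fns (posc B @ negc C)) (map Star (negc B))) \<Phi>"
    "dfns (posc A @ posc B @ negc C) (map Star (negc A)) \<Psi>"
    "\<And>e a d. valuation S e \<Longrightarrow> objs (posc A) a \<Longrightarrow> objs (posc B @ negc C) d \<Longrightarrow>
        (\<forall>b. box b (\<Psi> (a @ d)) \<longrightarrow> sem A e a b) \<Longrightarrow> sem (Imp B C) e (\<Phi> a) d"
    using assms unfolding ent_def by (auto simp: o_def)
  let ?n = "length (posc A)" and ?m = "length (posc C)"
  have F: "dfns (posc A) (map (Fns (posc B)) (posc C)) (\<lambda>a. take ?m (\<Phi> a))"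
    using dfns_take[OF 1(1), of ?m] by simp
  have G: "dfns (posc A) (map (Fns (posc B @ negc C)) (map Star (negc B))) (\<lambda>a. drop ?m (\<Phi> a))"
    using dfns_drop[OF 1(1), of ?m] by simp
  let ?F = "\<lambda>z. map (\<lambda>f. f \<cdot>\<cdot> drop ?n z) (take ?m (\<Phi> (take ?n z)))"
  let ?G = "\<lambda>z. map (\<lambda>f. f \<cdot>\<cdot> drop ?n z) (drop ?m (\<Phi> (take ?n z)))"
  have F': "dfns (posc A @ posc B) (posc C) ?F"
    by (rule dfns_map_apps[OF dfns_comp[OF F dfns_fst] dfns_snd])
  have G': "dfns (posc A @ posc B @ negc C) (map Star (negc B)) ?G"
    by (rule dfns_map_apps[OF dfns_comp[OF G dfns_fst] dfns_snd])
  show ?thesis unfolding ent_def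
  proof (rule exI[of _ ?F], rule exI[of _ "\<lambda>z. \<Psi> z @ ?G z"], intro conjI allI impI)
    show "dfns (posc (And A B)) (posc C) ?F" using F' by simp
    show "dfns (posc (And A B) @ negc C) (map Star (negc (And A B))) (\<lambda>z. \<Psi> z @ ?G z)"
      using dfns_append[OF 1(2) G'] by simp
    fix e z d
    assume e: "valuation S e" and "objs (posc (And A B)) z" and d: "objs (negc C) d"
      and *: "\<forall>b. box b (\<Psi> (z @ d) @ ?G (z @ d)) \<longrightarrow> sem (And A B) e z b"
    then have "objs (posc A @ posc B) z" by simp
    then obtain a q where q: "z = a @ q" "objs (posc A) a" "objs (posc B) q" by (elim objs_appendE)
    have len: "length a = ?n" "length q = length (posc B)" using q objs_length by auto
    have qd: "objs (posc B @ negc C) (q @ d)" by (intro objs_appendI q d)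
    have aqd: "objs (posc A @ posc B @ negc C) (a @ q @ d)" by (intro objs_appendI q d)
    have l\<Psi>: "length b = length (negc A)" if "box b (\<Psi> (a @ q @ d))" for b
      using objs_length[OF box_in[OF dfns_in[OF 1(2) aqd] that]] .
    have **: "sem A e a b \<and> sem B e q b'"
      if "box b (\<Psi> (a @ q @ d))" "box b' (map (\<lambda>f. f \<cdot>\<cdot> (q @ d)) (drop ?m (\<Phi> a)))" for b b'
      using *[rule_format, of "b @ b'"] that box_length[OF that(1)] l\<Psi>[OF that(1)]
      by (simp add: q(1) len box_append)
    have "objs (map Star (negc B)) (map (\<lambda>f. f \<cdot>\<cdot> (q @ d)) (drop ?m (\<Phi> a)))"
      using dfns_in[OF G' aqd] by (simp add: len)
    \<comment> \<open>The premise speaks of pairs of challenges. As both boxes are inhabited, it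
      splits into one statement for each conjunct.\<close>
    from box_nonempty[OF this] box_nonempty[OF dfns_in[OF 1(2) aqd]]
    have "\<forall>b. box b (\<Psi> (a @ q @ d)) \<longrightarrow> sem A e a b"
      "\<forall>b. box b (map (\<lambda>f. f \<cdot>\<cdot> (q @ d)) (drop ?m (\<Phi> a))) \<longrightarrow> sem B e q b"
      using ** by blast+
    with 1(3)[OF e q(2) qd] show "sem C e (?F z) d"
      by (simp add: imps_def len q(1))
  qed
qed

lemma ent_mp: "P \<tturnstile> Imp A B \<Longrightarrow> P \<tturnstile> A \<Longrightarrow> P \<tturnstile> B"
  using ent_impE ent_conjI ent_refl ent_trans by blast

text \<open>The same realizers serve: they are independent of the valuation, and the truth of the
  premise does not change when \<open>v\<close> varies.\<close>

lemma ent_allI: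
  assumes "P \<tturnstile> A" "v \<notin> set (fv P)" shows "P \<tturnstile> All v A"
  using assms(1) unfolding ent_def
  by (elim exE conjE, intro exI conjI)
    (assumption | simp add: valuation_upd assms(2))+

text \<open>An instance is given semantically, by an object at which the body is realized as
  \<open>B\<close> is. The object may depend on the valuation, so instances by terms and by the
  current value of \<open>v\<close> are both covered.\<close>

lemma ent_allE:
  assumes "posc B = posc A" "negc B = negc A"
    "\<And>e. valuation S e \<Longrightarrow> \<exists>u\<in>obj S (snd v). sem B e = sem A (e(v := u))"
  shows "All v A \<tturnstile> B"
  by (rule ent_semI) (use assms in \<open>auto, metis\<close>)

text \<open>For formulas such as equations and negated equations: having no positive witnesses, they
  are realized by the empty tuple once they are true. Challenges to \<open>P\<close> are
  defaults.\<close>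

lemma ent_top: 
  assumes "posc B = []" "\<And>e d. valuation S e \<Longrightarrow> objs (negc B) d \<Longrightarrow> sem B e [] d"
  shows "P \<tturnstile> B"
proof -
  obtain D where "dfns (posc P @ negc B) (map Star (negc P)) D" using dfns_dflt by blast
  with assms show ?thesis unfolding ent_def
    by - (rule exI[of _ "\<lambda>_. []"], rule exI[of _ D], simp)
qed

section \<open>Distinction of cases and induction\<close>

lemma ent_join:
  assumes "P \<tturnstile> A" "P \<tturnstile> B" "pos_neg I_cb A = pos_neg I_cb C" "pos_neg I_cb B = pos_neg I_cb C"
    and "\<And>e. valuation S e \<Longrightarrow> sem C e = sem A e \<or> sem C e = sem B e"
  shows "P \<tturnstile> C"
proof -
  obtain \<Phi> \<Psi> where 1: "dfns (posc P) (posc C) \<Phi>" "dfns (posc P @ negc C) (map Star (negc P)) \<Psi>"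
    "\<And>e a d. valuation S e \<Longrightarrow> objs (posc P) a \<Longrightarrow> objs (negc C) d \<Longrightarrow>
        (\<forall>b. box b (\<Psi> (a @ d)) \<longrightarrow> sem P e a b) \<Longrightarrow> sem A e (\<Phi> a) d"
    using assms(1) unfolding ent_def assms(3) by metis
  obtain \<Phi>' \<Psi>' where 2: "dfns (posc P) (posc C) \<Phi>'" "dfns (posc P @ negc C) (map Star (negc P)) \<Psi>'"
    "\<And>e a d. valuation S e \<Longrightarrow> objs (posc P) a \<Longrightarrow> objs (negc C) d \<Longrightarrow>
        (\<forall>b. box b (\<Psi>' (a @ d)) \<longrightarrow> sem P e a b) \<Longrightarrow> sem B e (\<Phi>' a) d"
    using assms(2) unfolding ent_def assms(4) by metis
  obtain U where U: "dfns (posc P @ negc C) (map Star (negc P)) U"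
    "\<And>z. objs (posc P @ negc C) z \<Longrightarrow> subs (\<Psi> z) (U z)"
    "\<And>z. objs (posc P @ negc C) z \<Longrightarrow> subs (\<Psi>' z) (U z)"
    using dfns_Union[OF 1(2) 2(2)] by blast
  show ?thesis unfolding ent_def
  proof (rule exI[of _ "\<lambda>a. jns (posc C) (\<Phi> a) (\<Phi>' a)"], rule exI[of _ U], intro conjI allI impI)
    fix e a d
    assume e: "valuation S e" and a: "objs (posc P) a" and d: "objs (negc C) d"
      and *: "\<forall>b. box b (U (a @ d)) \<longrightarrow> sem P e a b"
    then have "sem A e (\<Phi> a) d" "sem B e (\<Phi>' a) d"
      using 1(3) 2(3) box_mono U(2,3) objs_appendI by blast+
    \<comment> \<open>Which alternative holds may depend on the valuation. The joined witness covers
      both, at the price of meeting the challenges of both.\<close>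
    with assms(5)[OF e] have "sem C e (\<Phi> a) d \<or> sem C e (\<Phi>' a) d" by auto
    then show "sem C e (jns (posc C) (\<Phi> a) (\<Phi>' a)) d"
      using sem_join_closed[of C e] dfns_in[OF 1(1) a] dfns_in[OF 2(1) a] d unfolding join_closed_def by blast
  qed (use U dfns_jns[OF 1(1) 2(1)] in auto)
qed

text \<open>
  A witness for \<open>X\<close> at all \<open>n \<le> k + 1\<close> is the join of a witness for all \<open>n \<le> k\<close> with the
  result of the step applied to it.
\<close>

lemma ent_induction_uniform:
  assumes v: "snd v = TN"
    and X0: "Top \<tturnstile> X0" and XS: "And (IAt TN (Var v)) X \<tturnstile> XS"
    and p0: "pos_neg I_cb X0 = pos_neg I_cb X" "\<And>e. valuation S e \<Longrightarrow> sem X0 e = sem X (e(v := num S 0))"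
    and pS: "pos_neg I_cb XS = pos_neg I_cb X"
      "\<And>e. valuation S e \<Longrightarrow> sem XS e = sem X (e(v := num S (Suc (nat_of S (e v)))))"
  shows "IAt TN (Var v) \<tturnstile> X"
proof -
  obtain \<Phi>0 where Z: "dfns [] (posc X) \<Phi>0"
    "\<And>e d. valuation S e \<Longrightarrow> objs (negc X) d \<Longrightarrow> sem X0 e (\<Phi>0 []) d"
    using X0 unfolding ent_def p0(1) by (auto simp: imps_def)
  obtain \<Phi> \<Psi> where 1: "dfns (TN # posc X) (posc X) \<Phi>"
    "dfns ((TN # posc X) @ negc X) (map Star (negc X)) \<Psi>"
    "\<And>e a d. valuation S e \<Longrightarrow> objs (TN # posc X) a \<Longrightarrow> objs (negc X) d \<Longrightarrow>
        (\<forall>b. box b (\<Psi> (a @ d)) \<longrightarrow> sem (And (IAt TN (Var v)) X) e a b) \<Longrightarrow> sem XS e (\<Phi> a) d"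
    using XS unfolding ent_def pS(1) by auto
  have t: "dfns (TN # posc X) (posc X) (\<lambda>z. drop 1 z)"
    using dfns_snd[of "[TN]" "posc X"] by simp
  have x0: "dfns [] (posc X) (\<lambda>_. \<Phi>0 [])" by (rule dfns_cong[OF Z(1)]) simp
  \<comment> \<open>The counter handed to \<open>\<Phi>\<close> acts as the witness of
    \<open>\<I>\<close>: it is the bound for the value of \<open>v\<close> at which the step is
    used.\<close>
  obtain R where R: "dfns [TN] (posc X) R" "R [num S 0] = \<Phi>0 []"
    "\<And>n. R [num S (Suc n)] = jns (posc X) (R [num S n]) (\<Phi> (num S n # R [num S n]))"
    using dfns_rec[OF dfns_jns[OF t 1(1)] x0] by auto
  have Rin: "objs (posc X) (R [num S n])" for n using dfns_in[OF R(1)] by simp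
  \<comment> \<open>Valuation and challenge stay general: the step refers to a smaller value of
    \<open>v\<close> and to every challenge supplied by \<open>\<Psi>\<close>.\<close>
  have main: "sem X e (R [num S k]) d"
    if "valuation S e" "nat_of S (e v) \<le> k" "objs (negc X) d" for e k d
    using that
  proof (induction k arbitrary: e d)
    case 0
    have "e v \<in> obj S TN" using v 0(1) unfolding valuation_def by metis
    then have "e v = num S 0" using 0(2) by (auto elim!: num_cases)
    then have "e(v := num S 0) = e" by auto
    then show ?case using p0(2)[OF 0(1)] Z(2)[OF 0(1,3)] by (simp add: R(2))
  next
    case (Suc k)
    have ev: "e v \<in> obj S TN" using v Suc.prems(1) unfolding valuation_def by metis
    have in': "objs (posc X) (\<Phi> (num S k # R [num S k]))"
      using dfns_in[OF 1(1)] Rin by simp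
    have "sem X e (R [num S k]) d \<or> sem X e (\<Phi> (num S k # R [num S k])) d"
    proof (cases "nat_of S (e v) \<le> k")
      case True
      then show ?thesis using Suc by blast
    next
      case False
      then have ev': "e v = num S (Suc k)" using Suc.prems ev by (metis le_antisym not_less_eq_eq num_nat_of)
      \<comment> \<open>The step is used at the predecessor of the value of \<open>v\<close>, so
        that its conclusion concerns that value itself.\<close>
      let ?e = "e(v := num S k)"
      have e': "valuation S ?e" using Suc.prems v by (auto intro!: valuation_upd)
      have "sem (And (IAt TN (Var v)) X) ?e (num S k # R [num S k]) b" if "objs (negc X) b" for b
        using Suc.IH[OF e' _ that] by (simp add: fun_upd_def)
      moreover have "objs (negc X) b" if "box b (\<Psi> ((num S k # R [num S k]) @ d))" for b
        using box_in[OF dfns_in[OF 1(2)] that] objs_appendI[of "TN # posc X" "num S k # R [num S k]", OF _ Suc.prems(3)] Rin by simp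
      ultimately have "sem XS ?e (\<Phi> (num S k # R [num S k])) d"
        using 1(3)[OF e', of "num S k # R [num S k]" d] Rin Suc.prems(3) by simp
      moreover have "?e(v := num S (Suc k)) = e" using ev' by auto
      ultimately show ?thesis using pS(2)[OF e'] by simp
    qed
    then show ?case unfolding R(3)
      using sem_join_closed[of X e] Rin in' Suc.prems(3) unfolding join_closed_def by blast
  qed
  show ?thesis unfolding ent_def
  \<comment> \<open>\<open>\<I>\<close> at \<open>TN\<close> has no negative witnesses, so the empty
    tuple of challenge sets gives access to the bound.\<close>
  proof (rule exI[of _ R], rule exI[of _ "\<lambda>_. []"], intro conjI allI impI)
    fix e a d assume e: "valuation S e" and "objs (posc (IAt TN (Var v))) a" and d: "objs (negc X) d"
      and *: "\<forall>b. box b [] \<longrightarrow> sem (IAt TN (Var v)) e a b"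
    then obtain n where a: "a = [n]" "n \<in> obj S TN" by (auto elim!: objs1E)
    with * have "nat_of S (e v) \<le> nat_of S n" by simp
    from main[OF e this d] show "sem X e (R a) d" using a by simp
  qed (use R in auto)
qed

end

section \<open>Truth of interpreted formulas\<close>

lemma interp_IAt [simp]: "interp I_cb k (IAt \<sigma> t) ps ns = cb_fm \<sigma> k t ps ns"
  by (simp add: I_cb_def)

declare interp.simps(2) [simp del]

lemma new_vars_simps [simp]:
  "length (new_vars k \<sigma>s) = length \<sigma>s" "map snd (new_vars k \<sigma>s) = \<sigma>s" "distinct (new_vars k \<sigma>s)"
  by (simp_all add: new_vars_def distinct_zipI1)

lemma new_vars_index: "v \<in> set (new_vars k \<sigma>s) \<Longrightarrow> k \<le> fst v \<and> fst v < k + length \<sigma>s"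
  by (cases v) (auto simp: new_vars_def dest: set_zip_leftD)

lemma new_vars_typed: "list_all2 has_type (map Var (new_vars k \<sigma>s)) \<sigma>s"
proof -
  have "has_type (Var v) (snd v)" for v by (metis has_type.intros(1) prod.collapse)
  moreover have "snd (new_vars k \<sigma>s ! i) = \<sigma>s ! i" if "i < length \<sigma>s" for i
    using that by (simp add: new_vars_def)
  ultimately show ?thesis
    by (metis (mono_tags, lifting) length_map list_all2_conv_all_nth new_vars_simps(1) nth_map)
qed

lemma has_type_Apps: "has_type f (Fns \<Delta> \<sigma>) \<Longrightarrow> list_all2 has_type ts \<Delta> \<Longrightarrow> has_type (Apps f ts) \<sigma>"
proof (induction \<Delta> arbitrary: f ts)
  case (Cons \<delta> \<Delta>)
  then obtain u us where "ts = u # us" "has_type u \<delta>" "list_all2 has_type us \<Delta>"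
    by (auto simp: list_all2_Cons2)
  with Cons show ?case by (auto intro: has_type.intros(3))
qed auto

lemma fv_Apps [simp]: "set (fv_tm (Apps f ts)) = set (fv_tm f) \<union> (\<Union>t\<in>set ts. set (fv_tm t))"
  by (induction ts arbitrary: f) auto

lemma tm_val_Apps [simp]: "tm_val S e (Apps f ts) = foldl (ap S) (tm_val S e f) (map (tm_val S e) ts)"
  by (induction ts arbitrary: f) auto

lemma bound_tm: "v \<in> set (fv_tm t) \<Longrightarrow> fst v < bound_tm t"
  by (induction t) (auto simp: less_max_iff_disj)

lemma bound_fm: "v \<in> set (fv A) \<Longrightarrow> fst v < bound_fm A"
  by (induction A) (auto simp: less_max_iff_disj dest: bound_tm)

text \<open>Well-typedness for formulas that may contain the predicates \<open>\<I>\<close>, as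
  relativized axioms do; \<open>ha_fm\<close> excludes them.\<close>

primrec fm_ok :: "fm \<Rightarrow> bool" where
  "fm_ok (Eq \<sigma> s t) \<longleftrightarrow> has_type s \<sigma> \<and> has_type t \<sigma>"
| "fm_ok (IAt \<sigma> t) \<longleftrightarrow> has_type t \<sigma>"
| "fm_ok Bot \<longleftrightarrow> True"
| "fm_ok (And A B) \<longleftrightarrow> fm_ok A \<and> fm_ok B"
| "fm_ok (Imp A B) \<longleftrightarrow> fm_ok A \<and> fm_ok B"
| "fm_ok (All v A) \<longleftrightarrow> fm_ok A"
| "fm_ok (Ex v A) \<longleftrightarrow> fm_ok A"

section \<open>Typing of interpreted formulas\<close>

lemma tfm_ok_TBall:
  "list_all2 has_type Bs (map Star (map snd bs)) \<Longrightarrow> tfm_ok \<phi> \<Longrightarrow> tfm_ok (TBall bs Bs \<phi>)"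
proof (induction bs Bs \<phi> rule: TBall.induct)
  case (1 b bs B Bs \<phi>)
  then show ?case by (cases b) (auto intro: has_type.intros)
qed auto

text \<open>Implications and \<open>\<I>\<close> at function types split their witness tuples in the
  same way, so the typing of the pieces is shared by both.\<close>

lemma imp_typed:
  assumes ps: "list_all2 has_type ps (imp_pos as bs cs ds)" and ns: "list_all2 has_type ns (as @ ds)"
  shows "list_all2 has_type (take (length as) ns) as" "list_all2 has_type (drop (length as) ns) ds"
    "list_all2 has_type (map (\<lambda>f. Apps f (take (length as) ns)) (take (length cs) ps)) cs"
    "list_all2 has_type (map (\<lambda>g. Apps g (take (length as) ns @ drop (length as) ns)) (drop (length cs) ps))
       (map Star bs)"
proof -
  have "list_all2 has_type (take (length as) ns) (take (length as) (as @ ds))"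
    using ns by (rule list_all2_takeI)
  then show a: "list_all2 has_type (take (length as) ns) as" by simp
  have "list_all2 has_type (drop (length as) ns) (drop (length as) (as @ ds))"
    using ns by (rule list_all2_dropI)
  then show "list_all2 has_type (drop (length as) ns) ds" by simp
  have "list_all2 has_type (take (length cs) ps) (take (length cs) (imp_pos as bs cs ds))"
    using ps by (rule list_all2_takeI)
  then have "list_all2 has_type (take (length cs) ps) (map (Fns as) cs)" by simp
  then show "list_all2 has_type (map (\<lambda>f. Apps f (take (length as) ns)) (take (length cs) ps)) cs"
    using a by (auto simp: list_all2_map1 list_all2_map2 elim!: list_all2_mono intro: has_type_Apps)
  have "list_all2 has_type (drop (length cs) ps) (drop (length cs) (imp_pos as bs cs ds))"
    using ps by (rule list_all2_dropI)
  then have "list_all2 has_type (drop (length cs) ps) (map (Fns (as @ ds)) (map Star bs))"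
    by (simp add: o_def)
  then show "list_all2 has_type (map (\<lambda>g. Apps g (take (length as) ns @ drop (length as) ns)) (drop (length cs) ps))
       (map Star bs)"
    unfolding append_take_drop_id
    using ns by (auto simp: list_all2_map1 list_all2_map2 simp del: foldr_append elim!: list_all2_mono
        intro: has_type_Apps[of _ "as @ ds"])
qed

lemma plus_tm_type: "has_type s TN \<Longrightarrow> has_type t TN \<Longrightarrow> has_type (plus_tm s t) TN"
proof -
  assume "has_type s TN" "has_type t TN"
  moreover have "has_type (Con (cRec [TN] 0)) (Fns [TN, TN, TN \<Rrightarrow> TN \<Rrightarrow> TN] TN)"
    using has_type.intros(2)[of "cRec [TN] 0"] by (simp add: step_tys_def)
  moreover have "has_type (App (Con (cPi (TN \<Rrightarrow> TN) TN)) (Con cSuc)) (TN \<Rrightarrow> TN \<Rrightarrow> TN)"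
    using has_type.intros(2)[of "cPi (TN \<Rrightarrow> TN) TN"] has_type.intros(2)[of cSuc]
    by (auto intro: has_type.intros(3))
  ultimately show ?thesis unfolding plus_tm_def by (intro has_type_Apps[of _ "[TN, TN, TN \<Rrightarrow> TN \<Rrightarrow> TN]"]) auto
qed

lemma tfm_ok_cb_fm:
  "has_type h \<sigma> \<Longrightarrow> list_all2 has_type ps (cb_pos \<sigma>) \<Longrightarrow> list_all2 has_type ns (cb_neg \<sigma>) \<Longrightarrow>
   tfm_ok (cb_fm \<sigma> k h ps ns)"
proof (induction \<sigma> arbitrary: k h ps ns)
  case TN
  then obtain p where "ps = [p]" "has_type p TN" by (auto simp: list_all2_Cons2)
  with TN show ?case by (auto simp: TLeq_def intro: plus_tm_type has_type.intros)
next
  case (Fn \<rho> \<sigma>)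
  have ps: "list_all2 has_type ps (imp_pos (cb_pos \<rho>) (cb_neg \<rho>) (cb_pos \<sigma>) (cb_neg \<sigma>))"
    and ns: "list_all2 has_type ns (cb_pos \<rho> @ cb_neg \<sigma>)"
    using Fn.prems by simp_all
  note t = imp_typed[OF ps ns]
  show ?case
    unfolding cb_fm.simps Let_def tfm_ok.simps
    by (intro conjI tfm_ok_TBall Fn.IH t new_vars_typed)
      (use t(4) Fn.prems(1) in \<open>auto intro: has_type.intros\<close>)
qed auto

lemma tfm_ok_interp:
  "fm_ok A \<Longrightarrow> list_all2 has_type ps (posc A) \<Longrightarrow> list_all2 has_type ns (negc A) \<Longrightarrow>
   tfm_ok (interp I_cb k A ps ns)"
proof (induction A arbitrary: k ps ns)
  case (IAt \<sigma> t)
  then show ?case using tfm_ok_cb_fm by simp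
next
  case (And A B)
  have "list_all2 has_type ps (posc A @ posc B)" "list_all2 has_type ns (negc A @ negc B)"
    using And.prems by simp_all
  then have "list_all2 has_type (take (length (posc A)) ps) (posc A)"
    "list_all2 has_type (drop (length (posc A)) ps) (posc B)"
    "list_all2 has_type (take (length (negc A)) ns) (negc A)"
    "list_all2 has_type (drop (length (negc A)) ns) (negc B)"
    by (metis append_eq_conv_conj list_all2_append2 list_all2_lengthD)+
  with And show ?case by simp
next
  case (Imp A B)
  have ps: "list_all2 has_type ps (imp_pos (posc A) (negc A) (posc B) (negc B))"
    and ns: "list_all2 has_type ns (posc A @ negc B)"
    using Imp.prems by simp_all
  note t = imp_typed[OF ps ns]
  show ?case
    unfolding interp.simps Let_def tfm_ok.simps
    by (intro conjI tfm_ok_TBall Imp.IH t new_vars_typed)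
      (use t(4) Imp.prems(1) in auto)
next
  case (Ex v A)
  then show ?case
    by (auto simp: Let_def intro!: tfm_ok_TBall Ex.IH new_vars_typed)
qed auto

lemma wit_Fns [simp]: "wit_ty (Fns \<Delta> \<sigma>) \<longleftrightarrow> (\<forall>\<delta>\<in>set \<Delta>. wit_ty \<delta>) \<and> wit_ty \<sigma>"
  by (induction \<Delta>) auto

lemma wit_cb: "\<forall>\<tau>\<in>set (cb_pos \<sigma>) \<union> set (cb_neg \<sigma>). wit_ty \<tau>"
  by (induction \<sigma>) auto

lemma wit_pos_neg: "\<forall>\<tau>\<in>set (posc A) \<union> set (negc A). wit_ty \<tau>"
proof (induction A)
  case (IAt \<sigma> t)
  show ?case using wit_cb[of \<sigma>] by simp
qed auto

fun upds :: "(var \<Rightarrow> 'a) \<Rightarrow> var list \<Rightarrow> 'a list \<Rightarrow> var \<Rightarrow> 'a" where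
  "upds e (b # bs) (u # us) = upds (e(b := u)) bs us"
| "upds e _ _ = e"

lemma upds_other: "v \<notin> set bs \<Longrightarrow> upds e bs us v = e v"
  by (induction e bs us rule: upds.induct) auto

lemma upds_map: "distinct bs \<Longrightarrow> length us = length bs \<Longrightarrow> map (upds e bs us) bs = us"
  by (induction e bs us rule: upds.induct) (auto simp: upds_other)

lemma fv_TAlls: "set (fv_tfm (TAlls vs \<phi>)) = set (fv_tfm \<phi>) - set vs"
  by (induction vs) auto

lemma tfm_ok_TAlls: "tfm_ok (TAlls vs \<phi>) = tfm_ok \<phi>"
  by (induction vs) auto

context full begin

section \<open>Evaluation of bounded quantifiers, implications and interpreted formulas\<close>

lemma valuation_upds:
  "valuation S e \<Longrightarrow> objs (map snd bs) us \<Longrightarrow> valuation S (upds e bs us)"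
proof (induction e bs us rule: upds.induct)
  case (1 e b bs u us)
  then show ?case by (auto intro!: "1.IH" valuation_upd)
qed auto

lemma tm_val_upds:
  "set (fv_tm t) \<inter> set bs = {} \<Longrightarrow> tm_val S (upds e bs us) t = tm_val S e t"
  by (rule tm_val_cong, rule upds_other) blast

text \<open>The quantified variables do not occur in the bounds. All bounds may therefore be
  evaluated in the outer valuation, and the nested quantifiers merge into one over a
  product.\<close>

lemma sat_TBall:
  "distinct bs \<Longrightarrow> \<forall>B\<in>set Bs. set (fv_tm B) \<inter> set bs = {} \<Longrightarrow>
   objs (map Star (map snd bs)) (map (tm_val S e) Bs) \<Longrightarrow>
   sat S e (TBall bs Bs \<phi>) \<longleftrightarrow> (\<forall>us. box us (map (tm_val S e) Bs) \<longrightarrow> sat S (upds e bs us) \<phi>)"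
proof (induction bs Bs \<phi> arbitrary: e rule: TBall.induct)
  case (1 b bs B Bs \<phi>)
  have B: "tm_val S (e(b := u)) B = tm_val S e B" for u using "1.prems"(2) by simp
  have Bs: "map (tm_val S (e(b := u))) Bs = map (tm_val S e) Bs" for u
    using "1.prems"(2) by simp
  have BB: "tm_val S e B \<in> obj S (Star (snd b))" using "1.prems"(3) by simp
  have IH: "sat S (e(b := u)) (TBall bs Bs \<phi>) \<longleftrightarrow>
     (\<forall>us. box us (map (tm_val S e) Bs) \<longrightarrow> sat S (upds (e(b := u)) bs us) \<phi>)" for u
    using "1.IH"[of "e(b := u)"] "1.prems" unfolding Bs by (simp add: fun_upd_def)
  have "sat S e (TBall (b # bs) (B # Bs) \<phi>) \<longleftrightarrow> (\<forall>u\<in>elts S (tm_val S e B). sat S (e(b := u)) (TBall bs Bs \<phi>))"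
    using elts_props(1)[OF BB] by (auto simp: B)
  also have "\<dots> \<longleftrightarrow> (\<forall>us. box us (map (tm_val S e) (B # Bs)) \<longrightarrow> sat S (upds e (b # bs) us) \<phi>)"
    unfolding IH
  proof (intro iffI allI impI ballI)
    fix us assume *: "\<forall>u\<in>elts S (tm_val S e B). \<forall>us. box us (map (tm_val S e) Bs) \<longrightarrow> sat S (upds (e(b := u)) bs us) \<phi>"
      and "box us (map (tm_val S e) (B # Bs))"
    then obtain u us' where "us = u # us'" "u \<in> elts S (tm_val S e B)" "box us' (map (tm_val S e) Bs)"
      by (auto simp: box_def list_all2_Cons2)
    with * show "sat S (upds e (b # bs) us) \<phi>" by simp
  next
    fix u us assume *: "\<forall>us. box us (map (tm_val S e) (B # Bs)) \<longrightarrow> sat S (upds e (b # bs) us) \<phi>"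
      and "u \<in> elts S (tm_val S e B)" "box us (map (tm_val S e) Bs)"
    then show "sat S (upds (e(b := u)) bs us) \<phi>" using *[rule_format, of "u # us"] by simp
  qed
  finally show ?case .
qed (auto simp: objs_def)

lemma tm_vals_in:
  "valuation S e \<Longrightarrow> list_all2 has_type ts \<Delta> \<Longrightarrow> objs \<Delta> (map (tm_val S e) ts)"
  by (auto simp: objs_def list_all2_map1 valuation_def elim!: list_all2_mono intro!: tm_val_in)

text \<open>The step common to \<open>sat_cb_fm\<close> and \<open>sat_interp\<close>;
  \<open>P\<close> and \<open>Q\<close> stand for the semantic clauses of premise and conclusion in
  either case.\<close>

lemma sat_imp:
  assumes e: "valuation S e"
    and ps: "list_all2 has_type ps (imp_pos as \<beta>s cs ds)" and ns: "list_all2 has_type ns (as @ ds)"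
    and fr: "\<forall>t\<in>set (ps @ ns). \<forall>v\<in>set (fv_tm t). fst v < k"
    and A: "\<And>us. objs \<beta>s us \<Longrightarrow> sat S (upds e (new_vars k \<beta>s) us) \<phi> \<longleftrightarrow>
      P (map (tm_val S e) (take (length as) ns)) us"
    and B: "sat S e \<psi> \<longleftrightarrow> Q (map (tm_val S e) (map (\<lambda>f. Apps f (take (length as) ns)) (take (length cs) ps)))
       (map (tm_val S e) (drop (length as) ns))"
  shows "sat S e (TImp (TBall (new_vars k \<beta>s)
       (map (\<lambda>g. Apps g (take (length as) ns @ drop (length as) ns)) (drop (length cs) ps)) \<phi>) \<psi>) \<longleftrightarrow>
     imps (length as) (length cs) P Q (map (tm_val S e) ps) (map (tm_val S e) ns)"
proof -
  let ?Bs = "map (\<lambda>g. Apps g (take (length as) ns @ drop (length as) ns)) (drop (length cs) ps)"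
  have Bs: "list_all2 has_type ?Bs (map Star \<beta>s)" by (rule imp_typed(4)[OF ps ns])
  have Bin: "objs (map Star \<beta>s) (map (tm_val S e) ?Bs)" by (rule tm_vals_in[OF e Bs])
  have "set (fv_tm B) \<inter> set (new_vars k \<beta>s) = {}" if B: "B \<in> set ?Bs" for B
  proof -
    obtain g where "g \<in> set ps" "B = Apps g ns"
      using B by (auto simp del: foldl_append simp flip: foldl_append dest: in_set_dropD)
    then have "fst v < k" if "v \<in> set (fv_tm B)" for v
      using that fr by auto
    then show ?thesis using new_vars_index by fastforce
  qed
  then have "sat S e (TBall (new_vars k \<beta>s) ?Bs \<phi>) \<longleftrightarrow>
     (\<forall>us. box us (map (tm_val S e) ?Bs) \<longrightarrow> sat S (upds e (new_vars k \<beta>s) us) \<phi>)"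
    using Bin by (intro sat_TBall) auto
  \<comment> \<open>Elements of the box are well typed, and for such tuples the assumption on
    \<open>\<phi>\<close> is available.\<close>
  also have "\<dots> \<longleftrightarrow> (\<forall>us. box us (map (tm_val S e) ?Bs) \<longrightarrow> P (map (tm_val S e) (take (length as) ns)) us)"
    using A box_in[OF Bin] by blast
  also have "map (tm_val S e) ?Bs = map (\<lambda>g. g \<cdot>\<cdot> map (tm_val S e) ns) (drop (length cs) (map (tm_val S e) ps))"
    by (simp add: drop_map o_def flip: map_append)
  finally show ?thesis
    using B by (simp add: imps_def take_map drop_map o_def)
qed

text \<open>The recursion runs over the second summand and starts from the first.
  \<open>\<Pi>\<close> discards the counter, so each step is a plain successor.\<close>

lemma plus_val:
  assumes "tm_val S e s = num S m" "tm_val S e t = num S n"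
  shows "tm_val S e (plus_tm s t) = num S (m + n)"
proof -
  let ?f = "cst_val S (cPi (TN \<Rrightarrow> TN) TN) \<cdot> cst_val S cSuc"
  have suc: "cst_val S cSuc \<in> obj S (TN \<Rrightarrow> TN)" using cst_val_in[of cSuc] by simp
  have f: "?f \<in> obj S (TN \<Rrightarrow> TN \<Rrightarrow> TN)"
    using cst_val_in[of "cPi (TN \<Rrightarrow> TN) TN"] suc by simp
  have r: "rec_val S n [num S m] [?f] = [num S (m + n)]" for n
    by (induction n) (simp_all add: Pi_ap[OF suc] Suc_ap)
  have "cst_val S (cRec [TN] 0) \<cdot>\<cdot> (num S n # [num S m] @ [?f]) = num S (m + n)"
    by (subst Rec_apps) (use f r in \<open>auto simp: step_tys_def\<close>)
  then show ?thesis by (simp add: plus_tm_def assms)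
qed

lemma sat_cb_fm:
  "valuation S e \<Longrightarrow> has_type h \<sigma> \<Longrightarrow> list_all2 has_type ps (cb_pos \<sigma>) \<Longrightarrow>
   list_all2 has_type ns (cb_neg \<sigma>) \<Longrightarrow> \<forall>t\<in>set (h # ps @ ns). \<forall>v\<in>set (fv_tm t). fst v < k \<Longrightarrow>
   sat S e (cb_fm \<sigma> k h ps ns) \<longleftrightarrow> cbs \<sigma> (tm_val S e h) (map (tm_val S e) ps) (map (tm_val S e) ns)"
proof (induction \<sigma> arbitrary: e k h ps ns)
  case TN
  then obtain p where p: "ps = [p]" "has_type p TN" by (auto simp: list_all2_Cons2)
  have "tm_val S e h \<in> obj S TN" "tm_val S e p \<in> obj S TN"
    using TN.prems(1,2) p by (auto simp: valuation_def intro!: tm_val_in)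
  then obtain m n where mn: "tm_val S e h = num S m" "tm_val S e p = num S n" by (elim num_cases)
  have k: "(k, TN) \<notin> set (fv_tm h)" "(k, TN) \<notin> set (fv_tm p)" using TN.prems(5) p by auto
  have "sat S e (cb_fm TN k h ps ns) \<longleftrightarrow> (\<exists>z. num S (m + z) = num S n)"
  proof
    assume "sat S e (cb_fm TN k h ps ns)"
    then obtain u where u: "u \<in> obj S TN"
      "tm_val S (e((k, TN) := u)) (plus_tm h (Var (k, TN))) = tm_val S (e((k, TN) := u)) p"
      by (auto simp: p TLeq_def)
    obtain z where "u = num S z" using u(1) by (elim num_cases)
    then have "num S (m + z) = num S n"
      using u(2) plus_val[of "e((k, TN) := u)" h m "Var (k, TN)" z] k mn by simp
    then show "\<exists>z. num S (m + z) = num S n" ..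
  next
    assume "\<exists>z. num S (m + z) = num S n"
    then obtain z where "num S (m + z) = num S n" ..
    then have "tm_val S (e((k, TN) := num S z)) (plus_tm h (Var (k, TN))) = tm_val S (e((k, TN) := num S z)) p"
      using plus_val[of "e((k, TN) := num S z)" h m "Var (k, TN)" z] k mn by simp
    then show "sat S e (cb_fm TN k h ps ns)" by (auto simp: p TLeq_def)
  qed
  also have "\<dots> \<longleftrightarrow> m \<le> n" by (auto simp: le_iff_add)
  finally show ?case by (simp add: p mn)
next
  case (Fn \<rho> \<sigma>)
  have ps: "list_all2 has_type ps (imp_pos (cb_pos \<rho>) (cb_neg \<rho>) (cb_pos \<sigma>) (cb_neg \<sigma>))"
    and ns: "list_all2 has_type ns (cb_pos \<rho> @ cb_neg \<sigma>)"
    using Fn.prems by simp_all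
  note t = imp_typed[OF ps ns]
  \<comment> \<open>The argument of the function occupies index \<open>k\<close>, hence the block of
    challenges starts at \<open>Suc k\<close>, and \<open>sat_imp\<close> is used with this
    bound.\<close>
  let ?x = "(k, \<rho>)" and ?bs = "new_vars (Suc k) (cb_neg \<rho>)"
  let ?k = "Suc k + length ?bs"
  let ?as = "take (length (cb_pos \<rho>)) ns" and ?ds = "drop (length (cb_pos \<rho>)) ns"
  let ?fs = "map (\<lambda>f. Apps f ?as) (take (length (cb_pos \<sigma>)) ps)"
  have fr: "fst v < k" if "t \<in> set (h # ps @ ns)" "v \<in> set (fv_tm t)" for t v
    using Fn.prems(5) that by blast
  have "sat S (e(?x := u)) (TImp (TBall ?bs (map (\<lambda>g. Apps g (?as @ ?ds)) (drop (length (cb_pos \<sigma>)) ps))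
        (cb_fm \<rho> ?k (Var ?x) ?as (map Var ?bs)))
        (cb_fm \<sigma> ?k (App h (Var ?x)) ?fs ?ds))
     \<longleftrightarrow> imps (length (cb_pos \<rho>)) (length (cb_pos \<sigma>)) (cbs \<rho> u) (cbs \<sigma> (tm_val S e h \<cdot> u))
        (map (tm_val S e) ps) (map (tm_val S e) ns)" if u: "u \<in> obj S \<rho>" for u
  proof -
    let ?e = "e(?x := u)"
    have e: "valuation S ?e" using Fn.prems(1) u by (auto intro!: valuation_upd)
    have fx: "?x \<notin> set (fv_tm t)" if "t \<in> set (h # ps @ ns)" for t using fr[OF that] by force
    have v: "map (tm_val S ?e) ps = map (tm_val S e) ps" "map (tm_val S ?e) ns = map (tm_val S e) ns"
      "tm_val S ?e h = tm_val S e h"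
      using fx by simp_all
    show ?thesis unfolding v(1,2)[symmetric]
    proof (rule sat_imp[OF e ps ns])
      show "\<forall>t\<in>set (ps @ ns). \<forall>v\<in>set (fv_tm t). fst v < Suc k" using fr by fastforce
    next
      fix us assume us: "objs (cb_neg \<rho>) us"
      let ?e' = "upds ?e ?bs us"
      have e': "valuation S ?e'" using us by (intro valuation_upds e) simp
      have *: "tm_val S ?e' t = tm_val S ?e t" if "\<forall>v\<in>set (fv_tm t). fst v < Suc k" for t
        using that by (intro tm_val_upds) (fastforce dest: new_vars_index)
      have as: "map (tm_val S ?e') ?as = map (tm_val S ?e) ?as"
        using fr by (auto intro!: * dest!: in_set_takeD)
          (meson fr in_set_takeD less_SucI list.set_intros(2) UnCI set_append)+
      have bs: "map (tm_val S ?e') (map Var ?bs) = us"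
        using upds_map[of ?bs us ?e] objs_length[OF us] by (simp add: o_def)
      have "sat S ?e' (cb_fm \<rho> ?k (Var ?x) ?as (map Var ?bs)) \<longleftrightarrow>
         cbs \<rho> (tm_val S ?e' (Var ?x)) (map (tm_val S ?e') ?as) (map (tm_val S ?e') (map Var ?bs))"
      proof (rule Fn.IH(1)[OF e' _ t(1) new_vars_typed])
        show "\<forall>t\<in>set (Var ?x # ?as @ map Var ?bs). \<forall>v\<in>set (fv_tm t). fst v < ?k"
          using fr by (fastforce dest: in_set_takeD new_vars_index)
      qed (rule has_type.intros)
      also have "tm_val S ?e' (Var ?x) = u" using *[of "Var ?x"] by simp
      finally show "sat S ?e' (cb_fm \<rho> ?k (Var ?x) ?as (map Var ?bs)) \<longleftrightarrow>
         cbs \<rho> u (map (tm_val S ?e) ?as) us" unfolding as bs .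
    next
      have "sat S ?e (cb_fm \<sigma> ?k (App h (Var ?x)) ?fs ?ds) \<longleftrightarrow>
         cbs \<sigma> (tm_val S ?e (App h (Var ?x))) (map (tm_val S ?e) ?fs) (map (tm_val S ?e) ?ds)"
      proof (rule Fn.IH(2)[OF e _ t(3) t(2)])
        show "has_type (App h (Var ?x)) \<sigma>" using Fn.prems(2) by (auto intro: has_type.intros)
        show "\<forall>t\<in>set (App h (Var ?x) # ?fs @ ?ds). \<forall>v\<in>set (fv_tm t). fst v < ?k"
          using fr by (fastforce dest: in_set_takeD in_set_dropD)
      qed
      then show "sat S ?e (cb_fm \<sigma> ?k (App h (Var ?x)) ?fs ?ds) \<longleftrightarrow>
         cbs \<sigma> (tm_val S e h \<cdot> u) (map (tm_val S ?e) ?fs) (map (tm_val S ?e) ?ds)"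
        using v(3) by simp
    qed
  qed
  then show ?case unfolding cb_fm.simps Let_def sat.simps(6) cbs.simps snd_conv
    by (intro ball_cong refl)
qed auto

text \<open>Two bounds separate three groups of variables: those of \<open>A\<close> lie below
  \<open>b\<close>, those of the witness terms between \<open>b\<close> and \<open>k\<close>, and
  new ones from \<open>k\<close> on. The quantifiers of \<open>A\<close> are kept without renaming;
  the gap at \<open>b\<close> prevents them from capturing variables of witness terms. In the
  recursion \<open>b\<close> is fixed while \<open>k\<close> grows.\<close>

lemma sat_interp:
  "valuation S e \<Longrightarrow> fm_ok A \<Longrightarrow> bound_fm A \<le> b \<Longrightarrow> b \<le> k \<Longrightarrow>
   list_all2 has_type ps (posc A) \<Longrightarrow> list_all2 has_type ns (negc A) \<Longrightarrow>
   \<forall>t\<in>set (ps @ ns). \<forall>v\<in>set (fv_tm t). b \<le> fst v \<and> fst v < k \<Longrightarrow>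
   sat S e (interp I_cb k A ps ns) \<longleftrightarrow> sem A e (map (tm_val S e) ps) (map (tm_val S e) ns)"
proof (induction A arbitrary: e k ps ns)
  case (IAt \<sigma> t)
  have "fst v < k" if "v \<in> set (fv_tm t)" for v
    using bound_tm[OF that] IAt.prems(3,4) by simp
  then show ?case unfolding interp_IAt sem.simps
    by (intro sat_cb_fm) (use IAt.prems in auto)
next
  case (And A B)
  have "list_all2 has_type ps (posc A @ posc B)" "list_all2 has_type ns (negc A @ negc B)"
    using And.prems by simp_all
  then have *: "list_all2 has_type (take (length (posc A)) ps) (posc A)"
    "list_all2 has_type (drop (length (posc A)) ps) (posc B)"
    "list_all2 has_type (take (length (negc A)) ns) (negc A)"
    "list_all2 has_type (drop (length (negc A)) ns) (negc B)"
    by (metis append_eq_conv_conj list_all2_append2 list_all2_lengthD)+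
  have "sat S e (interp I_cb k A (take (length (posc A)) ps) (take (length (negc A)) ns)) \<longleftrightarrow>
      sem A e (map (tm_val S e) (take (length (posc A)) ps)) (map (tm_val S e) (take (length (negc A)) ns))"
    by (rule And.IH(1)) (use And.prems * in \<open>auto dest: in_set_takeD\<close>)
  moreover have "sat S e (interp I_cb k B (drop (length (posc A)) ps) (drop (length (negc A)) ns)) \<longleftrightarrow>
      sem B e (map (tm_val S e) (drop (length (posc A)) ps)) (map (tm_val S e) (drop (length (negc A)) ns))"
    by (rule And.IH(2)) (use And.prems * in \<open>auto dest: in_set_dropD\<close>)
  ultimately show ?case by (simp add: take_map drop_map)
next
  case (Imp A B)
  have ps: "list_all2 has_type ps (imp_pos (posc A) (negc A) (posc B) (negc B))"
    and ns: "list_all2 has_type ns (posc A @ negc B)"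
    using Imp.prems by simp_all
  note t = imp_typed[OF ps ns]
  let ?bs = "new_vars k (negc A)"
  let ?k = "k + length ?bs"
  let ?as = "take (length (posc A)) ns" and ?ds = "drop (length (posc A)) ns"
  let ?fs = "map (\<lambda>f. Apps f ?as) (take (length (posc B)) ps)"
  have fr: "b \<le> fst v \<and> fst v < k" if "t \<in> set (ps @ ns)" "v \<in> set (fv_tm t)" for t v
    using Imp.prems(7) that by blast
  note e = Imp.prems(1)
  have "sat S e (TImp (TBall ?bs (map (\<lambda>g. Apps g (?as @ ?ds)) (drop (length (posc B)) ps))
        (interp I_cb ?k A ?as (map Var ?bs))) (interp I_cb k B ?fs ?ds))
     \<longleftrightarrow> imps (length (posc A)) (length (posc B)) (sem A e) (sem B e)
        (map (tm_val S e) ps) (map (tm_val S e) ns)"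
  proof (rule sat_imp[OF e ps ns])
    show "\<forall>t\<in>set (ps @ ns). \<forall>v\<in>set (fv_tm t). fst v < k" using fr by blast
  next
    fix us assume us: "objs (negc A) us"
    let ?e' = "upds e ?bs us"
    have e': "valuation S ?e'" using us by (intro valuation_upds e) simp
    have *: "tm_val S ?e' t = tm_val S e t" if "\<forall>v\<in>set (fv_tm t). fst v < k" for t
      using that by (intro tm_val_upds) (fastforce dest: new_vars_index)
    have as: "map (tm_val S ?e') ?as = map (tm_val S e) ?as"
    proof (rule map_cong[OF refl])
      fix t assume "t \<in> set ?as"
      then have "t \<in> set (ps @ ns)" by (auto dest: in_set_takeD)
      with fr show "tm_val S ?e' t = tm_val S e t" by (intro *) blast
    qed
    have bs: "map (tm_val S ?e') (map Var ?bs) = us"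
      using upds_map[of ?bs us e] objs_length[OF us] by (simp add: o_def)
    have "sem A ?e' = sem A e"
    proof (rule sem_cong)
      fix v assume "v \<in> set (fv A)"
      then have "fst v < k" using bound_fm[of v A] Imp.prems(3,4) by simp
      then have "v \<notin> set ?bs" using new_vars_index[of v] by fastforce
      then show "?e' v = e v" by (rule upds_other)
    qed
    moreover have "sat S ?e' (interp I_cb ?k A ?as (map Var ?bs)) \<longleftrightarrow>
       sem A ?e' (map (tm_val S ?e') ?as) (map (tm_val S ?e') (map Var ?bs))"
    proof (rule Imp.IH(1)[OF e' _ _ _ t(1) new_vars_typed])
      show "\<forall>t\<in>set (?as @ map Var ?bs). \<forall>v\<in>set (fv_tm t). b \<le> fst v \<and> fst v < ?k"
        using fr Imp.prems(4) by (fastforce dest: in_set_takeD new_vars_index)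
    qed (use Imp.prems in auto)
    ultimately show "sat S ?e' (interp I_cb ?k A ?as (map Var ?bs)) \<longleftrightarrow>
       sem A e (map (tm_val S e) ?as) us" unfolding as bs by simp
  next
    show "sat S e (interp I_cb k B ?fs ?ds) \<longleftrightarrow>
       sem B e (map (tm_val S e) ?fs) (map (tm_val S e) ?ds)"
    proof (rule Imp.IH(2)[OF e _ _ _ t(3) t(2)])
      show "\<forall>t\<in>set (?fs @ ?ds). \<forall>v\<in>set (fv_tm t). b \<le> fst v \<and> fst v < k"
        using fr by (fastforce dest: in_set_takeD in_set_dropD)
    qed (use Imp.prems in auto)
  qed
  then show ?case unfolding interp.simps Let_def sem.simps .
next
  case (All v A)
  have "sat S (e(v := u)) (interp I_cb k A ps ns) \<longleftrightarrow> sem A (e(v := u)) (map (tm_val S e) ps) (map (tm_val S e) ns)"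
    if u: "u \<in> obj S (snd v)" for u
  proof -
    have "v \<notin> set (fv_tm t)" if "t \<in> set (ps @ ns)" for t
      using All.prems(3,7) that by fastforce
    then have vals: "map (tm_val S (e(v := u))) ps = map (tm_val S e) ps"
      "map (tm_val S (e(v := u))) ns = map (tm_val S e) ns" by simp_all
    have "sat S (e(v := u)) (interp I_cb k A ps ns) \<longleftrightarrow>
      sem A (e(v := u)) (map (tm_val S (e(v := u))) ps) (map (tm_val S (e(v := u))) ns)"
      using All.prems u by (intro All.IH valuation_upd) auto
    then show ?thesis unfolding vals .
  qed
  then show ?case by simp
next
  case (Ex v A)
  let ?bs = "new_vars k (negc A)"
  let ?k = "k + length ?bs"
  have ns: "list_all2 has_type ns (map Star (negc A))" using Ex.prems(6) by simp
  have fr: "b \<le> fst w \<and> fst w < k" if "t \<in> set (ps @ ns)" "w \<in> set (fv_tm t)" for t w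
    using Ex.prems(7) that by blast
  have "sat S (e(v := u)) (TBall ?bs ns (interp I_cb ?k A ps (map Var ?bs))) \<longleftrightarrow>
     (\<forall>us. box us (map (tm_val S e) ns) \<longrightarrow> sem A (e(v := u)) (map (tm_val S e) ps) us)"
    if u: "u \<in> obj S (snd v)" for u
  proof -
    let ?e = "e(v := u)"
    have e: "valuation S ?e" using Ex.prems(1) u by (rule valuation_upd)
    have v: "v \<notin> set (fv_tm t)" if "t \<in> set (ps @ ns)" for t
      using Ex.prems(3) fr[OF that] by fastforce
    then have vals: "map (tm_val S ?e) ps = map (tm_val S e) ps"
      "map (tm_val S ?e) ns = map (tm_val S e) ns" by simp_all
    have Bin: "objs (map Star (negc A)) (map (tm_val S ?e) ns)" by (rule tm_vals_in[OF e ns])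
    have "set (fv_tm B) \<inter> set ?bs = {}" if "B \<in> set ns" for B
      using fr[of B] that new_vars_index by fastforce
    then have "sat S ?e (TBall ?bs ns (interp I_cb ?k A ps (map Var ?bs))) \<longleftrightarrow>
      (\<forall>us. box us (map (tm_val S ?e) ns) \<longrightarrow> sat S (upds ?e ?bs us) (interp I_cb ?k A ps (map Var ?bs)))"
      using Bin by (intro sat_TBall) auto
    also have "\<dots> \<longleftrightarrow> (\<forall>us. box us (map (tm_val S ?e) ns) \<longrightarrow> sem A ?e (map (tm_val S ?e) ps) us)"
    proof (intro all_cong1 imp_cong refl)
      fix us assume "box us (map (tm_val S ?e) ns)"
      then have us: "objs (negc A) us" by (rule box_in[OF Bin])
      let ?e' = "upds ?e ?bs us"
      have e': "valuation S ?e'" using us by (intro valuation_upds e) simp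
      have as: "map (tm_val S ?e') ps = map (tm_val S ?e) ps"
      proof (rule map_cong[OF refl])
        fix t assume "t \<in> set ps"
        with fr[of t] show "tm_val S ?e' t = tm_val S ?e t"
          by (intro tm_val_upds) (fastforce dest: new_vars_index)
      qed
      have bs: "map (tm_val S ?e') (map Var ?bs) = us"
        using upds_map[of ?bs us ?e] objs_length[OF us] by (simp add: o_def)
      have "sem A ?e' = sem A ?e"
      proof (rule sem_cong)
        fix w assume "w \<in> set (fv A)"
        then have "fst w < k" using bound_fm[of w A] Ex.prems(3,4) by simp
        then have "w \<notin> set ?bs" using new_vars_index[of w] by fastforce
        then show "?e' w = ?e w" by (rule upds_other)
      qed
      moreover have "sat S ?e' (interp I_cb ?k A ps (map Var ?bs)) \<longleftrightarrow>
         sem A ?e' (map (tm_val S ?e') ps) (map (tm_val S ?e') (map Var ?bs))"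
      proof (rule Ex.IH[OF e' _ _ _ _ new_vars_typed])
        show "\<forall>t\<in>set (ps @ map Var ?bs). \<forall>v\<in>set (fv_tm t). b \<le> fst v \<and> fst v < ?k"
          using fr Ex.prems(4) by (fastforce dest: new_vars_index)
      qed (use Ex.prems in auto)
      ultimately show "sat S ?e' (interp I_cb ?k A ps (map Var ?bs)) \<longleftrightarrow> sem A ?e (map (tm_val S ?e) ps) us"
        unfolding as bs by simp
    qed
    finally show ?thesis unfolding vals .
  qed
  then show ?case by (simp add: Let_def)
qed auto

section \<open>From entailment back to closed terms and provability\<close>

lemma dfns_closed:
  assumes "dfns [] \<Delta> \<Phi>"
  shows "\<exists>ts. list_all2 has_type ts \<Delta> \<and> (\<forall>t\<in>set ts. fv_tm t = []) \<and> map cval ts = \<Phi> []"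
proof -
  have "\<forall>j<length \<Delta>. \<exists>t. has_type t (\<Delta> ! j) \<and> fv_tm t = [] \<and> cval t = \<Phi> [] ! j"
    using assms unfolding dfns_def dfn_def by simp
  then obtain t where t: "\<forall>j<length \<Delta>. has_type (t j) (\<Delta> ! j) \<and> fv_tm (t j) = [] \<and> cval (t j) = \<Phi> [] ! j"
    by metis
  moreover have "length (\<Phi> []) = length \<Delta>" using assms by (simp add: dfns_def)
  ultimately show ?thesis
    by (intro exI[of _ "map t [0..<length \<Delta>]"]) (auto simp: list_all2_conv_all_nth intro!: nth_equalityI)
qed

lemma sat_TAlls:
  "valuation S e \<Longrightarrow> (\<And>e. valuation S e \<Longrightarrow> sat S e \<phi>) \<Longrightarrow> sat S e (TAlls vs \<phi>)"
  by (induction vs arbitrary: e) (auto simp: valuation_upd)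

text \<open>\<open>Top\<close> is true and has no witnesses, so an entailment from it amounts to a
  definable tuple of no arguments that meets every challenge. Such a tuple consists of values of
  closed terms.\<close>

lemma U_interpretableI:
  assumes "fm_ok A" "Top \<tturnstile> A"
  shows "U_interpretable S I_cb A"
proof -
  obtain \<Phi> where \<Phi>: "dfns [] (posc A) \<Phi>"
    "\<And>e d. valuation S e \<Longrightarrow> objs (negc A) d \<Longrightarrow> sem A e (\<Phi> []) d"
    using assms(2) unfolding ent_def by (auto simp: imps_def)
  obtain ts where ts: "list_all2 has_type ts (posc A)" "\<forall>t\<in>set ts. fv_tm t = []" "map cval ts = \<Phi> []"
    using dfns_closed[OF \<Phi>(1)] by blast
  let ?bs = "new_vars (bound_fm A) (negc A)"
  let ?\<psi> = "TAlls ?bs (interp I_cb (bound_fm A + length ?bs) A ts (map Var ?bs))"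
  have sat: "sat S e (interp I_cb (bound_fm A + length ?bs) A ts (map Var ?bs))" if e: "valuation S e" for e
  proof (subst sat_interp[where b = "bound_fm A"])
    show "\<forall>t\<in>set (ts @ map Var ?bs). \<forall>v\<in>set (fv_tm t). bound_fm A \<le> fst v \<and> fst v < bound_fm A + length ?bs"
      using ts(2) by (auto dest: new_vars_index)
    have "map (tm_val S e) ts = \<Phi> []" using ts(2,3) by (metis (mono_tags, lifting) map_eq_conv tm_val_closed)
    moreover have "objs (negc A) (map (tm_val S e) (map Var ?bs))"
      by (rule tm_vals_in[OF e new_vars_typed])
    ultimately show "sem A e (map (tm_val S e) ts) (map (tm_val S e) (map Var ?bs))"
      using \<Phi>(2)[OF e] by simp
  qed (use e assms(1) ts new_vars_typed in auto)
  have "TAlls (fv_tfm ?\<psi>) ?\<psi> \<in> target_theory S"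
    unfolding target_theory_def
  proof (intro CollectI conjI allI impI)
    show "tfm_ok (TAlls (fv_tfm ?\<psi>) ?\<psi>)"
      using tfm_ok_interp[OF assms(1) ts(1) new_vars_typed] by (simp add: tfm_ok_TAlls)
    have "set (fv_tfm (TAlls (fv_tfm ?\<psi>) ?\<psi>)) = {}" unfolding fv_TAlls by blast
    then show "fv_tfm (TAlls (fv_tfm ?\<psi>) ?\<psi>) = []" by simp
    fix e assume "valuation S e"
    then show "sat S e (TAlls (fv_tfm ?\<psi>) ?\<psi>)" by (intro sat_TAlls sat)
  qed
  moreover have "witnessing_tm t" if t: "t \<in> set ts" for t
  proof -
    obtain j where j: "j < length ts" "t = ts ! j" using t by (auto simp: in_set_conv_nth)
    then have "has_type t (posc A ! j)" using ts(1) by (simp add: list_all2_nthD)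
    moreover have "posc A ! j \<in> set (posc A)" using j(1) list_all2_lengthD[OF ts(1)] by simp
    then have "wit_ty (posc A ! j)" using wit_pos_neg[of A] by (meson UnI1)
    ultimately show ?thesis unfolding witnessing_tm_def by (intro exI conjI)
  qed
  ultimately show ?thesis
    unfolding U_interpretable_def proves_def Let_def using ts by blast
qed

end

section \<open>Constants and axioms\<close>

abbreviation Ands :: "fm list \<Rightarrow> fm" where "Ands As \<equiv> foldr And As Top"

lemma has_type_Var: "has_type (Var v) (snd v)"
  by (metis has_type.intros(1) prod.collapse)

lemma has_type_Con: "cst_ok c \<Longrightarrow> cst_ty c = \<sigma> \<Longrightarrow> has_type (Con c) \<sigma>"
  using has_type.intros(2) by auto

lemma list_all2_Var: "list_all2 has_type (map Var vs) (map snd vs)"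
  by (simp add: list_all2_conv_all_nth has_type_Var)

lemma subst_tm_type: "has_type t \<sigma> \<Longrightarrow> has_type r (snd v) \<Longrightarrow> has_type (subst_tm v r t) \<sigma>"
  by (induction rule: has_type.induct) (auto intro: has_type.intros)

lemma fm_ok_subst: "fm_ok A \<Longrightarrow> has_type r (snd v) \<Longrightarrow> fm_ok (subst v r A)"
  by (induction A) (auto intro: subst_tm_type)

lemma ha_fm_ok: "ha_fm A \<Longrightarrow> fm_ok A"
  by (induction A) auto

lemma fm_ok_relativize: "fm_ok A \<Longrightarrow> fm_ok (relativize A)"
  by (induction A) (auto intro: has_type_Var)

text \<open>The atoms added by relativization speak only of the variable bound at the same place,
  which substitution for another variable leaves alone.\<close>

lemma relativize_subst: "relativize (subst v r A) = subst v r (relativize A)"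
  by (induction A) auto

lemma fv_relativize [simp]: "set (fv (relativize A)) = set (fv A)"
  by (induction A) auto

lemma free_for_relativize: "free_for v r A \<Longrightarrow> free_for v r (relativize A)"
  by (induction A) auto

text \<open>A quantifier that could capture a variable of \<open>r\<close> binds \<open>v\<close>
  itself, and in its scope no free \<open>v\<close> is left to be replaced.\<close>

lemma free_for_self: "set (fv_tm r) \<subseteq> {v} \<Longrightarrow> free_for v r A"
  by (induction A) auto

lemma fv_subst_tm: "v \<notin> set (fv_tm r) \<Longrightarrow> v \<notin> set (fv_tm (subst_tm v r t))"
  by (induction t) auto

lemma fv_subst: "v \<notin> set (fv_tm r) \<Longrightarrow> v \<notin> set (fv (subst v r A))"
  by (induction A) (auto simp: fv_subst_tm)

lemma subst_Ands: "subst v r (Ands As) = Ands (map (subst v r) As)"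
  by (induction As) auto

lemma fv_Ands: "set (fv (Ands As)) = (\<Union>A\<in>set As. set (fv A))"
  by (induction As) auto

lemma free_for_Ands: "\<forall>A\<in>set As. free_for v r A \<Longrightarrow> free_for v r (Ands As)"
  by (induction As) auto

context full begin

section \<open>Derived rules of entailment\<close>

lemma ent_weaken1: "A \<tturnstile> B \<Longrightarrow> And A C \<tturnstile> B"
  using ent_trans ent_conj1 by blast

lemma ent_weaken2: "A \<tturnstile> B \<Longrightarrow> And C A \<tturnstile> B"
  using ent_trans ent_conj2 by blast

lemma ent_TopI: "P \<tturnstile> Top"
  by (rule ent_top) (auto simp: imps_def)

lemma ent_Ands: "A \<in> set As \<Longrightarrow> Ands As \<tturnstile> A"
  by (induction As) (auto intro: ent_conj1 ent_weaken2)

lemma ent_AndsI: "(\<And>A. A \<in> set As \<Longrightarrow> P \<tturnstile> A) \<Longrightarrow> P \<tturnstile> Ands As"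
  by (induction As) (auto intro: ent_TopI ent_conjI)

lemma val_in: "has_type t \<sigma> \<Longrightarrow> valuation S e \<Longrightarrow> tm_val S e t \<in> obj S \<sigma>"
  by (rule tm_val_in) (auto simp: valuation_def)

text \<open>Realization of \<open>\<I>\<close> depends only on the value of the term. This is how
  defining equations of constants enter derivations.\<close>

lemma ent_IAt_cong:
  assumes "P \<tturnstile> IAt \<sigma> t" "\<And>e. valuation S e \<Longrightarrow> tm_val S e t = tm_val S e t'"
  shows "P \<tturnstile> IAt \<sigma> t'"
  by (rule ent_trans[OF assms(1)], rule ent_semI) (use assms(2) in auto)

section \<open>Abstraction, application and induction for the predicates \<open>\<I>\<close>\<close>

lemma sem_IAt_fun:
  assumes "snd v = \<rho>" "v \<notin> set (fv_tm h)"
  shows "sem (IAt (\<rho> \<Rrightarrow> \<sigma>) h) e = sem (All v (Imp (IAt \<rho> (Var v)) (IAt \<sigma> (App h (Var v))))) e"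
proof -
  have "sem (IAt \<rho> (Var v)) (e(v := u)) = cbs \<rho> u"
    "sem (IAt \<sigma> (App h (Var v))) (e(v := u)) = cbs \<sigma> (tm_val S e h \<cdot> u)" for u
    using assms(2) by (simp_all add: fun_eq_iff)
  then show ?thesis using assms(1)
    by (intro ext) (simp only: sem.simps cbs.simps pos_neg_IAt)
qed

lemma ent_IAt_funI:
  assumes "And P (IAt \<rho> (Var v)) \<tturnstile> IAt \<sigma> (App h (Var v))" "snd v = \<rho>"
    "v \<notin> set (fv_tm h)" "v \<notin> set (fv P)"
  shows "P \<tturnstile> IAt (\<rho> \<Rrightarrow> \<sigma>) h"
proof (rule ent_trans)
  show "P \<tturnstile> All v (Imp (IAt \<rho> (Var v)) (IAt \<sigma> (App h (Var v))))"
    by (intro ent_allI ent_impI assms)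
  show "All v (Imp (IAt \<rho> (Var v)) (IAt \<sigma> (App h (Var v)))) \<tturnstile> IAt (\<rho> \<Rrightarrow> \<sigma>) h"
    by (rule ent_semI) (simp_all only: sem_IAt_fun[OF assms(2,3)], simp_all)
qed

lemma ent_IAt_app:
  assumes h: "P \<tturnstile> IAt (\<rho> \<Rrightarrow> \<sigma>) h" and t: "P \<tturnstile> IAt \<rho> t" "has_type t \<rho>"
  shows "P \<tturnstile> IAt \<sigma> (App h t)"
proof -
  \<comment> \<open>\<open>bound_tm h\<close> exceeds every index occurring in \<open>h\<close>, so
    this variable is fresh for \<open>h\<close>.\<close>
  define v where "v = (bound_tm h, \<rho>)"
  have v: "snd v = \<rho>" "v \<notin> set (fv_tm h)" using bound_tm[of v h] by (auto simp: v_def)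
  have "IAt (\<rho> \<Rrightarrow> \<sigma>) h \<tturnstile> All v (Imp (IAt \<rho> (Var v)) (IAt \<sigma> (App h (Var v))))"
    by (rule ent_semI) (simp_all only: sem_IAt_fun[OF v], simp_all)
  moreover have "All v (Imp (IAt \<rho> (Var v)) (IAt \<sigma> (App h (Var v)))) \<tturnstile> Imp (IAt \<rho> t) (IAt \<sigma> (App h t))"
  proof (rule ent_allE)
    fix e assume e: "valuation S e"
    have "sem (IAt \<rho> (Var v)) (e(v := tm_val S e t)) = sem (IAt \<rho> t) e"
      "sem (IAt \<sigma> (App h (Var v))) (e(v := tm_val S e t)) = sem (IAt \<sigma> (App h t)) e"
      using v(2) by (simp_all add: fun_eq_iff)
    then have "sem (Imp (IAt \<rho> t) (IAt \<sigma> (App h t))) e =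
      sem (Imp (IAt \<rho> (Var v)) (IAt \<sigma> (App h (Var v)))) (e(v := tm_val S e t))"
      by (intro ext) (simp only: sem.simps pos_neg_IAt)
    then show "\<exists>u\<in>obj S (snd v). sem (Imp (IAt \<rho> t) (IAt \<sigma> (App h t))) e =
      sem (Imp (IAt \<rho> (Var v)) (IAt \<sigma> (App h (Var v)))) (e(v := u))"
      using val_in[OF t(2) e] v(1) by blast
  qed simp_all
  ultimately have "P \<tturnstile> Imp (IAt \<rho> t) (IAt \<sigma> (App h t))" using h ent_trans by blast
  then show ?thesis using t(1) by (rule ent_mp)
qed

lemma ent_IAt_Apps:
  "P \<tturnstile> IAt (Fns \<Delta> \<sigma>) h \<Longrightarrow> list_all2 (\<lambda>t \<delta>. has_type t \<delta> \<and> P \<tturnstile> IAt \<delta> t) ts \<Delta> \<Longrightarrow> P \<tturnstile> IAt \<sigma> (Apps h ts)"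
proof (induction \<Delta> arbitrary: h ts)
  case (Cons \<delta> \<Delta>)
  then obtain u us where u: "ts = u # us" "has_type u \<delta>" "P \<tturnstile> IAt \<delta> u"
    "list_all2 (\<lambda>t \<delta>. has_type t \<delta> \<and> P \<tturnstile> IAt \<delta> t) us \<Delta>"
    by (auto simp: list_all2_Cons2)
  have "P \<tturnstile> IAt (Fns \<Delta> \<sigma>) (App h u)"
    using Cons.prems(1) u(2,3) by (auto intro: ent_IAt_app)
  from Cons.IH[OF this u(4)] show ?case by (simp add: u(1))
qed auto

text \<open>One variable at a time is moved from the tuple into the premise \<open>P\<close>, where
  \<open>ent_IAt_funI\<close> discharges it.\<close>

lemma ent_IAt_lams:
  "And P (IAt_tuple vs) \<tturnstile> IAt \<sigma> (Apps h (map Var vs)) \<Longrightarrow> distinct vs \<Longrightarrow>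
   set vs \<inter> (set (fv P) \<union> set (fv_tm h)) = {} \<Longrightarrow> P \<tturnstile> IAt (Fns (map snd vs) \<sigma>) h"
proof (induction vs arbitrary: P h)
  case Nil
  have "P \<tturnstile> And P Top" by (intro ent_conjI ent_refl ent_TopI)
  with Nil show ?case using ent_trans by fastforce
next
  case (Cons v vs)
  let ?P = "And P (IAt (snd v) (Var v))"
  have "And ?P (IAt_tuple vs) \<tturnstile> And P (IAt_tuple (v # vs))"
    by (auto intro!: ent_conjI intro: ent_weaken1 ent_weaken2 ent_refl)
  then have "And ?P (IAt_tuple vs) \<tturnstile> IAt \<sigma> (Apps (App h (Var v)) (map Var vs))"
    using ent_trans Cons.prems(1) by simp
  then have "?P \<tturnstile> IAt (Fns (map snd vs) \<sigma>) (App h (Var v))"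
    by (rule Cons.IH) (use Cons.prems in auto)
  then show ?case using Cons.prems by (auto intro: ent_IAt_funI)
qed

lemma ent_IAt_const:
  assumes "IAt_tuple vs \<tturnstile> IAt \<sigma> (Apps (Con c) (map Var vs))" "distinct vs"
  shows "Top \<tturnstile> IAt (Fns (map snd vs) \<sigma>) (Con c)"
  by (rule ent_IAt_lams) (use assms in \<open>auto intro: ent_weaken2\<close>)

lemma ent_IAt_tuple: "v \<in> set vs \<Longrightarrow> snd v = \<sigma> \<Longrightarrow> IAt_tuple vs \<tturnstile> IAt \<sigma> (Var v)"
  by (rule ent_Ands) auto

text \<open>Uniform induction is applied to \<open>P \<rightarrow> D\<close>. Since \<open>v\<close>
  is not free in \<open>P\<close>, substituting zero or a successor changes only
  \<open>D\<close>.\<close>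

lemma ent_induction_rule:
  assumes v: "snd v = TN" "v \<notin> set (fv P)"
    and ff: "free_for v (Con cZero) D" "free_for v (App (Con cSuc) (Var v)) D"
    and 0: "P \<tturnstile> subst v (Con cZero) D"
    and S: "And (And P (IAt TN (Var v))) D \<tturnstile> subst v (App (Con cSuc) (Var v)) D"
  shows "And P (IAt TN (Var v)) \<tturnstile> D"
proof -
  let ?X = "Imp P D" and ?s = "App (Con cSuc) (Var v)" and ?I = "IAt TN (Var v)"
  have ffX: "free_for v (Con cZero) ?X" "free_for v ?s ?X"
    using ff free_for_self[of _ v P] by auto
  have "?I \<tturnstile> ?X"
  proof (rule ent_induction_uniform[OF v(1)])
    show "Top \<tturnstile> subst v (Con cZero) ?X"
      using v(2) 0 by (simp add: subst_fresh) (intro ent_impI ent_weaken2)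
    \<comment> \<open>The step is proved under \<open>P\<close>, which is thus at hand twice: to
      detach \<open>D\<close> from the induction hypothesis and to serve as premise of
      \<open>S\<close>.\<close>
    have "And (And ?I ?X) P \<tturnstile> D"
      by (rule ent_mp[of _ P]) (intro ent_weaken1 ent_weaken2 ent_refl ent_conj2 ent_conj1)+
    then have "And (And ?I ?X) P \<tturnstile> And (And P ?I) D"
      by (intro ent_conjI) (auto intro: ent_weaken1 ent_weaken2 ent_refl)
    then show "And ?I ?X \<tturnstile> subst v ?s ?X"
      using v(2) ent_trans[OF _ S] by (simp add: subst_fresh) (intro ent_impI)
    show "pos_neg I_cb (subst v (Con cZero) ?X) = pos_neg I_cb ?X"
      "pos_neg I_cb (subst v ?s ?X) = pos_neg I_cb ?X" by (rule pos_neg_subst)+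
    fix e assume e: "valuation S e"
    then have "e v \<in> obj S TN" using v(1) unfolding valuation_def by metis
    then show "sem (subst v ?s ?X) e = sem ?X (e(v := num S (Suc (nat_of S (e v)))))"
      unfolding sem_subst[OF ffX(2)] by (simp only: tm_val.simps Suc_ap)
    show "sem (subst v (Con cZero) ?X) e = sem ?X (e(v := num S 0))"
      unfolding sem_subst[OF ffX(1)] by (simp only: tm_val.simps cst_val.simps)
  qed
  then have "And ?I P \<tturnstile> D" by (rule ent_impE)
  moreover have "And P ?I \<tturnstile> And ?I P" by (intro ent_conjI ent_conj1 ent_conj2)
  ultimately show ?thesis using ent_trans by blast
qed

section \<open>Realizers for the constants\<close>

lemma ent_cZero: "Top \<tturnstile> IAt TN (Con cZero)"
proof -
  have "dfns [] [TN] (\<lambda>_. [num S 0])" using dfns_single[OF dfn_Con[of cZero]] by simp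
  then show ?thesis unfolding ent_def
    by - (rule exI[of _ "\<lambda>_. [num S 0]"], rule exI[of _ "\<lambda>_. []"], simp)
qed

text \<open>The successor is monotone, so it turns a bound for \<open>x\<close> into a bound for its
  successor.\<close>

lemma ent_cSuc: "Top \<tturnstile> IAt (TN \<Rrightarrow> TN) (Con cSuc)"
proof -
  let ?v = "(0, TN)"
  have "dfns [TN] [TN] (\<lambda>xs. [cst_val S cSuc \<cdot> xs ! 0])"
    using dfn_app[OF dfn_Con'[of cSuc] dfn_nth[of 0 "[TN]"]] by (intro dfns_single) simp
  then have "IAt TN (Var ?v) \<tturnstile> IAt TN (App (Con cSuc) (Var ?v))" unfolding ent_def
    by - (rule exI[of _ "\<lambda>xs. [cst_val S cSuc \<cdot> xs ! 0]"], rule exI[of _ "\<lambda>_. []"],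
      auto simp: valuation_def Suc_ap elim!: objs1E)
  then show ?thesis by (intro ent_IAt_funI[of _ _ ?v] ent_weaken2) auto
qed

lemma ent_cPi: "Top \<tturnstile> IAt (\<rho> \<Rrightarrow> \<sigma> \<Rrightarrow> \<rho>) (Con (cPi \<rho> \<sigma>))"
proof -
  let ?vs = "[(0, \<rho>), (1, \<sigma>)]"
  have "IAt_tuple ?vs \<tturnstile> IAt \<rho> (Apps (Con (cPi \<rho> \<sigma>)) (map Var ?vs))"
    by (rule ent_IAt_cong[OF ent_IAt_tuple[of "(0, \<rho>)"]]) (auto simp: valuation_def Pi_ap)
  from ent_IAt_const[OF this] show ?thesis by simp
qed

lemma ent_cSigma: "Top \<tturnstile> IAt (cst_ty (cSigma \<rho> \<sigma> \<tau>)) (Con (cSigma \<rho> \<sigma> \<tau>))"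
proof -
  let ?x = "(0, \<rho> \<Rrightarrow> \<sigma> \<Rrightarrow> \<tau>)" and ?y = "(1, \<rho> \<Rrightarrow> \<sigma>)" and ?z = "(2, \<rho>)"
  let ?vs = "[?x, ?y, ?z]"
  have v: "IAt_tuple ?vs \<tturnstile> IAt (snd v) (Var v)" if "v \<in> set ?vs" for v
    using that by (rule ent_IAt_tuple) simp
  have z: "has_type (Var ?z) \<rho>" by (rule has_type.intros)
  have "IAt_tuple ?vs \<tturnstile> IAt (\<sigma> \<Rrightarrow> \<tau>) (App (Var ?x) (Var ?z))"
    using v[of ?x] v[of ?z] z by (intro ent_IAt_app[of _ \<rho>]) simp_all
  moreover have "IAt_tuple ?vs \<tturnstile> IAt \<sigma> (App (Var ?y) (Var ?z))"
    using v[of ?y] v[of ?z] z by (intro ent_IAt_app[of _ \<rho>]) simp_all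
  moreover have "has_type (App (Var ?y) (Var ?z)) \<sigma>" by (rule has_type.intros(3)[OF has_type.intros(1) z])
  ultimately have "IAt_tuple ?vs \<tturnstile> IAt \<tau> (App (App (Var ?x) (Var ?z)) (App (Var ?y) (Var ?z)))"
    by (rule ent_IAt_app)
  then have "IAt_tuple ?vs \<tturnstile> IAt \<tau> (Apps (Con (cSigma \<rho> \<sigma> \<tau>)) (map Var ?vs))"
    by (rule ent_IAt_cong) (simp add: valuation_def Sigma_ap)
  from ent_IAt_const[OF this] show ?thesis by simp
qed

lemma ent_cCond: "Top \<tturnstile> IAt (cst_ty (cCond \<sigma>)) (Con (cCond \<sigma>))"
proof -
  let ?i = "(0, TB)" and ?x = "(1, \<sigma>)" and ?y = "(2, \<sigma>)"
  let ?vs = "[?i, ?x, ?y]"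
  have "IAt_tuple ?vs \<tturnstile> IAt \<sigma> (Apps (Con (cCond \<sigma>)) (map Var ?vs))"
  proof (rule ent_join)
    show "IAt_tuple ?vs \<tturnstile> IAt \<sigma> (Var ?x)" "IAt_tuple ?vs \<tturnstile> IAt \<sigma> (Var ?y)"
      by (auto intro!: ent_IAt_tuple simp del: foldr.simps list.map)
    fix e assume "valuation S e"
    then have "e ?i \<in> obj S TB" "e ?x \<in> obj S \<sigma>" "e ?y \<in> obj S \<sigma>" by (auto simp: valuation_def)
    \<comment> \<open>The conditional takes the value of one of its branches, so the join of the
      witnesses for both branches realizes it.\<close>
    then have "tm_val S e (Apps (Con (cCond \<sigma>)) (map Var ?vs)) \<in> {e ?x, e ?y}"
      by (auto elim!: bl_cases simp: Cond_ap)
    then show "sem (IAt \<sigma> (Apps (Con (cCond \<sigma>)) (map Var ?vs))) e = sem (IAt \<sigma> (Var ?x)) e \<or>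
      sem (IAt \<sigma> (Apps (Con (cCond \<sigma>)) (map Var ?vs))) e = sem (IAt \<sigma> (Var ?y)) e"
      by (auto simp only: fun_eq_iff sem.simps tm_val.simps insert_iff empty_iff)
  qed auto
  from ent_IAt_const[OF this] show ?thesis by simp
qed

text \<open>The recursor with variables for initial values and steps; the recursion argument
  \<open>n\<close> remains a term, so that zero, a variable and its successor can be
  compared.\<close>

definition rec_tm :: "ty list \<Rightarrow> var list \<Rightarrow> var list \<Rightarrow> tm \<Rightarrow> nat \<Rightarrow> tm" where
  "rec_tm \<sigma>s ws fs n j = Apps (Con (cRec \<sigma>s j)) (n # map Var ws @ map Var fs)"

lemma rec_tm_type:
  "map snd ws = \<sigma>s \<Longrightarrow> map snd fs = step_tys \<sigma>s \<Longrightarrow> has_type n TN \<Longrightarrow> j < length \<sigma>s \<Longrightarrow>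
   has_type (rec_tm \<sigma>s ws fs n j) (\<sigma>s ! j)"
  unfolding rec_tm_def
  using list_all2_Var[of ws] list_all2_Var[of fs]
  by (intro has_type_Apps[of _ "TN # \<sigma>s @ step_tys \<sigma>s"] has_type_Con)
    (auto intro: list_all2_appendI)

lemma valuation_map: "valuation S e \<Longrightarrow> objs (map snd vs) (map e vs)"
  by (simp add: objs_conv_nth valuation_def del: split_paired_All)

lemma rec_tm_val:
  assumes "map snd ws = \<sigma>s" "map snd fs = step_tys \<sigma>s" "j < length \<sigma>s" "valuation S e"
    "tm_val S e n \<in> obj S TN"
  shows "tm_val S e (rec_tm \<sigma>s ws fs n j) = rec_val S (nat_of S (tm_val S e n)) (map e ws) (map e fs) ! j"
  using Rec_apps[of "tm_val S e n" \<sigma>s "map e ws" "map e fs" j] assms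
    valuation_map[OF assms(4), of ws] valuation_map[OF assms(4), of fs]
  by (simp add: rec_tm_def o_def)

lemma rec_tm_Suc_val:
  assumes "map snd ws = \<sigma>s" "map snd fs = step_tys \<sigma>s" "j < length \<sigma>s" "valuation S e"
    "tm_val S e n \<in> obj S TN"
  shows "tm_val S e (rec_tm \<sigma>s ws fs (App (Con cSuc) n) j) =
    tm_val S e (Apps (Var (fs ! j)) (n # map (rec_tm \<sigma>s ws fs n) [0..<length \<sigma>s]))"
proof -
  obtain m where m: "tm_val S e n = num S m" using assms(5) by (elim num_cases)
  have sn: "tm_val S e (App (Con cSuc) n) = num S (Suc m)" by (simp add: m Suc_ap)
  have lf: "length fs = length \<sigma>s" using assms(2) by (metis length_map step_tys_def)
  have r: "objs \<sigma>s (rec_val S m (map e ws) (map e fs))"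
    using rec_val_in valuation_map[OF assms(4), of ws] valuation_map[OF assms(4), of fs] assms(1,2) by simp
  have "map (tm_val S e) (map (rec_tm \<sigma>s ws fs n) [0..<length \<sigma>s]) = rec_val S m (map e ws) (map e fs)"
    using rec_tm_val[OF assms(1,2) _ assms(4,5)] objs_length[OF r]
    by (intro nth_equalityI) (auto simp: m)
  then show ?thesis
    using rec_tm_val[OF assms(1-4), of "App (Con cSuc) n"] assms(3) lf
    unfolding sn by (simp add: m)
qed

text \<open>Induction on the recursion argument. The hypotheses on initial values and steps form the
  side formula, and the rules for application, together with the recursion equations, give base and
  step.\<close>

lemma ent_cRec:
  assumes i: "i < length \<sigma>s"
  shows "Top \<tturnstile> IAt (cst_ty (cRec \<sigma>s i)) (Con (cRec \<sigma>s i))"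
proof -
  let ?n = "(0 :: nat, TN)"
  \<comment> \<open>Index 0 is taken by the recursion argument; the two blocks of variables follow
    it without overlap.\<close>
  define ws where "ws = new_vars 1 \<sigma>s"
  define fs where "fs = new_vars (1 + length \<sigma>s) (step_tys \<sigma>s)"
  have ws: "map snd ws = \<sigma>s" and fs: "map snd fs = step_tys \<sigma>s" by (simp_all add: ws_def fs_def)
  have len: "length ws = length \<sigma>s" "length fs = length \<sigma>s"
    by (simp_all add: ws_def fs_def step_tys_def)
  have "distinct (?n # ws @ fs)"
    by (auto simp: ws_def fs_def dest!: new_vars_index)
  let ?P = "IAt_tuple (ws @ fs)" and ?I = "IAt TN (Var ?n)"
  let ?R = "\<lambda>j. IAt (\<sigma>s ! j) (rec_tm \<sigma>s ws fs (Var ?n) j)"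
  \<comment> \<open>All components are treated in one conjunction, because a recursion step for one
    of them uses the previous values of all.\<close>
  let ?D = "Ands (map ?R [0..<length \<sigma>s])"
  have "?n \<notin> set (fv ?P)"
    using \<open>distinct (?n # ws @ fs)\<close> unfolding fv_Ands by auto
  have nv: "?n \<notin> set ws" "?n \<notin> set fs" using \<open>distinct (?n # ws @ fs)\<close> by auto
  have mw: "map (e(?n := u)) ws = map e ws" "map (e(?n := u)) fs = map e fs" for e :: "var \<Rightarrow> 'u" and u
    using nv by auto
  have w: "?P \<tturnstile> IAt (\<sigma>s ! j) (Var (ws ! j))" if "j < length \<sigma>s" for j
  proof (intro ent_IAt_tuple)
    show "snd (ws ! j) = \<sigma>s ! j" using that len ws by (metis nth_map)
  qed (use that len in auto)
  have f: "?P \<tturnstile> IAt (TN \<Rrightarrow> Fns \<sigma>s (\<sigma>s ! j)) (Var (fs ! j))" if "j < length \<sigma>s" for j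
  proof (intro ent_IAt_tuple)
    have "snd (fs ! j) = step_tys \<sigma>s ! j" using that len fs by (metis nth_map)
    then show "snd (fs ! j) = TN \<Rrightarrow> Fns \<sigma>s (\<sigma>s ! j)" using that by (simp add: step_tys_def)
  qed (use that len in auto)
  have "And ?P ?I \<tturnstile> ?D"
  proof (rule ent_induction_rule)
    show "?P \<tturnstile> subst ?n (Con cZero) ?D"
      unfolding subst_Ands
    proof (rule ent_AndsI)
      fix A assume "A \<in> set (map (subst ?n (Con cZero)) (map ?R [0..<length \<sigma>s]))"
      then obtain j where j: "j < length \<sigma>s" "A = subst ?n (Con cZero) (?R j)" by auto
      show "?P \<tturnstile> A" unfolding j(2) subst.simps
      proof (rule ent_IAt_cong[OF w[OF j(1)]])
        fix e assume e: "valuation S e"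
        then have "valuation S (e(?n := num S 0))" by (auto intro!: valuation_upd)
        from rec_tm_val[OF ws fs j(1) this, of "Var ?n"]
        show "tm_val S e (Var (ws ! j)) = tm_val S e (subst_tm ?n (Con cZero) (rec_tm \<sigma>s ws fs (Var ?n) j))"
          unfolding tm_val_subst mw using j(1) len by simp
      qed
    qed
  next
    let ?s = "App (Con cSuc) (Var ?n)" and ?G = "And (And ?P ?I) ?D"
    show "?G \<tturnstile> subst ?n ?s ?D"
      unfolding subst_Ands
    proof (rule ent_AndsI)
      fix A assume "A \<in> set (map (subst ?n ?s) (map ?R [0..<length \<sigma>s]))"
      then obtain j where j: "j < length \<sigma>s" "A = subst ?n ?s (?R j)" by auto
      let ?t = "Apps (Var (fs ! j)) (Var ?n # map (rec_tm \<sigma>s ws fs (Var ?n)) [0..<length \<sigma>s])"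
      show "?G \<tturnstile> A" unfolding j(2) subst.simps
      proof (rule ent_IAt_cong)
        have "?G \<tturnstile> IAt (Fns (TN # \<sigma>s) (\<sigma>s ! j)) (Var (fs ! j))"
          using f[OF j(1)] by (auto intro: ent_weaken1)
        moreover have "?G \<tturnstile> ?I" by (intro ent_weaken1 ent_conj2)
        moreover have "?G \<tturnstile> ?R k" if "k < length \<sigma>s" for k
          using that by (intro ent_weaken2 ent_Ands) auto
        ultimately have "list_all2 (\<lambda>t \<delta>. has_type t \<delta> \<and> ?G \<tturnstile> IAt \<delta> t)
            (map (rec_tm \<sigma>s ws fs (Var ?n)) [0..<length \<sigma>s]) \<sigma>s"
          using rec_tm_type[OF ws fs, of "Var ?n"] has_type.intros(1)
          by (simp add: list_all2_conv_all_nth)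
        with \<open>?G \<tturnstile> IAt (Fns (TN # \<sigma>s) (\<sigma>s ! j)) (Var (fs ! j))\<close> \<open>?G \<tturnstile> ?I\<close>
        show "?G \<tturnstile> IAt (\<sigma>s ! j) ?t"
          by (intro ent_IAt_Apps[of _ "TN # \<sigma>s"]) (simp_all add: has_type.intros)
        fix e assume e: "valuation S e"
        then have n: "e ?n \<in> obj S TN" by (auto simp: valuation_def)
        let ?e = "e(?n := tm_val S e ?s)"
        have s: "tm_val S e ?s = num S (Suc (nat_of S (e ?n)))" using n by (simp add: Suc_ap)
        have e': "valuation S ?e" using e unfolding s by (auto intro!: valuation_upd)
        have "tm_val S ?e (rec_tm \<sigma>s ws fs (Var ?n) j) = tm_val S e (rec_tm \<sigma>s ws fs ?s j)"
          using rec_tm_val[OF ws fs j(1) e', of "Var ?n"] rec_tm_val[OF ws fs j(1) e, of ?s]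
          unfolding mw s by (simp add: s)
        then show "tm_val S e ?t = tm_val S e (subst_tm ?n ?s (rec_tm \<sigma>s ws fs (Var ?n) j))"
          unfolding tm_val_subst
          using rec_tm_Suc_val[OF ws fs j(1) e, of "Var ?n"] n by simp
      qed
    qed
  qed (use \<open>?n \<notin> set (fv ?P)\<close> in \<open>auto intro!: free_for_Ands\<close>)
  moreover have "?D \<tturnstile> ?R i" by (rule ent_Ands) (use i in auto)
  moreover have "IAt_tuple (?n # ws @ fs) \<tturnstile> And ?P ?I"
    by (auto intro!: ent_conjI intro: ent_conj1 ent_conj2)
  ultimately have "IAt_tuple (?n # ws @ fs) \<tturnstile> ?R i" using ent_trans by blast
  then have "IAt_tuple (?n # ws @ fs) \<tturnstile> IAt (\<sigma>s ! i) (Apps (Con (cRec \<sigma>s i)) (map Var (?n # ws @ fs)))"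
    by (simp add: rec_tm_def)
  from ent_IAt_const[OF this \<open>distinct (?n # ws @ fs)\<close>] show ?thesis by (simp add: ws fs)
qed

lemma ent_cst:
  assumes "ha_cst c" shows "Top \<tturnstile> IAt (cst_ty c) (Con c)"
proof (cases c)
  case cZero then show ?thesis using ent_cZero by simp
next
  case cSuc then show ?thesis using ent_cSuc by simp
next
  case cPi then show ?thesis using ent_cPi by simp
next
  case cSigma then show ?thesis using ent_cSigma by simp
next
  case cRec then show ?thesis using ent_cRec assms by simp
next
  case cB0 then show ?thesis by (auto intro: ent_top)
next
  case cB1 then show ?thesis by (auto intro: ent_top)
next
  case cCond then show ?thesis using ent_cCond by simp
qed (use assms in auto)

lemma ent_application:
  assumes "x = (0, \<sigma>)" "f = (1, \<sigma> \<Rrightarrow> \<tau>)"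
  shows "Top \<tturnstile> All x (All f (Imp (And (IAt \<sigma> (Var x)) (IAt (\<sigma> \<Rrightarrow> \<tau>) (Var f))) (IAt \<tau> (App (Var f) (Var x)))))"
proof -
  let ?A = "And (IAt \<sigma> (Var x)) (IAt (\<sigma> \<Rrightarrow> \<tau>) (Var f))"
  have "?A \<tturnstile> IAt \<tau> (App (Var f) (Var x))"
    by (rule ent_IAt_app[OF ent_conj2 ent_conj1]) (simp add: assms has_type.intros)
  then have "And Top ?A \<tturnstile> IAt \<tau> (App (Var f) (Var x))" by (rule ent_weaken2)
  then show ?thesis by (intro ent_allI ent_impI) auto
qed

text \<open>Realizers that are uniform in the free variables remain realizers under the premises
  \<open>\<I>(x)\<close>: these are added by weakening, and the quantifiers by
  generalization.\<close>

lemma I_interpretableI: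
  assumes "fm_ok A" "Top \<tturnstile> relativize A" shows "I_interpretable S I_cb A"
proof -
  let ?xs = "remdups (fv A)"
  have ok: "fm_ok (Alls vs B) = fm_ok B" for vs B by (induction vs) auto
  have ok': "fm_ok (IAt_tuple vs)" for vs by (induction vs) (auto intro: has_type_Var)
  have "Top \<tturnstile> Imp (IAt_tuple ?xs) (relativize A)" by (intro ent_impI ent_weaken1 assms)
  then have "Top \<tturnstile> Alls vs (Imp (IAt_tuple ?xs) (relativize A))" for vs
    by (induction vs) (auto intro: ent_allI)
  then show ?thesis unfolding I_interpretable_def Let_def
    by (intro U_interpretableI) (use assms(1) in \<open>auto simp: ok ok' fm_ok_relativize\<close>)
qed

section \<open>Realizers for the axioms\<close>

lemma ent_Eq: "(\<And>e. valuation S e \<Longrightarrow> tm_val S e s = tm_val S e t) \<Longrightarrow> Top \<tturnstile> Eq \<sigma> s t"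
  by (rule ent_top) auto

text \<open>If the two values are equal, both instances have the same realizers, so the witnesses of
  the first are handed over as they are.\<close>

lemma ent_eq_repl:
  assumes "free_for z (Var x) A" "free_for z (Var y) A"
  shows "And (Eq \<sigma> (Var x) (Var y)) (subst z (Var x) A) \<tturnstile> subst z (Var y) A"
  by (rule ent_semI) (auto simp: sem_subst[OF assms(1)] sem_subst[OF assms(2)])

lemma ent_bool_cases:
  assumes i: "snd i = TB"
  shows "And (subst i (Con cB0) A) (subst i (Con cB1) A) \<tturnstile> A"
proof (rule ent_join[OF ent_conj1 ent_conj2])
  fix e assume "valuation S e"
  then have "e i \<in> obj S TB" using i unfolding valuation_def by metis
  \<comment> \<open>Resetting \<open>i\<close> to the Boolean that it already denotes leaves the
    valuation unchanged; this identifies \<open>A\<close> with one of its two instances.\<close>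
  then have "e = e(i := bl S False) \<or> e = e(i := bl S True)"
    by (elim bl_cases) (metis fun_upd_triv)+
  moreover have "free_for i (Con c) A" for c by (rule free_for_self) simp
  ultimately show "sem A e = sem (subst i (Con cB0) A) e \<or> sem A e = sem (subst i (Con cB1) A) e"
    by (simp add: sem_subst) metis
qed simp_all

text \<open>Base and step together form the side formula of the induction rule. In it
  \<open>n\<close> is not free, being substituted away in the base and bound in the step.\<close>

lemma ent_induction_axiom:
  fixes A :: fm
  assumes n: "snd n = TN"
  shows "And (subst n (Con cZero) A)
      (All n (Imp (IAt TN (Var n)) (Imp A (subst n (App (Con cSuc) (Var n)) A))))
    \<tturnstile> All n (Imp (IAt TN (Var n)) A)" (is "And ?A0 ?AS \<tturnstile> _")
proof -
  let ?P = "And ?A0 ?AS" and ?I = "IAt TN (Var n)" and ?S = "subst n (App (Con cSuc) (Var n)) A"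
  have fr: "n \<notin> set (fv ?P)" using fv_subst[of n "Con cZero" A] by simp
  have "And ?P ?I \<tturnstile> A"
  proof (rule ent_induction_rule[OF n fr])
    show "And (And ?P ?I) A \<tturnstile> ?S"
    proof (rule ent_mp, rule ent_mp)
      \<comment> \<open>The universal step is instantiated at the current value of \<open>n\<close>,
        which leaves the valuation as it is.\<close>
      have "?AS \<tturnstile> Imp ?I (Imp A ?S)"
      proof (rule ent_allE)
        fix e assume "valuation S e"
        then have "e n \<in> obj S (snd n)" unfolding valuation_def by metis
        then show "\<exists>u\<in>obj S (snd n). sem (Imp ?I (Imp A ?S)) e = sem (Imp ?I (Imp A ?S)) (e(n := u))"
          by (metis fun_upd_triv)
      qed simp_all
      then show "And (And ?P ?I) A \<tturnstile> Imp ?I (Imp A ?S)" by (intro ent_weaken1 ent_weaken2)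
      show "And (And ?P ?I) A \<tturnstile> ?I" by (intro ent_weaken1 ent_conj2)
      show "And (And ?P ?I) A \<tturnstile> A" by (rule ent_conj2)
    qed
  qed (auto intro: free_for_self ent_conj1)
  with fr show ?thesis by (intro ent_allI ent_impI)
qed

lemma I_interpretable_axiom: "ha_axiom A \<Longrightarrow> I_interpretable S I_cb A"
proof (induction rule: ha_axiom.induct)
  case (eq_refl \<sigma> x)
  then show ?case by (intro I_interpretableI) (auto intro: ent_Eq has_type.intros)
next
  case (eq_repl \<sigma> A z x y)
  have "And (Eq \<sigma> (Var (x, \<sigma>)) (Var (y, \<sigma>))) (subst (z, \<sigma>) (Var (x, \<sigma>)) (relativize A))
     \<tturnstile> subst (z, \<sigma>) (Var (y, \<sigma>)) (relativize A)"
    using eq_repl by (intro ent_eq_repl free_for_relativize)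
  then show ?case using ha_fm_ok[OF eq_repl(2)]
    by (intro I_interpretableI)
      (auto simp: relativize_subst intro!: ent_impI fm_ok_subst has_type.intros intro: ent_weaken2)
next
  case (Pi \<rho> \<sigma> x y)
  have "has_type (Apps (Con (cPi \<rho> \<sigma>)) [Var (x, \<rho>), Var (y, \<sigma>)]) \<rho>"
    by (rule has_type_Apps[of _ "[\<rho>, \<sigma>]"]) (auto intro: has_type_Con has_type.intros(1))
  then show ?case
    by (intro I_interpretableI) (auto intro!: ent_Eq has_type.intros(1) simp: valuation_def Pi_ap)
next
  case (Sigma \<rho> \<sigma> \<tau> vx x vy y vz z)
  then have t: "has_type (Var vx) (\<rho> \<Rrightarrow> \<sigma> \<Rrightarrow> \<tau>)" "has_type (Var vy) (\<rho> \<Rrightarrow> \<sigma>)" "has_type (Var vz) \<rho>"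
    by (auto intro: has_type.intros)
  have l: "has_type (Apps (Con (cSigma \<rho> \<sigma> \<tau>)) [Var vx, Var vy, Var vz]) \<tau>"
    by (rule has_type_Apps[of _ "[\<rho> \<Rrightarrow> \<sigma> \<Rrightarrow> \<tau>, \<rho> \<Rrightarrow> \<sigma>, \<rho>]"]) (auto intro: has_type_Con t)
  have r: "has_type (App (App (Var vx) (Var vz)) (App (Var vy) (Var vz))) \<tau>"
    using t by (meson has_type.intros(3))
  show ?case
  proof (rule I_interpretableI)
    show "Top \<tturnstile> relativize (Eq \<tau> (Apps (Con (cSigma \<rho> \<sigma> \<tau>)) [Var vx, Var vy, Var vz])
       (App (App (Var vx) (Var vz)) (App (Var vy) (Var vz))))"
      unfolding relativize.simps using t
      by (intro ent_Eq) (use Sigma in \<open>simp add: valuation_def Sigma_ap\<close>)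
  qed (use l r in simp)
next
  case (suc_inj x y)
  have "Top \<tturnstile> Imp (Eq TN (App (Con cSuc) (Var (x, TN))) (App (Con cSuc) (Var (y, TN))))
                   (Eq TN (Var (x, TN)) (Var (y, TN)))"
  proof (rule ent_top)
    fix e d assume "valuation S e"
    then have "e (x, TN) \<in> obj S TN" "e (y, TN) \<in> obj S TN" by (auto simp: valuation_def)
    then show "sem (Imp (Eq TN (App (Con cSuc) (Var (x, TN))) (App (Con cSuc) (Var (y, TN))))
                   (Eq TN (Var (x, TN)) (Var (y, TN)))) e [] d"
      by (auto simp: imps_def Suc_ap elim!: num_cases)
  qed simp
  then show ?case
    by (intro I_interpretableI) (auto intro!: has_type.intros(1) has_type.intros(3)[of _ TN] has_type_Con)
next
  case (zero_suc x)
  have "Top \<tturnstile> Neg (Eq TN (App (Con cSuc) (Var (x, TN))) (Con cZero))"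
  proof (rule ent_top)
    fix e d assume "valuation S e"
    then have "e (x, TN) \<in> obj S TN" by (auto simp: valuation_def)
    then show "sem (Neg (Eq TN (App (Con cSuc) (Var (x, TN))) (Con cZero))) e [] d"
      by (auto simp: imps_def Suc_ap)
  qed simp
  then show ?case
    by (intro I_interpretableI) (auto intro!: has_type.intros(1) has_type.intros(3)[of _ TN] has_type_Con)
next
  case (rec_zero \<sigma>s i ws fs)
  have w: "snd (ws ! i) = \<sigma>s ! i" "length ws = length \<sigma>s" using rec_zero(2,3) by (metis length_map nth_map)+
  have z: "has_type (Con cZero) TN" by (rule has_type_Con) simp_all
  have "Top \<tturnstile> Eq (\<sigma>s ! i) (rec_tm \<sigma>s ws fs (Con cZero) i) (Var (ws ! i))"
    using rec_tm_val[OF rec_zero(3,4,2), of _ "Con cZero"] rec_zero(2) w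
    by (intro ent_Eq) simp
  moreover have "has_type (Var (ws ! i)) (\<sigma>s ! i)" using has_type_Var[of "ws ! i"] w by simp
  ultimately show ?case
    using rec_tm_type[OF rec_zero(3,4) z rec_zero(2)]
    by (intro I_interpretableI) (simp_all add: rec_tm_def)
next
  case (rec_suc \<sigma>s i ws fs n)
  let ?n = "Var (n, TN)"
  let ?t = "Apps (Var (fs ! i)) (?n # map (rec_tm \<sigma>s ws fs ?n) [0..<length \<sigma>s])"
  have lf: "length fs = length \<sigma>s" using rec_suc(4) by (metis length_map step_tys_def)
  have n: "has_type ?n TN" by (rule has_type.intros)
  then have sn: "has_type (App (Con cSuc) ?n) TN" by (auto intro!: has_type.intros(3)[of _ TN] has_type_Con)
  have "snd (fs ! i) = step_tys \<sigma>s ! i" using rec_suc lf by (metis nth_map)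
  then have "has_type (Var (fs ! i)) (Fns (TN # \<sigma>s) (\<sigma>s ! i))"
    using has_type_Var[of "fs ! i"] rec_suc(2) by (simp add: step_tys_def)
  moreover have "list_all2 has_type (map (rec_tm \<sigma>s ws fs ?n) [0..<length \<sigma>s]) \<sigma>s"
    by (simp add: list_all2_conv_all_nth rec_tm_type[OF rec_suc(3,4) n])
  ultimately have t: "has_type ?t (\<sigma>s ! i)"
    by (intro has_type_Apps[of _ "TN # \<sigma>s"]) (simp_all add: n)
  have "Top \<tturnstile> Eq (\<sigma>s ! i) (rec_tm \<sigma>s ws fs (App (Con cSuc) ?n) i) ?t"
    by (intro ent_Eq rec_tm_Suc_val rec_suc) (auto simp: valuation_def)
  then show ?case
    using rec_tm_type[OF rec_suc(3,4) sn rec_suc(2)] t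
    by (intro I_interpretableI) (simp_all add: rec_tm_def[abs_def])
next
  case bool_distinct
  have "Top \<tturnstile> Neg (Eq TB (Con cB0) (Con cB1))"
    by (rule ent_top) (auto simp: imps_def)
  then show ?case by (intro I_interpretableI) (auto intro: has_type_Con)
next
  case (bool_cases D i)
  let ?A = "relativize D"
  let ?P = "And (subst (i, TB) (Con cB0) ?A) (subst (i, TB) (Con cB1) ?A)"
  have "(i, TB) \<notin> set (fv ?P)" using fv_subst[of "(i, TB)"] by simp
  \<comment> \<open>\<open>\<I>\<close> at \<open>TB\<close> has no witnesses and says nothing about
    \<open>i\<close>. The relativizing premise is therefore added by weakening, and the join does
    the work.\<close>
  then have "?P \<tturnstile> All (i, TB) (Imp (IAt TB (Var (i, TB))) ?A)"
    by (intro ent_allI ent_impI ent_weaken1 ent_bool_cases) auto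
  then show ?case using ha_fm_ok[OF bool_cases]
    by (intro I_interpretableI)
      (auto simp: relativize_subst intro!: ent_impI fm_ok_subst has_type_Con intro: ent_weaken2)
next
  case (cond_0 \<sigma> x y)
  have "has_type (Apps (Con (cCond \<sigma>)) [Con cB0, Var (x, \<sigma>), Var (y, \<sigma>)]) \<sigma>"
    by (rule has_type_Apps[of _ "[TB, \<sigma>, \<sigma>]"]) (auto intro: has_type_Con has_type.intros(1))
  then show ?case
    by (intro I_interpretableI) (auto intro!: ent_Eq has_type.intros(1) simp: valuation_def Cond_ap)
next
  case (cond_1 \<sigma> x y)
  have "has_type (Apps (Con (cCond \<sigma>)) [Con cB1, Var (x, \<sigma>), Var (y, \<sigma>)]) \<sigma>"
    by (rule has_type_Apps[of _ "[TB, \<sigma>, \<sigma>]"]) (auto intro: has_type_Con has_type.intros(1))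
  then show ?case
    by (intro I_interpretableI) (auto intro!: ent_Eq has_type.intros(1) simp: valuation_def Cond_ap)
next
  case (induction D n)
  have "has_type (App (Con cSuc) (Var (n, TN))) TN"
    by (auto intro!: has_type.intros(1) has_type.intros(3)[of _ TN] has_type_Con)
  then show ?case using ent_induction_axiom[of "(n, TN)" "relativize D"] ha_fm_ok[OF induction]
    by (intro I_interpretableI)
      (auto simp: relativize_subst intro!: ent_impI fm_ok_subst has_type_Con intro: ent_weaken2)
qed

end

theorem theorem8p21:
  fixes S :: "'u type_structure"
  assumes "full_structure S"
  shows "sound_type_informative_base_interp S I_cb"
proof -
  interpret full S using assms by unfold_locales
  have ok: "cst_ok c" if "ha_cst c" for c using that by (cases c) auto
  show ?thesis unfolding sound_type_informative_base_interp_def Let_def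
  proof (intro conjI allI impI)
    fix c assume "ha_cst c"
    then show "U_interpretable S I_cb (IAt (cst_ty c) (Con c))"
      using ok by (intro U_interpretableI ent_cst) (auto intro: has_type.intros)
  next
    fix \<sigma> \<tau>
    show "U_interpretable S I_cb (All (0, \<sigma>) (All (1, \<sigma> \<Rrightarrow> \<tau>)
       (Imp (And (IAt \<sigma> (Var (0, \<sigma>))) (IAt (\<sigma> \<Rrightarrow> \<tau>) (Var (1, \<sigma> \<Rrightarrow> \<tau>))))
         (IAt \<tau> (App (Var (1, \<sigma> \<Rrightarrow> \<tau>)) (Var (0, \<sigma>)))))))"
      by (intro U_interpretableI ent_application refl) (auto intro: has_type.intros)
  next
    fix A assume "ha_axiom A"
    then show "I_interpretable S I_cb A" by (rule I_interpretable_axiom)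
  qed
qed

end
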